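(* Let $\mathbb{F}$ be a prime field with $\mathrm{char}(\mathbb{F})>4$ and let $f \in \mathbb{F}[x_1,\ldots,x_n]$ be a degree four polynomial with $\|f\|_{U^4}=\delta$. Then $$f = \sum_{i=1}^{R} \ell_i\cdot g_i + \sum_{i=1}^{r} q_i \cdot q'_i$$ for some $r=O(\log^2(1/\delta))$ and $R=\exp(O(\log^2(1/\delta)))$, where each $\ell_i$ is linear, each $q_i,q'_i$ is quadratic and each $g_i$ is cubic.
   Context: For $f:\mathbb{F}^n\to\mathbb{F}$ and $y\in\mathbb{F}^n$, $\Delta_y(f)(x)=f(x+y)-f(x)$. The $d$-th Gowers norm is $\|f\|_{U^d} = \left|\mathbb{E}_{x,y_1,\ldots,y_d\in\mathbb{F}^n}[\omega^{\Delta_{y_d}\cdots\Delta_{y_1}(f)(x)}]\right|^{1/2^d}$ with $\omega=e^{2\pi i/|\mathbb{F}|}$. Polynomials are identified with the functions $\mathbb{F}^n\to\mathbb{F}$ they define (i.e. one works modulo $x_i^{p}-x_i$, $p=|\mathbb{F}|$), and the degree of a function is the least degree of a polynomial representing it. In the conclusion, "linear", "quadratic", "cubic" mean degree at most $1,2,3$ (linear functions may have a constant term). The implied constants in $O(\cdot)$ may depend on the fixed field $\mathbb{F}$ but not on $n$, $f$ or $\delta$. *)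

theory Defs
  imports
    Complex_Main
    "HOL-Library.Poly_Mapping"
    "Berlekamp_Zassenhaus.Finite_Field"
    "Jordan_Normal_Form.Matrix"
begin

text \<open>
  The prime field with \<open>p = CARD('p)\<close> elements is \<open>'p mod_ring\<close>, and its \<open>n\<close>-th power is
  \<open>carrier_vec n\<close>. A function on that power is a function on all vectors, of which only the
  values on \<open>carrier_vec n\<close> matter. The dimension is a term, not a type, so that
  constants can be chosen before \<open>n\<close>.
\<close>

type_synonym 'p vfun = "'p mod_ring vec \<Rightarrow> 'p mod_ring"

type_synonym 'p mv_poly = "(nat \<Rightarrow>\<^sub>0 nat) \<Rightarrow>\<^sub>0 'p mod_ring"

definition mv_polys :: "nat \<Rightarrow> 'p::prime_card mv_poly set" where
  "mv_polys n = {P. \<forall>m\<in>Poly_Mapping.keys P. Poly_Mapping.keys m \<subseteq> {..<n}}"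

definition mv_eval :: "'p::prime_card mv_poly \<Rightarrow> 'p vfun" where
  "mv_eval P x =
    (\<Sum>m\<in>Poly_Mapping.keys P. Poly_Mapping.lookup P m *
      (\<Prod>i\<in>Poly_Mapping.keys m. (x $ i) ^ Poly_Mapping.lookup m i))"

text \<open>The zero polynomial gets total degree 0.\<close>

definition total_deg :: "'p::prime_card mv_poly \<Rightarrow> nat" where
  "total_deg P =
    Max (insert 0
      ((\<lambda>m. \<Sum>i\<in>Poly_Mapping.keys m. Poly_Mapping.lookup m i) ` Poly_Mapping.keys P))"

text \<open>
  The set below is never empty, since every function on the finite set \<open>carrier_vec n\<close> is
  given by a polynomial.
\<close>

definition fun_degree :: "nat \<Rightarrow> 'p::prime_card vfun \<Rightarrow> nat" where
  "fun_degree n f =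
    (LEAST d. \<exists>P\<in>mv_polys n. total_deg P = d \<and> (\<forall>x\<in>carrier_vec n. f x = mv_eval P x))"

definition additive_char :: "'p::prime_card mod_ring \<Rightarrow> complex" where
  "additive_char a =
    exp (2 * of_real pi * \<i> / of_nat CARD('p)) powi (to_int_mod_ring a)"

definition deriv_dir :: "'p::prime_card mod_ring vec \<Rightarrow> 'p vfun \<Rightarrow> 'p vfun" where
  "deriv_dir y f = (\<lambda>x. f (x + y) - f x)"

definition average :: "'a set \<Rightarrow> ('a \<Rightarrow> complex) \<Rightarrow> complex" where
  "average A g = (\<Sum>a\<in>A. g a) / of_nat (card A)"

text \<open>
  The directions form a list \<open>[y\<^sub>1, \<dots>, y\<^sub>d]\<close>; \<open>fold\<close> applies the derivative along
  \<open>y\<^sub>1\<close> first.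
\<close>

definition gowers_norm :: "nat \<Rightarrow> nat \<Rightarrow> 'p::prime_card vfun \<Rightarrow> real" where
  "gowers_norm n d f =
    root (2 ^ d) (cmod (average
      (carrier_vec n \<times> {ys. length ys = d \<and> set ys \<subseteq> carrier_vec n})
      (\<lambda>(x, ys). additive_char (fold deriv_dir ys f x))))"

end

theory Submission
  imports Defs "HOL-Library.Function_Algebras"
begin

text \<open>
  Up to a function of degree at most three, \<open>f x = T(x,x,x,x) / 24\<close> for the symmetric 4-linear form \<open>T\<close>
  given by the fourth derivative, and \<open>\<delta>\<^sup>1\<^sup>6\<close> is the density of the triples \<open>(z,u,v)\<close> with
  \<open>T(-,z,u,v) = 0\<close>. Write \<open>k = log (1/\<delta>)\<close>. A Fourier argument and a doubling argument give a subspace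
  \<open>V\<close> of codimension \<open>exp O(k)\<close> such that for every \<open>y \<in> V\<close> the slices \<open>T(y,z,-,-)\<close> have rank at most
  \<open>exp O(k)\<close> for all \<open>z\<close> in a subspace of codimension \<open>O(k)\<close> that depends on \<open>y\<close>. The key step
  (\<open>exists_common_span\<close>) turns this into a single subspace on which all slices lie, up to rank
  \<open>exp O(k\<^sup>2)\<close>, in the span of \<open>O(k\<^sup>2)\<close> fixed bilinear forms \<open>Q\<^sub>i\<close>. If no combination of the \<open>Q\<^sub>i\<close> has low
  rank, the coefficients are bilinear forms \<open>\<alpha>\<^sub>i\<close>. Subtracting the terms \<open>\<alpha>\<^sub>i Q\<^sub>i\<close> in the three possible
  ways leaves a form all of whose slices have low rank, and such a form vanishes on a subspace \<open>U\<close> of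
  codimension polynomial in the rank. Hence \<open>T(x,x,x,x) = 3 \<Sum>\<^sub>i \<alpha>\<^sub>i(x,x) Q\<^sub>i(x,x)\<close> on \<open>U\<close>, and a linear
  projection to \<open>U\<close> changes \<open>f\<close> by products of a linear and a cubic function, one for each
  codimension.
\<close>

section \<open>Subspaces of finite index\<close>

text \<open>Only the number of fixed forms enters \<open>r\<close>; every other loss enters
  \<open>R\<close> and may be exponential. So the codimension of \<open>V\<close>, the ranks and the
  regularisation can be wasteful, while the subspaces that depend on \<open>y\<close> must have
  codimension O(k): codimension m yields up to m^2 forms. The obstacle is that these subspaces vary
  with \<open>y\<close> without any structure; they are replaced by a single one at the price of
  adjoining finitely many slices to the span. The coefficients of the fixed forms are unique only in
  the absence of relations modulo low rank, so a form that takes part in such a relation is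
  discarded, which multiplies the admissible error by 4. With O(k^2) forms this is the source of exp
  O(k^2). Characteristic above 4 permits the division by 24. Degree exactly four makes
  \<open>T\<close> nonzero, whence \<delta>^16 \<le> 7/8; this gap below 1 lets additive constants
  be absorbed into multiples of log^2 (1/\<delta>).\<close>

lemma card_le_mult_fibers:
  assumes "finite X" "finite Y" "f ` X \<subseteq> Y"
    and "\<And>y. y \<in> Y \<Longrightarrow> card {x \<in> X. f x = y} \<le> k"
  shows "card X \<le> card Y * k"
proof -
  have "card X = (\<Sum>y\<in>Y. card {x \<in> X. f x = y})"
    using sum.group[OF assms(1,2,3), of "\<lambda>_. 1::nat"] by simp
  also have "\<dots> \<le> card Y * k"
    using sum_bounded_above[of Y "\<lambda>y. card {x \<in> X. f x = y}" k] assms(4) by simp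
  finally show ?thesis .
qed

text \<open>
  Codimension is measured in base 2 whatever the field: a proper subspace has at most half of the
  elements, and a kernel of a functional has index at most \<open>p \<le> 2 ^ p\<close>.
\<close>

definition index_le :: "nat \<Rightarrow> 'a set \<Rightarrow> 'a set \<Rightarrow> bool" where
  "index_le m A B \<longleftrightarrow> card A \<le> 2 ^ m * card B"

lemma index_le_refl: "index_le m A A"
  by (simp add: index_le_def)

lemma index_le_trans: "index_le m A B \<Longrightarrow> index_le k B C \<Longrightarrow> index_le (m + k) A C"
  unfolding index_le_def power_add
  by (metis (no_types, lifting) le_trans mult.assoc mult_le_mono2)

lemma index_le_mono: "index_le m A B \<Longrightarrow> m \<le> k \<Longrightarrow> index_le k A B"
  unfolding index_le_def by (meson le_trans mult_le_mono1 power_increasing one_le_numeral)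

lemma index_le_mono_set: "index_le m A B \<Longrightarrow> B \<subseteq> C \<Longrightarrow> finite C \<Longrightarrow> index_le m A C"
  unfolding index_le_def by (meson card_mono le_trans mult_le_mono2)

locale finite_field_space = vector_space scale
  for scale :: "'a::{field,finite} \<Rightarrow> 'b::ab_group_add \<Rightarrow> 'b"  (infixr \<open>*s\<close> 75)
begin

definition linear_on :: "'b set \<Rightarrow> ('b \<Rightarrow> 'a) \<Rightarrow> bool" where
  "linear_on G g \<longleftrightarrow> (\<forall>x\<in>G. \<forall>y\<in>G. g (x + y) = g x + g y) \<and> (\<forall>c. \<forall>x\<in>G. g (c *s x) = c * g x)"

lemma linear_on_subset: "linear_on G g \<Longrightarrow> H \<subseteq> G \<Longrightarrow> linear_on H g"
  unfolding linear_on_def by blast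

lemma linear_on_add: "linear_on G g \<Longrightarrow> x \<in> G \<Longrightarrow> y \<in> G \<Longrightarrow> g (x + y) = g x + g y"
  unfolding linear_on_def by blast

lemma linear_on_scale: "linear_on G g \<Longrightarrow> x \<in> G \<Longrightarrow> g (c *s x) = c * g x"
  unfolding linear_on_def by blast

lemma linear_on_0: "linear_on G g \<Longrightarrow> subspace G \<Longrightarrow> g 0 = 0"
  by (metis linear_on_scale mult_zero_left scale_zero_left subspace_0)

lemma linear_on_diff:
  assumes "linear_on G g" "subspace G" "x \<in> G" "y \<in> G" shows "g (x - y) = g x - g y"
  using assms linear_on_add[OF assms(1), of "x - y" y] subspace_diff by (simp add: algebra_simps)

lemma linear_on_eq_0_span:
  assumes "linear_on G g" "subspace G" "C \<subseteq> G" "\<And>c. c \<in> C \<Longrightarrow> g c = 0" "x \<in> span C"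
  shows "g x = 0"
proof -
  have "x \<in> G \<and> g x = 0"
    using assms(5)
  proof (induction rule: span_induct_alt)
    case base
    then show ?case using assms linear_on_0 subspace_0 by blast
  next
    case (step c x y)
    then show ?case
      using assms by (auto simp: linear_on_add linear_on_scale subspace_add subspace_scale subset_iff)
  qed
  then show ?thesis ..
qed

lemma subspace_kernel: "linear_on G g \<Longrightarrow> subspace G \<Longrightarrow> subspace {x \<in> G. g x = 0}"
  by (auto simp: subspace_def linear_on_add linear_on_scale dest: linear_on_0[unfolded subspace_def])

lemma card_subspace_double:
  assumes "subspace A" "A \<subset> B" "finite B" "subspace B"
  shows "2 * card A \<le> card B"
proof -
  obtain b where b: "b \<in> B" "b \<notin> A" using assms(2) by blast
  have fin: "finite A" using assms finite_subset by blast
  have disj: "A \<inter> (+) b ` A = {}"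
  proof -
    have "b + a \<notin> A" if "a \<in> A" for a
      using b(2) that assms(1) subspace_diff[of A "b + a" a] by auto
    then show ?thesis by auto
  qed
  have "A \<union> (+) b ` A \<subseteq> B" using assms b(1) by (auto simp: subspace_add)
  then have "card (A \<union> (+) b ` A) \<le> card B" using assms(3) card_mono by blast
  moreover have "card ((+) b ` A) = card A" by (simp add: card_image)
  ultimately show ?thesis using disj fin by (simp add: card_Un_disjoint)
qed

text \<open>Subtraction maps pairs from \<open>A\<close> and \<open>B\<close> into \<open>H\<close>,
  and two pairs with the same difference have first components that differ by an element of
  \<open>A \<inter> B\<close>. The product form avoids division when codimensions are
  combined.\<close>

lemma card_mult_le_card_Int:
  assumes "subspace A" "subspace B" "subspace H" "A \<subseteq> H" "B \<subseteq> H" "finite H"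
  shows "card A * card B \<le> card H * card (A \<inter> B)"
proof -
  have fin: "finite A" "finite B" using assms finite_subset by blast+
  have "card {x \<in> A \<times> B. fst x - snd x = h} \<le> card (A \<inter> B)" for h
  proof (cases "{x \<in> A \<times> B. fst x - snd x = h} = {}")
    case False
    then obtain a b where ab: "a \<in> A" "b \<in> B" "a - b = h" by auto
    show ?thesis
    proof (rule card_inj_on_le[where f = "\<lambda>x. fst x - a"])
      show "inj_on (\<lambda>x. fst x - a) {x \<in> A \<times> B. fst x - snd x = h}"
        by (rule inj_onI) (auto simp: prod_eq_iff)
      have "a' - a \<in> B" if "b' \<in> B" "a' - b' = h" for a' b'
      proof -
        have "a' - a = b' - b" using that(2) ab(3) by (simp add: algebra_simps)
        then show ?thesis using that ab assms(2) subspace_diff by simp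
      qed
      then show "(\<lambda>x. fst x - a) ` {x \<in> A \<times> B. fst x - snd x = h} \<subseteq> A \<inter> B"
        using assms(1) ab subspace_diff by auto
      show "finite (A \<inter> B)" using fin by simp
    qed
  next
    case True
    show ?thesis unfolding True by simp
  qed
  then have "card (A \<times> B) \<le> card H * card (A \<inter> B)"
    using fin assms by (intro card_le_mult_fibers[where f = "\<lambda>x. fst x - snd x"])
      (auto intro!: subspace_diff[OF assms(3)])
  then show ?thesis by (simp add: card_cartesian_product)
qed

lemma card_subspace_pos: "subspace A \<Longrightarrow> finite A \<Longrightarrow> 0 < card A"
  using subspace_0 card_gt_0_iff by blast

lemma index_le_restrict:
  assumes "subspace A" "subspace B" "subspace H" "A \<subseteq> H" "B \<subseteq> H" "finite H" "index_le m H A"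
  shows "index_le m B (A \<inter> B)"
proof -
  have "card A * card B \<le> card H * card (A \<inter> B)" using assms card_mult_le_card_Int by blast
  also have "\<dots> \<le> card A * (2 ^ m * card (A \<inter> B))"
    using assms(7) unfolding index_le_def by (simp add: mult.commute mult.left_commute)
  finally show ?thesis unfolding index_le_def
    using card_subspace_pos[of A] assms(1,4,6) finite_subset by fastforce
qed

lemma index_le_Int:
  assumes "subspace A" "subspace B" "subspace H" "A \<subseteq> H" "B \<subseteq> H" "finite H"
    "index_le m H A" "index_le k H B"
  shows "index_le (m + k) H (A \<inter> B)"
  using index_le_trans[OF assms(8) index_le_restrict[OF assms(1-7)]] by (simp add: add.commute)

lemma index_le_kernel:
  assumes "linear_on G g" "subspace G" "finite G"
  shows "index_le (CARD('a)) G {x \<in> G. g x = 0}"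
proof -
  have fiber: "card {x \<in> G. g x = c} \<le> card {x \<in> G. g x = 0}" for c
  proof (cases "{x \<in> G. g x = c} = {}")
    case False
    then obtain a where a: "a \<in> G" "g a = c" by auto
    show ?thesis
    proof (rule card_inj_on_le[where f = "\<lambda>x. x - a"])
      show "(\<lambda>x. x - a) ` {x \<in> G. g x = c} \<subseteq> {x \<in> G. g x = 0}"
        using a assms by (auto simp: linear_on_diff subspace_diff)
    qed (use assms in \<open>auto simp: inj_on_def\<close>)
  next
    case True
    show ?thesis unfolding True by simp
  qed
  have "card G \<le> CARD('a) * card {x \<in> G. g x = 0}"
    by (rule card_le_mult_fibers[where f = g]) (use fiber assms in auto)
  also have "CARD('a) \<le> 2 ^ CARD('a)" by (simp add: less_imp_le)
  finally show ?thesis by (simp add: index_le_def)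
qed

lemma index_le_kernels:
  assumes "finite P" "\<And>g. g \<in> P \<Longrightarrow> linear_on G g" "subspace G" "finite G"
  shows "subspace {x \<in> G. \<forall>g\<in>P. g x = 0} \<and> index_le (CARD('a) * card P) G {x \<in> G. \<forall>g\<in>P. g x = 0}"
  using assms(1,2)
proof (induction P rule: finite_induct)
  case empty
  then show ?case using assms by (simp add: index_le_def)
next
  case (insert g P)
  have "{x \<in> G. \<forall>h\<in>insert g P. h x = 0} = {x \<in> G. g x = 0} \<inter> {x \<in> G. \<forall>h\<in>P. h x = 0}" by auto
  moreover have "subspace {x \<in> G. g x = 0}" using insert.prems assms subspace_kernel by simp
  moreover have "index_le (CARD('a) + CARD('a) * card P) G
      ({x \<in> G. g x = 0} \<inter> {x \<in> G. \<forall>h\<in>P. h x = 0})"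
    by (rule index_le_Int) (use insert assms subspace_kernel index_le_kernel in auto)
  ultimately show ?case using insert subspace_inter by simp
qed

lemma index_le_Inter:
  assumes "finite I" "\<And>i. i \<in> I \<Longrightarrow> subspace (A i) \<and> A i \<subseteq> H \<and> index_le m H (A i)"
    "subspace H" "finite H"
  shows "subspace (H \<inter> (\<Inter>i\<in>I. A i)) \<and> index_le (card I * m) H (H \<inter> (\<Inter>i\<in>I. A i))"
  using assms(1,2)
proof (induction I rule: finite_induct)
  case empty
  then show ?case using assms by (simp add: index_le_def)
next
  case (insert i I)
  have eq: "H \<inter> (\<Inter>j\<in>insert i I. A j) = A i \<inter> (H \<inter> (\<Inter>j\<in>I. A j))" by auto
  have "index_le (m + card I * m) H (A i \<inter> (H \<inter> (\<Inter>j\<in>I. A j)))"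
    by (rule index_le_Int) (use insert assms in auto)
  moreover have "card (insert i I) * m = m + card I * m" using insert.hyps by simp
  moreover have "subspace (A i \<inter> (H \<inter> (\<Inter>j\<in>I. A j)))"
    by (rule subspace_inter) (use insert in auto)
  ultimately show ?case unfolding eq by metis
qed

text \<open>Induction on \<open>m\<close>: adjoin a vector \<open>c\<close> to \<open>U\<close>,
  which at least doubles it, apply the hypothesis to the larger \<open>U'\<close>, and split the
  \<open>c\<close>-component off its projection. The clause \<open>C \<inter> U = {}\<close> serves
  the induction: it keeps the new vector out of \<open>C\<close>. Linearity of \<open>u\<close> and
  \<open>l\<close> is what later bounds the degrees of the correction terms.\<close>

lemma subspace_projection:
  assumes "subspace U" "subspace G" "U \<subseteq> G" "finite G" "index_le m G U"
  shows "\<exists>C u l. C \<subseteq> G \<and> finite C \<and> card C \<le> m \<and> C \<inter> U = {} \<and>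
    (\<forall>x\<in>G. u x \<in> U \<and> x = u x + (\<Sum>c\<in>C. l c x *s c)) \<and> (\<forall>c\<in>C. linear_on G (l c)) \<and>
    (\<forall>x\<in>G. \<forall>y\<in>G. u (x + y) = u x + u y) \<and> (\<forall>a. \<forall>x\<in>G. u (a *s x) = a *s u x)"
  using assms(1,3,5)
proof (induction m arbitrary: U)
  case 0
  then have "U = G" using assms card_seteq[of G U] by (simp add: index_le_def)
  then show ?case by (intro exI[of _ "{}"] exI[of _ "\<lambda>x. x"]) auto
next
  case (Suc m)
  show ?case
  proof (cases "U = G")
    case True
    then show ?thesis by (intro exI[of _ "{}"] exI[of _ "\<lambda>x. x"]) auto
  next
    case False
    then obtain c where c: "c \<in> G" "c \<notin> U" using Suc.prems by blast
    define U' where "U' = {y \<in> G. \<exists>a. y - a *s c \<in> U}"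
    have U_U': "U \<subset> U'"
    proof -
      have "y \<in> U'" if "y \<in> U" for y
        using that Suc.prems by (auto simp: U'_def intro!: exI[of _ 0])
      moreover have "c \<in> U'"
        using c Suc.prems by (auto simp: U'_def subspace_0 intro!: exI[of _ 1])
      ultimately show ?thesis using c by blast
    qed
    have U'_add: "x + y \<in> U' \<and> (x + y) - (a + b) *s c \<in> U"
      if "x \<in> G" "y \<in> G" "x - a *s c \<in> U" "y - b *s c \<in> U" for x y a b
    proof -
      have "(x + y) - (a + b) *s c = (x - a *s c) + (y - b *s c)" by (simp add: scale_left_distrib)
      then have "(x + y) - (a + b) *s c \<in> U" using that Suc.prems(1) subspace_add by presburger
      then show ?thesis using that assms(2) subspace_add by (auto simp: U'_def)
    qed
    have U'_scale: "b *s x \<in> U' \<and> b *s x - (b * a) *s c \<in> U"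
      if "x \<in> G" "x - a *s c \<in> U" for x a b
    proof -
      have "b *s x - (b * a) *s c = b *s (x - a *s c)" by (simp add: scale_right_diff_distrib)
      then have "b *s x - (b * a) *s c \<in> U" using that Suc.prems(1) subspace_scale by presburger
      then show ?thesis using that assms(2) subspace_scale by (auto simp: U'_def)
    qed
    have U': "subspace U'"
    proof (rule subspaceI)
      show "0 \<in> U'" using U_U' subspace_0 Suc.prems by blast
      show "x + y \<in> U'" if "x \<in> U'" "y \<in> U'" for x y using that U'_add by (auto simp: U'_def)
      show "b *s x \<in> U'" if "x \<in> U'" for b x using that U'_scale by (auto simp: U'_def)
    qed
    have U'G: "U' \<subseteq> G" by (auto simp: U'_def)
    have "2 * card U \<le> card U'"
      using card_subspace_double Suc.prems(1) U_U' U'G U' assms(4) finite_subset by blast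
    then have "2 ^ m * (2 * card U) \<le> 2 ^ m * card U'" by (rule mult_le_mono2)
    then have "index_le m G U'" using Suc.prems(3) unfolding index_le_def power_Suc by linarith
    from Suc.IH[OF U' U'G this] obtain C u l where C: "C \<subseteq> G" "finite C" "card C \<le> m" "C \<inter> U' = {}"
      and dec: "\<And>x. x \<in> G \<Longrightarrow> u x \<in> U' \<and> x = u x + (\<Sum>d\<in>C. l d x *s d)"
      and l: "\<And>d. d \<in> C \<Longrightarrow> linear_on G (l d)"
      and u: "\<And>x y. x \<in> G \<Longrightarrow> y \<in> G \<Longrightarrow> u (x + y) = u x + u y" "\<And>a x. x \<in> G \<Longrightarrow> u (a *s x) = a *s u x"
      by blast
    \<comment> \<open>Since \<open>c\<close> is outside \<open>U\<close>, the coefficient of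
      \<open>c\<close> modulo \<open>U\<close> is unique, and uniqueness makes the chosen
      \<open>t\<close> linear.\<close>
    have unique: "a = b" if "y - a *s c \<in> U" "y - b *s c \<in> U" for a b y
    proof (rule ccontr)
      assume "a \<noteq> b"
      have "(b - a) *s c = (y - a *s c) - (y - b *s c)" by (simp add: scale_left_diff_distrib)
      then have "(b - a) *s c \<in> U" using that Suc.prems(1) subspace_diff by presburger
      from subspace_scale[OF Suc.prems(1) this, of "1 / (b - a)"] have "c \<in> U" using \<open>a \<noteq> b\<close> by simp
      then show False using c by simp
    qed
    define t where "t x = (SOME a. u x - a *s c \<in> U)" for x
    have t: "u x - t x *s c \<in> U" if "x \<in> G" for x
    proof -
      have "\<exists>a. u x - a *s c \<in> U" using dec[OF that] by (auto simp: U'_def)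
      then show ?thesis unfolding t_def by (rule someI_ex)
    qed
    have uG: "u x \<in> G" if "x \<in> G" for x using dec[OF that] U'G by blast
    have t_add: "t (x + y) = t x + t y" if "x \<in> G" "y \<in> G" for x y
      using unique[OF t[of "x + y"]] U'_add[OF uG uG t t] that assms(2) u(1) subspace_add by simp
    have t_scale: "t (a *s x) = a * t x" if "x \<in> G" for a x
      using unique[OF t[of "a *s x"]] U'_scale[OF uG t] that assms(2) u(2) subspace_scale by simp
    define l' where "l' = l(c := t)"
    define u' where "u' x = u x - t x *s c" for x
    have cC: "c \<notin> C" using C(4) U_U' c Suc.prems subspace_0[OF Suc.prems(1)]
      by (auto simp: U'_def intro!: exI[of _ 1])
    have "x = u' x + (\<Sum>d\<in>insert c C. l' d x *s d)" if x: "x \<in> G" for x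
    proof -
      have "(\<Sum>d\<in>insert c C. l' d x *s d) = t x *s c + (\<Sum>d\<in>C. l d x *s d)"
        using C(2) cC by (auto simp: l'_def intro!: sum.cong)
      then show ?thesis using dec[OF x] by (simp add: u'_def algebra_simps)
    qed
    moreover have "\<forall>d\<in>insert c C. linear_on G (l' d)"
      using l t_add t_scale by (auto simp: l'_def linear_on_def)
    moreover have "u' (x + y) = u' x + u' y" if "x \<in> G" "y \<in> G" for x y
      using that by (simp add: u'_def u t_add scale_left_distrib)
    moreover have "u' (a *s x) = a *s u' x" if "x \<in> G" for a x
      using that by (simp add: u'_def u t_scale scale_right_diff_distrib)
    moreover have "insert c C \<subseteq> G" "finite (insert c C)" "card (insert c C) \<le> Suc m"
      "insert c C \<inter> U = {}"
      using C c U_U' cC by auto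
    moreover have "u' x \<in> U" if "x \<in> G" for x using t[OF that] by (simp add: u'_def)
    ultimately show ?thesis
      by (intro exI[of _ "insert c C"] exI[of _ u'] exI[of _ l']) blast
  qed
qed

lemma subspace_complement:
  assumes "subspace A" "subspace H" "A \<subseteq> H" "finite H" "index_le m H A"
  shows "\<exists>C\<subseteq>H. finite C \<and> card C \<le> m \<and> H \<subseteq> {a + s | a s. a \<in> A \<and> s \<in> span C}"
proof -
  obtain C u l where C: "C \<subseteq> H" "finite C" "card C \<le> m"
    and dec: "\<And>x. x \<in> H \<Longrightarrow> u x \<in> A \<and> x = u x + (\<Sum>c\<in>C. l c x *s c)"
    using subspace_projection[OF assms] by blast
  have "(\<Sum>c\<in>C. l c x *s c) \<in> span C" for x
    by (intro span_sum span_scale span_base)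
  then have "H \<subseteq> {a + s | a s. a \<in> A \<and> s \<in> span C}" using dec by blast
  then show ?thesis using C by blast
qed
end

section \<open>Level sets of a subadditive rank that are subspaces\<close>

context finite_field_space
begin

text \<open>Read \<open>L a x\<close> as \<open>x\<close> having rank at most \<open>a\<close>.
  Subadditivity alone makes no level set a subspace, but one of density 2^-K can double at most
  \<open>K\<close> times, so growth must stop at one of the scales 5^j * K with j \<le> K.
  \<open>K\<close> is both the starting level and the codimension.\<close>

lemma exists_subspace_level:
  fixes L :: "nat \<Rightarrow> 'b \<Rightarrow> bool"
  assumes G: "subspace G" "finite G"
    and add: "\<And>a b x y. x \<in> G \<Longrightarrow> y \<in> G \<Longrightarrow> L a x \<Longrightarrow> L b y \<Longrightarrow> L (a + b) (x + y)"
    and scl: "\<And>a c x. x \<in> G \<Longrightarrow> L a x \<Longrightarrow> L a (c *s x)"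
    and mono: "\<And>a b x. x \<in> G \<Longrightarrow> L a x \<Longrightarrow> a \<le> b \<Longrightarrow> L b x"
    and zero: "L 0 0"
    and dense: "index_le K G {x \<in> G. L K x}"
  shows "\<exists>c \<le> 2 * (5 ^ K * K). subspace {x \<in> G. L c x} \<and> index_le K G {x \<in> G. L c x}"
proof -
  define N where "N c = {x \<in> G. L c x}" for c
  have finN: "finite (N c)" for c using G by (simp add: N_def)
  have Nmono: "a \<le> b \<Longrightarrow> N a \<subseteq> N b" for a b using mono by (auto simp: N_def)
  have neg: "L a (- x)" if "x \<in> G" "L a x" for a x
    using scl[OF that, of "-1"] by simp
  \<comment> \<open>If the level sets at \<open>2 c\<close> and \<open>4 c\<close> differ, a translate of the one at \<open>c\<close> is disjoint from it, so
    the level set at \<open>5 c\<close> has at least twice as many elements.\<close>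
  have "\<exists>j\<le>K. N (2 * (5 ^ j * K)) = N (4 * (5 ^ j * K))"
  proof (rule ccontr)
    assume contra: "\<not> ?thesis"
    have grow: "2 ^ j * card (N K) \<le> card (N (5 ^ j * K))" if "j \<le> Suc K" for j
      using that
    proof (induction j)
      case (Suc j)
      define c where "c = 5 ^ j * K"
      have "N (2 * c) \<noteq> N (4 * c)" using contra Suc.prems unfolding c_def by simp
      then obtain x where x: "x \<in> N (4 * c)" "x \<notin> N (2 * c)" using Nmono[of "2 * c" "4 * c"] by auto
      have disj: "N c \<inter> (+) x ` N c = {}"
      proof -
        have False if n: "n \<in> N c" "x + n \<in> N c" for n
        proof -
          have "x + n \<in> G" "L c (x + n)" "- n \<in> G" "L c (- n)"
            using n neg G subspace_neg by (auto simp: N_def)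
          from add[OF this(1,3,2,4)] have "L (2 * c) x" by (simp add: mult_2)
          then show False using x by (auto simp: N_def)
        qed
        then show ?thesis by auto
      qed
      have "N c \<union> (+) x ` N c \<subseteq> N (5 * c)"
      proof -
        have "x + n \<in> N (5 * c)" if "n \<in> N c" for n
          using add[of x n "4 * c" c] x that G subspace_add by (auto simp: N_def)
        moreover have "N c \<subseteq> N (5 * c)" by (rule Nmono) simp
        ultimately show ?thesis by blast
      qed
      then have "card (N c \<union> (+) x ` N c) \<le> card (N (5 * c))" using finN card_mono by blast
      moreover have "card (N c \<union> (+) x ` N c) = 2 * card (N c)"
        using disj finN by (subst card_Un_disjoint) (auto simp: card_image)
      ultimately have "2 * card (N c) \<le> card (N (5 * c))" by simp
      moreover have "2 ^ j * card (N K) \<le> card (N c)" using Suc by (simp add: c_def)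
      ultimately show ?case by (simp add: c_def mult.assoc)
    qed simp
    have "card (N (5 ^ Suc K * K)) \<le> card G" using G by (auto intro: card_mono simp: N_def)
    then have "2 ^ Suc K * card (N K) \<le> card G" using grow[of "Suc K"] by simp
    moreover have "card G \<le> 2 ^ K * card (N K)" using dense by (simp add: index_le_def N_def)
    moreover have "0 < card G" using card_subspace_pos G by simp
    ultimately show False by simp
  qed
  then obtain j where j: "j \<le> K" "N (2 * (5 ^ j * K)) = N (4 * (5 ^ j * K))" by blast
  define c where "c = 2 * (5 ^ j * K)"
  have "c + c = 4 * (5 ^ j * K)" by (simp add: c_def)
  then have eq: "N (c + c) = N c" using j(2) by (metis c_def)
  have "subspace (N c)"
  proof (rule subspaceI)
    show "0 \<in> N c" using zero mono[of 0 0 c] G subspace_0 by (simp add: N_def)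
    show "x + y \<in> N c" if "x \<in> N c" "y \<in> N c" for x y
      using add[of x y c c] that eq G subspace_add[of G x y] by (auto simp: N_def)
    show "a *s x \<in> N c" if "x \<in> N c" for a x
      using scl[of x c a] that G subspace_scale[of G x a] by (auto simp: N_def)
  qed
  moreover have "5 ^ j * K \<le> 5 ^ K * K" using j(1) by (simp add: power_increasing)
  moreover have "K \<le> c" unfolding c_def by simp
  then have "index_le K G (N c)" using index_le_mono_set[OF dense] Nmono[of K c] finN
    by (simp add: N_def)
  ultimately show ?thesis unfolding c_def N_def by (intro exI[of _ "2 * (5 ^ j * K)"]) simp
qed

end

section \<open>A common span for a family of linear maps\<close>

locale finite_field_space_to = finite_field_space scale + Z: vector_space scaleZ
  for scale :: "'a::{field,finite} \<Rightarrow> 'b::ab_group_add \<Rightarrow> 'b"  (infixr \<open>*s\<close> 75)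
    and scaleZ :: "'a \<Rightarrow> 'c::ab_group_add \<Rightarrow> 'c"  (infixr \<open>*z\<close> 75)
begin

lemma map_span:
  assumes add: "\<And>e e'. e \<in> H \<Longrightarrow> e' \<in> H \<Longrightarrow> f (e + e') = f e + f e'"
    and scl: "\<And>c e. e \<in> H \<Longrightarrow> f (c *s e) = c *z f e"
    and H: "subspace H" "C \<subseteq> H" and x: "x \<in> span C"
  shows "x \<in> H \<and> f x \<in> Z.span (f ` C)"
  using x
proof (induction rule: span_induct_alt)
  case base
  have "f 0 = 0" using scl[of 0 0] H subspace_0 by simp
  then show ?case using H subspace_0 Z.span_zero by simp
next
  case (step c x y)
  then have "x \<in> H" using H by blast
  moreover have "f x \<in> Z.span (f ` C)" using step Z.span_base by blast
  ultimately show ?case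
    using step add[of "c *s x" y] scl[of x c] H
    by (simp add: subspace_add subspace_scale Z.span_add Z.span_scale)
qed

text \<open>
  Induction on \<open>m\<close>. Suppose that \<open>y1\<close> needs codimension \<open>m\<close> even when three times the error is
  allowed, witnessed by \<open>H1\<close>, and adjoin the values of \<open>a y1\<close> on a complement of \<open>H1\<close> to \<open>Q\<close>. For
  any other \<open>y\<close> with witnesses \<open>G0\<close> for \<open>y\<close> and \<open>G1\<close> for \<open>y + y1\<close>, the map \<open>a y\<close> is now close to the
  span on \<open>(G0 + G1) \<inter> H1\<close>, which has codimension less than \<open>m\<close> in \<open>H1\<close> unless \<open>G0 = G1\<close>; in that
  case \<open>a y1\<close> is close to the span on \<open>G0 + H1\<close>, so \<open>G0 = H1\<close> by the choice of \<open>y1\<close>.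
\<close>

theorem exists_common_span:
  fixes a :: "'y::plus \<Rightarrow> 'b \<Rightarrow> 'c" and L :: "nat \<Rightarrow> 'c \<Rightarrow> bool"
  assumes L_add: "\<And>i j x y. L i x \<Longrightarrow> L j y \<Longrightarrow> L (i + j) (x + y)"
    and L_neg: "\<And>i x. L i x \<Longrightarrow> L i (- x)"
    and L_mono: "\<And>i j x. L i x \<Longrightarrow> i \<le> j \<Longrightarrow> L j x"
    and V: "\<And>y y'. y \<in> V \<Longrightarrow> y' \<in> V \<Longrightarrow> y + y' \<in> V"
    and H: "subspace H" "finite H"
    and a_plus: "\<And>y y' e. y \<in> V \<Longrightarrow> y' \<in> V \<Longrightarrow> e \<in> H \<Longrightarrow> a (y + y') e = a y e + a y' e"
    and a_add: "\<And>y e e'. y \<in> V \<Longrightarrow> e \<in> H \<Longrightarrow> e' \<in> H \<Longrightarrow> a y (e + e') = a y e + a y e'"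
    and a_scl: "\<And>y c e. y \<in> V \<Longrightarrow> e \<in> H \<Longrightarrow> a y (c *s e) = c *z a y e"
    and Q: "finite Q"
    and near: "\<And>y. y \<in> V \<Longrightarrow> \<exists>G\<subseteq>H. subspace G \<and> index_le m H G \<and>
                 (\<forall>e\<in>G. \<exists>q\<in>Z.span Q. L b (a y e - q))"
  shows "\<exists>H' Q'. H' \<subseteq> H \<and> subspace H' \<and> index_le (m\<^sup>2) H H' \<and>
           finite Q' \<and> Q \<subseteq> Q' \<and> Q' \<subseteq> Q \<union> {a y e | y e. y \<in> V \<and> e \<in> H} \<and> card Q' \<le> card Q + m\<^sup>2 \<and>
           (\<forall>y\<in>V. \<forall>e\<in>H'. \<exists>q\<in>Z.span Q'. L (3 ^ m * b) (a y e - q))"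
  using H a_plus a_add a_scl Q near
proof (induction m arbitrary: H Q b)
  case 0
  have "\<exists>q\<in>Z.span Q. L b (a y e - q)" if ye: "y \<in> V" "e \<in> H" for y e
  proof -
    obtain G where G: "G \<subseteq> H" "index_le 0 H G" "\<forall>e\<in>G. \<exists>q\<in>Z.span Q. L b (a y e - q)"
      using "0.prems"(7)[OF ye(1)] by blast
    then have "G = H" using "0.prems"(2) card_seteq[of H G] by (simp add: index_le_def)
    then show ?thesis using G ye by blast
  qed
  then show ?case using 0 by (intro exI[of _ H] exI[of _ Q]) (auto simp: index_le_refl)
next
  case (Suc m)
  note H = Suc.prems(1,2) and a_plus = Suc.prems(3) and a_add = Suc.prems(4)
    and a_scl = Suc.prems(5) and Q = Suc.prems(6) and near = Suc.prems(7)
  have a_diff: "a y (e - e') = a y e - a y e'" if "y \<in> V" "e \<in> H" "e' \<in> H" for y e e'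
    using a_add[OF that(1) _ that(3), of "e - e'"] that H subspace_diff by (simp add: algebra_simps)
  define nr where "nr R i x \<longleftrightarrow> (\<exists>q\<in>Z.span R. L i (x - q))" for R i x
  have nr_add: "nr R (i + j) (x + y)" if xy: "nr R i x" "nr R j y" for R i j x y
  proof -
    obtain q r where "q \<in> Z.span R" "L i (x - q)" "r \<in> Z.span R" "L j (y - r)"
      using xy by (auto simp: nr_def)
    moreover from this have "L (i + j) ((x + y) - (q + r))"
      using L_add[of i "x - q" j "y - r"] by (simp add: algebra_simps)
    ultimately show ?thesis unfolding nr_def using Z.span_add by blast
  qed
  have nr_neg: "nr R i (- x)" if x: "nr R i x" for R i x
  proof -
    obtain q where "q \<in> Z.span R" "L i (x - q)" using x by (auto simp: nr_def)
    moreover from this have "L i (- x - (- q))" using L_neg by fastforce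
    ultimately show ?thesis unfolding nr_def using Z.span_neg by blast
  qed
  have nr_diff: "nr R (i + j) (x - y)" if xy: "nr R i x" "nr R j y" for R i j x y
    using nr_add[OF xy(1) nr_neg[OF xy(2)]] by simp
  have nr_mono: "nr R' j x" if "nr R i x" "i \<le> j" "R \<subseteq> R'" for R R' i j x
    using that L_mono Z.span_mono unfolding nr_def by blast
  have pow: "3 ^ Suc m * b = 3 ^ m * (3 * b)" by simp
  show ?case
  proof (cases "\<exists>y1\<in>V. \<not> (\<exists>G\<subseteq>H. subspace G \<and> index_le m H G \<and> (\<forall>e\<in>G. nr Q (3 * b) (a y1 e)))")
    case False
    then have "\<exists>H' Q'. H' \<subseteq> H \<and> subspace H' \<and> index_le (m\<^sup>2) H H' \<and>
           finite Q' \<and> Q \<subseteq> Q' \<and> Q' \<subseteq> Q \<union> {a y e | y e. y \<in> V \<and> e \<in> H} \<and> card Q' \<le> card Q + m\<^sup>2 \<and>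
           (\<forall>y\<in>V. \<forall>e\<in>H'. \<exists>q\<in>Z.span Q'. L (3 ^ m * (3 * b)) (a y e - q))"
      using H a_plus a_add a_scl Q unfolding nr_def by (intro Suc.IH) blast+
    then obtain H' Q' where *: "H' \<subseteq> H" "subspace H'" "index_le (m\<^sup>2) H H'"
           "finite Q'" "Q \<subseteq> Q'" "Q' \<subseteq> Q \<union> {a y e | y e. y \<in> V \<and> e \<in> H}" "card Q' \<le> card Q + m\<^sup>2"
           "\<forall>y\<in>V. \<forall>e\<in>H'. \<exists>q\<in>Z.span Q'. L (3 ^ m * (3 * b)) (a y e - q)" by blast
    have "m\<^sup>2 \<le> (Suc m)\<^sup>2" by (simp add: power_mono)
    from le_trans[OF *(7) add_left_mono[OF this]] index_le_mono[OF *(3) this]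
    have "card Q' \<le> card Q + (Suc m)\<^sup>2" "index_le ((Suc m)\<^sup>2) H H'" by -
    then show ?thesis unfolding pow
      by (intro exI[of _ H'] exI[of _ Q'] conjI) (assumption | rule *)+
  next
    case True
    then obtain y1 where y1: "y1 \<in> V"
      and max: "\<And>G. G \<subseteq> H \<Longrightarrow> subspace G \<Longrightarrow> index_le m H G \<Longrightarrow> \<forall>e\<in>G. nr Q (3 * b) (a y1 e) \<Longrightarrow> False"
      by blast
    obtain H1 where H1: "H1 \<subseteq> H" "subspace H1" "index_le (Suc m) H H1" "\<forall>e\<in>H1. nr Q b (a y1 e)"
      using near[OF y1] unfolding nr_def by blast
    obtain C where C: "C \<subseteq> H" "finite C" "card C \<le> Suc m"
      "H \<subseteq> {h + s | h s. h \<in> H1 \<and> s \<in> span C}"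
      using subspace_complement[OF H1(2) H(1) H1(1) H(2) H1(3)] by blast
    define Q1 where "Q1 = Q \<union> a y1 ` C"
    have Q1: "finite Q1" "Q \<subseteq> Q1" "Q1 \<subseteq> Q \<union> {a y e | y e. y \<in> V \<and> e \<in> H}"
      "card Q1 \<le> card Q + Suc m"
    proof -
      have "card Q1 \<le> card Q + card (a y1 ` C)" unfolding Q1_def by (rule card_Un_le)
      also have "card (a y1 ` C) \<le> Suc m" using C card_image_le le_trans by blast
      finally show "card Q1 \<le> card Q + Suc m" by simp
    qed (use C Q y1 in \<open>auto simp: Q1_def\<close>)
    have y1_near: "nr Q1 b (a y1 e)" if e: "e \<in> H" for e
    proof -
      obtain h s where hs: "e = h + s" "h \<in> H1" "s \<in> span C" using C(4) e by blast
      have s: "s \<in> H" "a y1 s \<in> Z.span (a y1 ` C)"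
        using map_span[of H "a y1" C s] a_add[OF y1] a_scl[OF y1] H C hs by auto
      obtain q where q: "q \<in> Z.span Q" "L b (a y1 h - q)" using H1 hs by (auto simp: nr_def)
      have "a y1 e - (q + a y1 s) = a y1 h - q" using hs a_add[OF y1, of h s] H1 s by auto
      moreover have "q + a y1 s \<in> Z.span Q1"
        using q s Z.span_mono[of Q Q1] Z.span_mono[of "a y1 ` C" Q1] Z.span_add
        unfolding Q1_def by blast
      ultimately show ?thesis unfolding nr_def using q by metis
    qed
    have finH: "finite G" if "G \<subseteq> H" for G using that H finite_subset by blast
    \<comment> \<open>A proper inclusion would at least double the cardinality and so bring
      \<open>J\<close> to codimension \<open>m\<close>.\<close>
    have collapse: "A = J"
      if "A \<subseteq> J" "J \<subseteq> H" "subspace A" "subspace J" "index_le (Suc m) H A" "\<not> index_le m H J" for A J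
    proof (rule ccontr)
      assume "A \<noteq> J"
      then have "2 * card A \<le> card J" using card_subspace_double that finH by blast
      then have "2 ^ m * (2 * card A) \<le> 2 ^ m * card J" by (rule mult_le_mono2)
      then show False using that(5,6) unfolding index_le_def power_Suc by linarith
    qed
    have sums: "subspace {x + y | x y. x \<in> A \<and> y \<in> B}" "A \<subseteq> {x + y | x y. x \<in> A \<and> y \<in> B}"
      "B \<subseteq> {x + y | x y. x \<in> A \<and> y \<in> B}" "{x + y | x y. x \<in> A \<and> y \<in> B} \<subseteq> H"
      if "subspace A" "subspace B" "A \<subseteq> H" "B \<subseteq> H" for A B
    proof -
      show "subspace {x + y | x y. x \<in> A \<and> y \<in> B}" using subspace_sums that by blast
      show "A \<subseteq> {x + y | x y. x \<in> A \<and> y \<in> B}" using subspace_0[OF that(2)] by force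
      show "B \<subseteq> {x + y | x y. x \<in> A \<and> y \<in> B}" using subspace_0[OF that(1)] by force
      show "{x + y | x y. x \<in> A \<and> y \<in> B} \<subseteq> H" using that H subspace_add by blast
    qed
    have step: "\<exists>G\<subseteq>H1. subspace G \<and> index_le m H1 G \<and> (\<forall>e\<in>G. nr Q1 (3 * b) (a y e))"
      if y: "y \<in> V" for y
    proof -
      obtain G0 where G0: "G0 \<subseteq> H" "subspace G0" "index_le (Suc m) H G0" "\<forall>e\<in>G0. nr Q b (a y e)"
        using near[OF y] unfolding nr_def by blast
      obtain G1 where G1: "G1 \<subseteq> H" "subspace G1" "index_le (Suc m) H G1"
        "\<forall>e\<in>G1. nr Q b (a (y + y1) e)"
        using near[OF V[OF y y1]] unfolding nr_def by blast
      define S where "S = {x + y | x y. x \<in> G0 \<and> y \<in> G1}"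
      have S: "subspace S" "G0 \<subseteq> S" "G1 \<subseteq> S" "S \<subseteq> H"
        unfolding S_def using sums G0 G1 by simp_all
      show ?thesis
      proof (cases "index_le m H S")
        case True
        have "nr Q1 (3 * b) (a y e)" if "e \<in> S" for e
        proof -
          obtain g h where gh: "e = g + h" "g \<in> G0" "h \<in> G1" using \<open>e \<in> S\<close> unfolding S_def by blast
          have h: "h \<in> H" "g \<in> H" using gh G0 G1 by auto
          have 1: "nr Q1 b (a y g)" using G0 gh nr_mono[OF _ order_refl Q1(2)] by blast
          have "nr Q1 b (a (y + y1) h)" using G1 gh nr_mono[OF _ order_refl Q1(2)] by blast
          \<comment> \<open>Here \<open>a y (g + h) = a y g + (a (y + y1) h - a y1 h)\<close>; the
            three errors are the origin of the factor 3.\<close>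
          from nr_add[OF 1 nr_diff[OF this y1_near[OF h(1)]]]
          have "nr Q1 (b + (b + b)) (a y e)" using gh h y y1 by (simp add: a_plus a_add)
          then show ?thesis by (rule nr_mono) simp_all
        qed
        moreover have "subspace (S \<inter> H1)" using S H1 subspace_inter by blast
        moreover have "index_le m H1 (S \<inter> H1)" using index_le_restrict[OF S(1) H1(2) H(1) S(4) H1(1) H(2) True] .
        ultimately show ?thesis by (intro exI[of _ "S \<inter> H1"]) auto
      next
        case False
        then have eq: "G0 = S" "G1 = S" using collapse S G0 G1 by blast+
        define J where "J = {x + y | x y. x \<in> G0 \<and> y \<in> H1}"
        have J: "subspace J" "G0 \<subseteq> J" "H1 \<subseteq> J" "J \<subseteq> H"
          unfolding J_def using sums G0 H1 by simp_all
        have "nr Q (3 * b) (a y1 e)" if "e \<in> J" for e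
        proof -
          obtain g h where gh: "e = g + h" "g \<in> G0" "h \<in> H1" using \<open>e \<in> J\<close> unfolding J_def by blast
          have h: "h \<in> H" "g \<in> H" using gh G0 H1 by auto
          have 1: "nr Q b (a y g)" using G0 gh by blast
          have "nr Q b (a (y + y1) g)" using G1 gh eq by blast
          \<comment> \<open>Here \<open>a y1 (g + h) = (a (y + y1) g - a y g) + a y1 h\<close>; as
            \<open>G0 = G1\<close>, both terms in \<open>g\<close> are under control.\<close>
          from nr_add[OF nr_diff[OF this 1], of b "a y1 h"]
          have "nr Q (b + b + b) (a y1 e)" using gh h y y1 H1 by (simp add: a_plus a_add)
          then show ?thesis by (rule nr_mono) simp_all
        qed
        then have "\<not> index_le m H J" using max J by blast
        then have "G0 = J" "H1 = J" using collapse J G0 H1 by blast+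
        then have "\<forall>e\<in>H1. nr Q1 (3 * b) (a y e)" using G0 nr_mono[OF _ _ Q1(2)] by fastforce
        then show ?thesis using H1 index_le_refl[of m H1] by (intro exI[of _ H1]) simp
      qed
    qed
    have "\<exists>H' Q'. H' \<subseteq> H1 \<and> subspace H' \<and> index_le (m\<^sup>2) H1 H' \<and>
           finite Q' \<and> Q1 \<subseteq> Q' \<and> Q' \<subseteq> Q1 \<union> {a y e | y e. y \<in> V \<and> e \<in> H1} \<and> card Q' \<le> card Q1 + m\<^sup>2 \<and>
           (\<forall>y\<in>V. \<forall>e\<in>H'. \<exists>q\<in>Z.span Q'. L (3 ^ m * (3 * b)) (a y e - q))"
      using step finH[OF H1(1)] H1 Q1 subsetD[OF H1(1)]
      by (intro Suc.IH) (auto simp: nr_def a_plus a_add a_scl)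
    then obtain H' Q' where *: "H' \<subseteq> H1" "subspace H'" "index_le (m\<^sup>2) H1 H'"
           "finite Q'" "Q1 \<subseteq> Q'" "Q' \<subseteq> Q1 \<union> {a y e | y e. y \<in> V \<and> e \<in> H1}" "card Q' \<le> card Q1 + m\<^sup>2"
           "\<forall>y\<in>V. \<forall>e\<in>H'. \<exists>q\<in>Z.span Q'. L (3 ^ m * (3 * b)) (a y e - q)" by blast
    \<comment> \<open>Passing to \<open>H1\<close> costs codimension \<open>Suc m\<close>, and at
      most \<open>Suc m\<close> values are adjoined; the induction hypothesis adds a square to each,
      so one inequality serves both bounds.\<close>
    have sq: "Suc m + m\<^sup>2 \<le> (Suc m)\<^sup>2" by (simp add: power2_eq_square)
    have "index_le ((Suc m)\<^sup>2) H H'" using index_le_mono[OF index_le_trans[OF H1(3) *(3)] sq] .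
    moreover have "card Q' \<le> card Q + (Suc m)\<^sup>2" using *(7) Q1(4) sq by linarith
    moreover have "Q' \<subseteq> Q \<union> {a y e | y e. y \<in> V \<and> e \<in> H}" using *(6) Q1(3) H1(1) by blast
    moreover have "H' \<subseteq> H" "Q \<subseteq> Q'" using *(1,5) H1(1) Q1(2) by simp_all
    ultimately show ?thesis unfolding pow
      by (intro exI[of _ H'] exI[of _ Q'] conjI) (assumption | rule *)+

  qed
qed

end

lemma sum_fun_apply: "(\<Sum>i\<in>I. f i) w = (\<Sum>i\<in>I. f i w :: 'a::ab_group_add)"
  by (induction I rule: infinite_finite_induct) auto

context finite_field_space
begin

lemma fun_space: "finite_field_space_to scale (\<lambda>c (f :: 'w \<Rightarrow> 'a) x. c * f x)"
  by unfold_locales (auto simp: algebra_simps fun_eq_iff)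

text \<open>The case of function spaces, starting from the empty span. The conclusion records that
  \<open>Q\<close> consists of values \<open>a y e\<close>, because the fixed forms must inherit
  linearity, symmetry and ranks from the slices.\<close>

lemma exists_common_span_fun:
  fixes a :: "'y::plus \<Rightarrow> 'b \<Rightarrow> 'w \<Rightarrow> 'a" and L :: "nat \<Rightarrow> ('w \<Rightarrow> 'a) \<Rightarrow> bool"
  assumes L_add: "\<And>i j f g. L i f \<Longrightarrow> L j g \<Longrightarrow> L (i + j) (\<lambda>w. f w + g w)"
    and L_neg: "\<And>i f. L i f \<Longrightarrow> L i (\<lambda>w. - f w)"
    and L_mono: "\<And>i j f. L i f \<Longrightarrow> i \<le> j \<Longrightarrow> L j f"
    and V: "\<And>y y'. y \<in> V \<Longrightarrow> y' \<in> V \<Longrightarrow> y + y' \<in> V"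
    and H: "subspace H" "finite H"
    and a_plus: "\<And>y y' e w. y \<in> V \<Longrightarrow> y' \<in> V \<Longrightarrow> e \<in> H \<Longrightarrow> a (y + y') e w = a y e w + a y' e w"
    and a_lin: "\<And>y w. y \<in> V \<Longrightarrow> linear_on H (\<lambda>e. a y e w)"
    and near: "\<And>y. y \<in> V \<Longrightarrow> \<exists>G\<subseteq>H. subspace G \<and> index_le m H G \<and> (\<forall>e\<in>G. L b (a y e))"
  shows "\<exists>H' Q. H' \<subseteq> H \<and> subspace H' \<and> index_le (m\<^sup>2) H H' \<and>
           finite Q \<and> Q \<subseteq> {a y e | y e. y \<in> V \<and> e \<in> H} \<and> card Q \<le> m\<^sup>2 \<and>
           (\<forall>y\<in>V. \<forall>e\<in>H'. \<exists>d. L (3 ^ m * b) (\<lambda>w. a y e w - (\<Sum>q\<in>Q. d q * q w)))"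
proof -
  interpret F: finite_field_space_to scale "\<lambda>c (f :: 'w \<Rightarrow> 'a) x. c * f x" by (rule fun_space)
  have near': "\<exists>G\<subseteq>H. subspace G \<and> index_le m H G \<and> (\<forall>e\<in>G. \<exists>q\<in>F.Z.span {}. L b (a y e - q))"
    if "y \<in> V" for y
    using near[OF that] by simp
  have add': "L (i + j) (f + g)" if "L i f" "L j g" for i j f g
    using L_add[OF that] by (simp add: plus_fun_def)
  have neg': "L i (- f)" if "L i f" for i f
    using L_neg[OF that] by (simp add: fun_Compl_def)
  have a_add: "a y (e + e') = a y e + a y e'" if "y \<in> V" "e \<in> H" "e' \<in> H" for y e e'
    using linear_on_add[OF a_lin[OF that(1)] that(2,3)] by (simp add: fun_eq_iff)
  have a_scl: "a y (c *s e) = (\<lambda>w. c * a y e w)" if "y \<in> V" "e \<in> H" for y e c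
    using linear_on_scale[OF a_lin[OF that(1)] that(2)] by (simp add: fun_eq_iff)
  have a_plus': "a (y + y') e = a y e + a y' e" if "y \<in> V" "y' \<in> V" "e \<in> H" for y y' e
    using a_plus[OF that] by (auto simp: fun_eq_iff)
  have "\<exists>H' Q'. H' \<subseteq> H \<and> subspace H' \<and> index_le (m\<^sup>2) H H' \<and>
           finite Q' \<and> {} \<subseteq> Q' \<and> Q' \<subseteq> {} \<union> {a y e | y e. y \<in> V \<and> e \<in> H} \<and> card Q' \<le> card ({} :: ('w \<Rightarrow> 'a) set) + m\<^sup>2 \<and>
           (\<forall>y\<in>V. \<forall>e\<in>H'. \<exists>q\<in>F.Z.span Q'. L (3 ^ m * b) (a y e - q))"
    by (rule F.exists_common_span[of L V H a "{}" m b])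
      (fact add' neg' L_mono V H a_plus' a_add a_scl finite.emptyI near')+
  then obtain H' Q where *: "H' \<subseteq> H" "subspace H'" "index_le (m\<^sup>2) H H'" "finite Q"
    "Q \<subseteq> {a y e | y e. y \<in> V \<and> e \<in> H}" "card Q \<le> m\<^sup>2"
    "\<forall>y\<in>V. \<forall>e\<in>H'. \<exists>q\<in>F.Z.span Q. L (3 ^ m * b) (a y e - q)"
    by auto
  have "\<exists>d. L (3 ^ m * b) (\<lambda>w. a y e w - (\<Sum>q\<in>Q. d q * q w))" if "y \<in> V" "e \<in> H'" for y e
  proof -
    obtain q where q: "q \<in> F.Z.span Q" "L (3 ^ m * b) (a y e - q)" using * \<open>y \<in> V\<close> \<open>e \<in> H'\<close> by blast
    then obtain d where "q = (\<Sum>r\<in>Q. (\<lambda>w. d r * r w))" using F.Z.span_finite[OF *(4)] by auto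
    moreover have "(\<Sum>r\<in>Q. (\<lambda>w. d r * r w)) = (\<lambda>w. \<Sum>r\<in>Q. d r * r w)"
      by (rule ext) (rule sum_fun_apply)
    ultimately have "a y e - q = (\<lambda>w. a y e w - (\<Sum>r\<in>Q. d r * r w))" by (auto simp: fun_eq_iff)
    then show ?thesis using q by auto
  qed
  then show ?thesis using * by blast
qed

section \<open>Radicals of trilinear forms, and bilinear forms modulo low rank\<close>

lemma linear_on_cong:
  "subspace G \<Longrightarrow> linear_on G f \<Longrightarrow> (\<And>x. x \<in> G \<Longrightarrow> g x = f x) \<Longrightarrow> linear_on G g"
  unfolding linear_on_def by (simp add: subspace_add subspace_scale)

lemma linear_on_sum:
  "(\<And>i. i \<in> I \<Longrightarrow> linear_on G (f i)) \<Longrightarrow> linear_on G (\<lambda>x. \<Sum>i\<in>I. f i x)"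
  unfolding linear_on_def by (auto simp: sum.distrib sum_distrib_left)

lemma linear_on_plus: "linear_on G f \<Longrightarrow> linear_on G g \<Longrightarrow> linear_on G (\<lambda>x. f x + g x)"
  unfolding linear_on_def by (auto simp: algebra_simps)

lemma linear_on_minus: "linear_on G f \<Longrightarrow> linear_on G g \<Longrightarrow> linear_on G (\<lambda>x. f x - g x)"
  unfolding linear_on_def by (auto simp: algebra_simps)

lemma linear_on_cmult: "linear_on G f \<Longrightarrow> linear_on G (\<lambda>x. c * f x)"
  unfolding linear_on_def by (auto simp: algebra_simps)

lemma linear_on_multc: "linear_on G f \<Longrightarrow> linear_on G (\<lambda>x. f x * c)"
  unfolding linear_on_def by (auto simp: algebra_simps)

lemma linear_on_restrict:
  "subspace G \<Longrightarrow> linear_on G (\<lambda>x. if x \<in> G then f x else 0) \<longleftrightarrow> linear_on G f"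
  unfolding linear_on_def by (simp add: subspace_add subspace_scale)

lemma subspace_radical:
  assumes "\<And>v. v \<in> W \<Longrightarrow> linear_on W (\<lambda>u. g u v)" "subspace W"
  shows "subspace {u \<in> W. \<forall>v\<in>W. g u v = 0}"
  using assms(1) subspace_0[OF assms(2)] linear_on_0[OF assms(1) assms(2)] subspace_add[OF assms(2)]
    subspace_scale[OF assms(2)]
  unfolding subspace_def linear_on_def by simp

text \<open>The common span is used with error 0, closeness being equality. It gives
  \<open>H'\<close> and at most b^2 functionals of the last argument that span the slices
  \<open>S y e\<close> with \<open>e\<close> in \<open>H'\<close>. Their common kernel
  \<open>K\<close> in \<open>H'\<close> has codimension \<open>k\<close>, and by symmetry the form
  vanishes once two arguments lie in \<open>K\<close>. What remains are the values
  \<open>S z c c'\<close> on a complement of \<open>K\<close>: at most k^2 linear conditions on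
  \<open>z\<close>.\<close>

theorem symmetric_trilinear_radical:
  fixes S :: "'b \<Rightarrow> 'b \<Rightarrow> 'b \<Rightarrow> 'a"
  assumes W: "subspace W" "finite W"
    and lin: "\<And>u v. u \<in> W \<Longrightarrow> v \<in> W \<Longrightarrow> linear_on W (\<lambda>z. S z u v)"
    and sym12: "\<And>z u v. z \<in> W \<Longrightarrow> u \<in> W \<Longrightarrow> v \<in> W \<Longrightarrow> S z u v = S u z v"
    and sym23: "\<And>z u v. z \<in> W \<Longrightarrow> u \<in> W \<Longrightarrow> v \<in> W \<Longrightarrow> S z u v = S z v u"
    and slices: "\<And>z. z \<in> W \<Longrightarrow> index_le b W {u \<in> W. \<forall>v\<in>W. S z u v = 0}"
    and k: "k = (CARD('a) + 1) * b\<^sup>2"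
  shows "\<exists>D\<subseteq>W. subspace D \<and> index_le (k + CARD('a) * k\<^sup>2) W D \<and>
           (\<forall>z\<in>D. \<forall>u\<in>W. \<forall>v\<in>W. S z u v = 0)"
proof -
  have lin2: "linear_on W (\<lambda>u. S z u v)" if "z \<in> W" "v \<in> W" for z v
    using lin[OF that] sym12 that by (rule_tac linear_on_cong[OF W(1)]) auto
  have lin3: "linear_on W (\<lambda>v. S z u v)" if "z \<in> W" "u \<in> W" for z u
    using lin2[OF that] sym23 that by (rule_tac linear_on_cong[OF W(1)]) auto
  \<comment> \<open>Values outside \<open>W\<close> are set to 0, so that equality can be tested at
    every argument although the hypotheses speak only of \<open>W\<close>.\<close>
  define a where "a z u = (\<lambda>v. if v \<in> W then S z u v else 0)" for z u
  have "\<exists>H' Q. H' \<subseteq> W \<and> subspace H' \<and> index_le (b\<^sup>2) W H' \<and>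
           finite Q \<and> Q \<subseteq> {a y e | y e. y \<in> W \<and> e \<in> W} \<and> card Q \<le> b\<^sup>2 \<and>
           (\<forall>y\<in>W. \<forall>e\<in>H'. \<exists>d. \<forall>w. a y e w - (\<Sum>q\<in>Q. d q * q w) = 0)"
  proof (rule exists_common_span_fun[where L = "\<lambda>i g. \<forall>w. g w = 0" and b = 0])
    fix y assume y: "y \<in> W"
    have "subspace {u \<in> W. \<forall>v\<in>W. S y u v = 0}"
      using lin2[OF y] W(1) by (rule subspace_radical)
    then show "\<exists>G\<subseteq>W. subspace G \<and> index_le b W G \<and> (\<forall>e\<in>G. \<forall>w. a y e w = 0)"
      using slices[OF y] by (intro exI[of _ "{u \<in> W. \<forall>v\<in>W. S y u v = 0}"])
        (auto simp: a_def fun_eq_iff)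
  next
    fix y w assume "y \<in> W"
    then show "linear_on W (\<lambda>e. a y e w)"
      using lin2[of y w] by (cases "w \<in> W") (simp_all add: a_def linear_on_def)
  qed (use W linear_on_add[OF lin] in \<open>auto simp: a_def subspace_add\<close>)
  then obtain H' Q' where H': "H' \<subseteq> W" "subspace H'" "index_le (b\<^sup>2) W H'"
    and Q': "finite Q'" "Q' \<subseteq> {a y e | y e. y \<in> W \<and> e \<in> W}" "card Q' \<le> b\<^sup>2"
    and sp: "\<And>y e. y \<in> W \<Longrightarrow> e \<in> H' \<Longrightarrow> \<exists>d. \<forall>w. a y e w = (\<Sum>q\<in>Q'. d q * q w)"
    by (auto simp: eq_iff_diff_eq_0[symmetric])
  define K where "K = {v \<in> H'. \<forall>q\<in>Q'. q v = 0}"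
  have "linear_on H' q" if "q \<in> Q'" for q
  proof -
    have "linear_on W q" using Q'(2) that W lin3 linear_on_restrict by (auto simp: a_def)
    then show ?thesis using H' linear_on_subset by blast
  qed
  then have K: "subspace K" "index_le (CARD('a) * card Q') H' K"
    using index_le_kernels[OF Q'(1), of H'] H' W finite_subset unfolding K_def by blast+
  have "index_le (CARD('a) * b\<^sup>2) H' K" using index_le_mono[OF K(2)] Q'(3) by simp
  from index_le_trans[OF H'(3) this] have KW: "index_le k W K" by (simp add: k algebra_simps)
  have K_sub: "K \<subseteq> H'" "K \<subseteq> W" using H' by (auto simp: K_def)
  have zero: "S x y w = 0" if xyw: "x \<in> W" "y \<in> K" "w \<in> K" for x y w
  proof -
    obtain d where "a x y w = (\<Sum>q\<in>Q'. d q * q w)" using sp[of x y] xyw K_sub by blast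
    also have "\<dots> = 0" using xyw by (intro sum.neutral) (auto simp: K_def)
    finally have "a x y w = 0" .
    then show ?thesis using xyw K_sub by (auto simp: a_def split: if_splits)
  qed
  obtain C where C: "C \<subseteq> W" "finite C" "card C \<le> k" "W \<subseteq> {a + s | a s. a \<in> K \<and> s \<in> span C}"
    using subspace_complement[OF K(1) W(1) K_sub(2) W(2) KW] by blast
  define P where "P = (\<lambda>(c, c') z. S z c c') ` (C \<times> C)"
  define D where "D = {z \<in> K. \<forall>g\<in>P. g z = 0}"
  have finP: "finite P" using C by (simp add: P_def)
  have "card P \<le> card (C \<times> C)" unfolding P_def using C by (intro card_image_le) simp
  also have "\<dots> \<le> k * k" unfolding card_cartesian_product using C(3) mult_le_mono by blast
  finally have cardP: "card P \<le> k\<^sup>2" by (simp add: power2_eq_square)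
  have "linear_on K g" if g: "g \<in> P" for g
  proof -
    obtain c c' where "c \<in> W" "c' \<in> W" "g = (\<lambda>z. S z c c')"
      using g C(1) by (auto simp: P_def)
    then show ?thesis using linear_on_subset[OF lin K_sub(2)] by simp
  qed
  then have D: "subspace D" "index_le (CARD('a) * card P) K D"
    using index_le_kernels[OF finP, of K] K K_sub W finite_subset unfolding D_def by blast+
  have "index_le (CARD('a) * k\<^sup>2) K D" using index_le_mono[OF D(2)] cardP by simp
  from index_le_trans[OF KW this] have DW: "index_le (k + CARD('a) * k\<^sup>2) W D" .
  have "S z u v = 0" if z: "z \<in> D" and u: "u \<in> W" and v: "v \<in> W" for z u v
  proof -
    have zK: "z \<in> K" "z \<in> W" using z K_sub by (auto simp: D_def)
    have CW: "span C \<subseteq> W" using C W span_minimal by blast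
    obtain k s where ks: "u = k + s" "k \<in> K" "s \<in> span C" using C(4) u by blast
    obtain l t where lt: "v = l + t" "l \<in> K" "t \<in> span C" using C(4) v by blast
    have kW: "k \<in> W" "l \<in> W" "s \<in> W" "t \<in> W" using ks lt K_sub CW by auto
    have "S z k v = S v z k" using sym12 sym23 zK kW v by metis
    also have "\<dots> = 0" using zero v zK ks by blast
    finally have 1: "S z k v = 0" .
    have "S z s l = S s z l" using sym12 zK kW by metis
    also have "\<dots> = 0" using zero kW zK lt by blast
    finally have 2: "S z s l = 0" .
    have "S z c c' = 0" if "c \<in> C" "c' \<in> C" for c c' using z that by (auto simp: D_def P_def)
    then have "S z c t = 0" if "c \<in> C" for c
      using linear_on_eq_0_span[OF lin3[of z c] W(1) C(1) _ lt(3)] that zK C(1) by blast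
    then have 3: "S z s t = 0"
      using linear_on_eq_0_span[OF lin2[of z t] W(1) C(1) _ ks(3)] zK kW by blast
    have "S z u v = S z k v + S z s v"
      using linear_on_add[OF lin2[OF zK(2) v] kW(1,3)] by (simp add: ks)
    also have "S z s v = S z s l + S z s t"
      using linear_on_add[OF lin3[OF zK(2) kW(3)] kW(2,4)] by (simp add: lt)
    finally show ?thesis using 1 2 3 by simp
  qed
  then have "\<forall>z\<in>D. \<forall>u\<in>W. \<forall>v\<in>W. S z u v = 0" by blast
  moreover have "D \<subseteq> W" using K_sub by (auto simp: D_def)
  ultimately show ?thesis using D(1) DW by (intro exI[of _ D] conjI)
qed

text \<open>Rank at most \<open>b\<close>, measured by the codimension of the left radical. Forms
  take a pair as their single argument, as the common span for functions expects.\<close>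

definition low_form :: "'b set \<Rightarrow> nat \<Rightarrow> ('b \<times> 'b \<Rightarrow> 'a) \<Rightarrow> bool" where
  "low_form W b g \<longleftrightarrow> (\<exists>R\<subseteq>W. subspace R \<and> index_le b W R \<and> (\<forall>u\<in>R. \<forall>v\<in>W. g (u, v) = 0))"

lemma low_form_add:
  assumes "subspace W" "finite W" "low_form W i g" "low_form W j h"
  shows "low_form W (i + j) (\<lambda>w. g w + h w)"
proof -
  obtain R where R: "R \<subseteq> W" "subspace R" "index_le i W R" "\<forall>u\<in>R. \<forall>v\<in>W. g (u, v) = 0"
    using assms unfolding low_form_def by blast
  obtain R' where R': "R' \<subseteq> W" "subspace R'" "index_le j W R'" "\<forall>u\<in>R'. \<forall>v\<in>W. h (u, v) = 0"
    using assms unfolding low_form_def by blast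
  have "index_le (i + j) W (R \<inter> R')" using index_le_Int R R' assms by blast
  then show ?thesis unfolding low_form_def using R R' subspace_inter
    by (intro exI[of _ "R \<inter> R'"]) auto
qed

lemma low_form_cmult: "low_form W i g \<Longrightarrow> low_form W i (\<lambda>w. c * g w)"
  unfolding low_form_def by fastforce

lemma low_form_mono: "low_form W i g \<Longrightarrow> i \<le> j \<Longrightarrow> low_form W j g"
  unfolding low_form_def using index_le_mono by blast

lemma low_form_cong:
  "low_form W i g \<Longrightarrow> (\<And>u v. u \<in> W \<Longrightarrow> v \<in> W \<Longrightarrow> g (u, v) = h (u, v)) \<Longrightarrow> low_form W i h"
  unfolding low_form_def by (metis subset_iff)

lemma low_form_restrict:
  assumes "low_form W i g" "W' \<subseteq> W" "subspace W" "subspace W'" "finite W"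
  shows "low_form W' i g"
proof -
  obtain R where R: "R \<subseteq> W" "subspace R" "index_le i W R" "\<forall>u\<in>R. \<forall>v\<in>W. g (u, v) = 0"
    using assms unfolding low_form_def by blast
  have "index_le i W' (R \<inter> W')" using index_le_restrict R assms by blast
  then show ?thesis unfolding low_form_def using R assms subspace_inter
    by (intro exI[of _ "R \<inter> W'"]) auto
qed

definition approx_by :: "'b set \<Rightarrow> nat \<Rightarrow> 'x set \<Rightarrow> ('x \<Rightarrow> 'b \<times> 'b \<Rightarrow> 'a) \<Rightarrow> ('b \<times> 'b \<Rightarrow> 'a) set \<Rightarrow> bool"
  where "approx_by W b X a Q \<longleftrightarrow> (\<forall>x\<in>X. \<exists>d. low_form W b (\<lambda>w. a x w - (\<Sum>q\<in>Q. d q * q w)))"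

definition indep_mod_low :: "'b set \<Rightarrow> nat \<Rightarrow> ('b \<times> 'b \<Rightarrow> 'a) set \<Rightarrow> bool" where
  "indep_mod_low W b Q \<longleftrightarrow> (\<forall>c. low_form W b (\<lambda>w. \<Sum>q\<in>Q. c q * q w) \<longrightarrow> (\<forall>q\<in>Q. c q = 0))"

text \<open>In a relation of rank \<open>3 * b\<close>, a form with nonzero coefficient is a
  combination of the others up to that rank; eliminating it turns the error \<open>b\<close> into
  \<open>b + 3 * b\<close>. The 3 is the number of approximations that are combined when the
  coefficients are shown to be additive.\<close>

lemma low_form_regularize:
  assumes W: "subspace W" "finite W"
  shows "finite Q \<Longrightarrow> approx_by W b X a Q \<Longrightarrow>
    \<exists>Q' b'. Q' \<subseteq> Q \<and> b' \<le> 4 ^ card Q * b \<and> approx_by W b' X a Q' \<and> indep_mod_low W (3 * b') Q'"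
proof (induction "card Q" arbitrary: Q b)
  case 0
  then have "indep_mod_low W (3 * b) Q" by (simp add: indep_mod_low_def)
  then show ?case using 0 by (intro exI[of _ Q] exI[of _ b]) auto
next
  case (Suc n)
  show ?case
  proof (cases "indep_mod_low W (3 * b) Q")
    case True
    then show ?thesis using Suc.prems by (intro exI[of _ Q] exI[of _ b]) auto
  next
    case False
    then obtain c p where c: "low_form W (3 * b) (\<lambda>w. \<Sum>q\<in>Q. c q * q w)" and p: "p \<in> Q" "c p \<noteq> 0"
      unfolding indep_mod_low_def by blast
    have "approx_by W (4 * b) X a (Q - {p})"
      unfolding approx_by_def
    proof
      fix x assume "x \<in> X"
      then obtain d where d: "low_form W b (\<lambda>w. a x w - (\<Sum>q\<in>Q. d q * q w))"
        using Suc.prems(2) unfolding approx_by_def by blast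
      define t where "t = d p / c p"
      have "low_form W (b + 3 * b) (\<lambda>w. (a x w - (\<Sum>q\<in>Q. d q * q w)) + t * (\<Sum>q\<in>Q. c q * q w))"
        by (rule low_form_add[OF W d low_form_cmult[OF c]])
      moreover have "(a x w - (\<Sum>q\<in>Q. d q * q w)) + t * (\<Sum>q\<in>Q. c q * q w)
          = a x w - (\<Sum>q\<in>Q - {p}. (d q - t * c q) * q w)" for w
      proof -
        have "(\<Sum>q\<in>Q - {p}. (d q - t * c q) * q w) = (\<Sum>q\<in>Q. (d q - t * c q) * q w)"
          using Suc.prems(1) p by (simp add: sum.remove[of Q p] t_def)
        then show ?thesis by (simp add: left_diff_distrib sum_subtractf sum_distrib_left mult.assoc)
      qed
      ultimately have "low_form W (b + 3 * b) (\<lambda>w. a x w - (\<Sum>q\<in>Q - {p}. (d q - t * c q) * q w))"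
        by (simp only:)
      then have "low_form W (4 * b) (\<lambda>w. a x w - (\<Sum>q\<in>Q - {p}. (d q - t * c q) * q w))"
        by (rule low_form_mono) simp
      then show "\<exists>d. low_form W (4 * b) (\<lambda>w. a x w - (\<Sum>q\<in>Q - {p}. d q * q w))"
        by (rule exI[where x = "\<lambda>q. d q - t * c q"])
    qed
    moreover have card: "card Q = Suc (card (Q - {p}))" by (rule card.remove[OF Suc.prems(1) p(1)])
    moreover from this have "n = card (Q - {p})" using Suc.hyps(2) by linarith
    ultimately obtain Q' b' where "Q' \<subseteq> Q - {p}" "b' \<le> 4 ^ card (Q - {p}) * (4 * b)"
       "approx_by W b' X a Q'" "indep_mod_low W (3 * b') Q'"
      using Suc.hyps(1)[of "Q - {p}" "4 * b"] Suc.prems(1) by blast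
    moreover have "4 ^ card Q * b = 4 ^ card (Q - {p}) * (4 * b)" unfolding card by simp
    ultimately show ?thesis by (intro exI[of _ Q'] exI[of _ b']) auto
  qed
qed

end

section \<open>Quartic forms whose slices are close to a fixed span\<close>

context finite_field_space
begin

text \<open>\<open>S\<close> subtracts from \<open>T\<close> one product for each of the three
  partners of \<open>y\<close>. For fixed \<open>y\<close> it is a symmetric trilinear form with
  slices of rank \<open>b'\<close>, so it has a radical of codimension \<open>D\<close>. Hence the
  common span applies a second time, with error 0. The at most D^2 forms that it returns are slices
  of \<open>S\<close>, each with a radical of codimension \<open>b'\<close>; intersecting these with
  \<open>H\<close> gives D^2 * (b' + 1). On the diagonal the three products coincide, whence the
  3.\<close>

theorem quartic_on_subspace:
  fixes T :: "'b \<Rightarrow> 'b \<Rightarrow> 'b \<Rightarrow> 'b \<Rightarrow> 'a"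
  assumes W: "subspace W" "finite W"
    and lin: "\<And>z u v. z \<in> W \<Longrightarrow> u \<in> W \<Longrightarrow> v \<in> W \<Longrightarrow> linear_on W (\<lambda>y. T y z u v)"
    and sym12: "\<And>y z u v. y \<in> W \<Longrightarrow> z \<in> W \<Longrightarrow> u \<in> W \<Longrightarrow> v \<in> W \<Longrightarrow> T y z u v = T z y u v"
    and sym23: "\<And>y z u v. y \<in> W \<Longrightarrow> z \<in> W \<Longrightarrow> u \<in> W \<Longrightarrow> v \<in> W \<Longrightarrow> T y z u v = T y u z v"
    and sym34: "\<And>y z u v. y \<in> W \<Longrightarrow> z \<in> W \<Longrightarrow> u \<in> W \<Longrightarrow> v \<in> W \<Longrightarrow> T y z u v = T y z v u"
    and Q: "finite Q"
    and Q_lin: "\<And>q v. q \<in> Q \<Longrightarrow> v \<in> W \<Longrightarrow> linear_on W (\<lambda>u. q (u, v))"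
    and Q_sym: "\<And>q u v. q \<in> Q \<Longrightarrow> u \<in> W \<Longrightarrow> v \<in> W \<Longrightarrow> q (u, v) = q (v, u)"
    and approx: "approx_by W b (W \<times> W) (\<lambda>(y, z) (u, v). T y z u v) Q"
    and indep: "indep_mod_low W (3 * b) Q"
    and b': "b' = b + 2 * CARD('a) * card Q"
    and k: "k = (CARD('a) + 1) * b'\<^sup>2"
    and D: "D = k + CARD('a) * k\<^sup>2"
  shows "\<exists>U \<alpha>. U \<subseteq> W \<and> subspace U \<and> index_le (D\<^sup>2 * (b' + 1)) W U \<and>
           (\<forall>q\<in>Q. \<forall>z\<in>W. linear_on W (\<lambda>y. \<alpha> q y z) \<and> linear_on W (\<lambda>y. \<alpha> q z y)) \<and>
           (\<forall>x\<in>U. T x x x x = 3 * (\<Sum>q\<in>Q. \<alpha> q x x * q (x, x)))"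
proof -
  have lin2: "linear_on W (\<lambda>z. T y z u v)" if "y \<in> W" "u \<in> W" "v \<in> W" for y u v
    using lin[OF that] sym12 that by (rule_tac linear_on_cong[OF W(1)]) auto
  have lin3: "linear_on W (\<lambda>u. T y z u v)" if "y \<in> W" "z \<in> W" "v \<in> W" for y z v
    using lin2[OF that] sym23 that by (rule_tac linear_on_cong[OF W(1)]) auto
  have Q_lin2: "linear_on W (\<lambda>v. q (u, v))" if "q \<in> Q" "u \<in> W" for q u
    using Q_lin[OF that] Q_sym that by (rule_tac linear_on_cong[OF W(1)]) auto
  have "\<exists>d. low_form W b (\<lambda>(u, v). T y z u v - (\<Sum>q\<in>Q. d q * q (u, v)))" if "y \<in> W" "z \<in> W" for y z
    using approx that unfolding approx_by_def by (simp add: case_prod_unfold)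
  then have ex: "\<exists>d. low_form W b (\<lambda>(u, v). T y z u v - (\<Sum>q\<in>Q. d q * q (u, v)))"
    if "y \<in> W" "z \<in> W" for y z using that by simp
  define \<beta> where "\<beta> y z = (SOME d. low_form W b (\<lambda>(u, v). T y z u v - (\<Sum>q\<in>Q. d q * q (u, v))))" for y z
  have \<beta>: "low_form W b (\<lambda>(u, v). T y z u v - (\<Sum>q\<in>Q. \<beta> y z q * q (u, v)))"
    if "y \<in> W" "z \<in> W" for y z
    unfolding \<beta>_def using someI_ex[OF ex[OF that]] .
  have zero: "c q = 0" if "low_form W (3 * b) (\<lambda>(u, v). \<Sum>q\<in>Q. c q * q (u, v))" "q \<in> Q" for c q
    using indep that unfolding indep_mod_low_def by (simp add: case_prod_unfold)
  have neg: "low_form W b (\<lambda>w. - f w)" if "low_form W b f" for f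
    using low_form_cmult[OF that, of "-1"] by simp
  \<comment> \<open>Both coefficient families approximate the same slice, so their difference gives
    a combination of rank at most \<open>2 * b\<close>, and independence makes it trivial. Linearity
    follows likewise from at most three approximations.\<close>
  have \<beta>_sym: "\<beta> y z q = \<beta> z y q" if yz: "y \<in> W" "z \<in> W" "q \<in> Q" for y z q
  proof -
    have "low_form W (b + b) (\<lambda>w. (case w of (u, v) \<Rightarrow> T y z u v - (\<Sum>q\<in>Q. \<beta> y z q * q (u, v)))
        + - (case w of (u, v) \<Rightarrow> T z y u v - (\<Sum>q\<in>Q. \<beta> z y q * q (u, v))))"
      by (intro low_form_add[OF W] neg \<beta> yz)
    then have "low_form W (3 * b) (\<lambda>w. (case w of (u, v) \<Rightarrow> T y z u v - (\<Sum>q\<in>Q. \<beta> y z q * q (u, v)))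
        + - (case w of (u, v) \<Rightarrow> T z y u v - (\<Sum>q\<in>Q. \<beta> z y q * q (u, v))))"
      by (rule low_form_mono) simp
    then have "low_form W (3 * b) (\<lambda>(u, v). \<Sum>q\<in>Q. (\<beta> z y q - \<beta> y z q) * q (u, v))"
      by (rule low_form_cong) (use sym12 yz in \<open>simp add: sum_subtractf left_diff_distrib\<close>)
    from zero[OF this yz(3)] show ?thesis by simp
  qed
  have \<beta>_lin: "linear_on W (\<lambda>y. \<beta> y z q)" if z: "z \<in> W" "q \<in> Q" for z q
    unfolding linear_on_def
  proof (intro conjI ballI allI)
    fix x y assume xy: "x \<in> W" "y \<in> W"
    then have sum: "x + y \<in> W" using W subspace_add by blast
    have "low_form W ((b + b) + b) (\<lambda>w. ((case w of (u, v) \<Rightarrow> T x z u v - (\<Sum>q\<in>Q. \<beta> x z q * q (u, v)))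
        + (case w of (u, v) \<Rightarrow> T y z u v - (\<Sum>q\<in>Q. \<beta> y z q * q (u, v))))
        + - (case w of (u, v) \<Rightarrow> T (x + y) z u v - (\<Sum>q\<in>Q. \<beta> (x + y) z q * q (u, v))))"
      by (intro low_form_add[OF W] neg \<beta> z xy sum)
    then have "low_form W (3 * b) (\<lambda>w. ((case w of (u, v) \<Rightarrow> T x z u v - (\<Sum>q\<in>Q. \<beta> x z q * q (u, v)))
        + (case w of (u, v) \<Rightarrow> T y z u v - (\<Sum>q\<in>Q. \<beta> y z q * q (u, v))))
        + - (case w of (u, v) \<Rightarrow> T (x + y) z u v - (\<Sum>q\<in>Q. \<beta> (x + y) z q * q (u, v))))"
      by (rule low_form_mono) simp
    then have "low_form W (3 * b) (\<lambda>(u, v). \<Sum>q\<in>Q. (\<beta> (x + y) z q - \<beta> x z q - \<beta> y z q) * q (u, v))"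
      by (rule low_form_cong)
        (use linear_on_add[OF lin] z xy in \<open>simp add: sum_subtractf left_diff_distrib\<close>)
    from zero[OF this z(2)] show "\<beta> (x + y) z q = \<beta> x z q + \<beta> y z q" by (simp add: algebra_simps)
  next
    fix c x assume x: "x \<in> W"
    then have scl: "c *s x \<in> W" using W subspace_scale by blast
    have "low_form W (b + b) (\<lambda>w. c * (case w of (u, v) \<Rightarrow> T x z u v - (\<Sum>q\<in>Q. \<beta> x z q * q (u, v)))
        + - (case w of (u, v) \<Rightarrow> T (c *s x) z u v - (\<Sum>q\<in>Q. \<beta> (c *s x) z q * q (u, v))))"
      by (intro low_form_add[OF W] low_form_cmult neg \<beta> z x scl)
    then have "low_form W (3 * b) (\<lambda>w. c * (case w of (u, v) \<Rightarrow> T x z u v - (\<Sum>q\<in>Q. \<beta> x z q * q (u, v)))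
        + - (case w of (u, v) \<Rightarrow> T (c *s x) z u v - (\<Sum>q\<in>Q. \<beta> (c *s x) z q * q (u, v))))"
      by (rule low_form_mono) simp
    then have "low_form W (3 * b) (\<lambda>(u, v). \<Sum>q\<in>Q. (\<beta> (c *s x) z q - c * \<beta> x z q) * q (u, v))"
      by (rule low_form_cong)
        (use linear_on_scale[OF lin] z x in
          \<open>simp add: sum_subtractf left_diff_distrib right_diff_distrib sum_distrib_left mult.assoc\<close>)
    from zero[OF this z(2)] show "\<beta> (c *s x) z q = c * \<beta> x z q" by simp
  qed
  have \<beta>_lin2: "linear_on W (\<lambda>z. \<beta> y z q)" if "y \<in> W" "q \<in> Q" for y q
    using \<beta>_lin[OF that] \<beta>_sym that by (rule_tac linear_on_cong[OF W(1)]) auto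
  define S where "S y z u v = T y z u v -
      (\<Sum>q\<in>Q. \<beta> y z q * q (u, v) + \<beta> y u q * q (z, v) + \<beta> y v q * q (z, u))" for y z u v
  have S_lin: "linear_on W (\<lambda>y. S y z u v)" if "z \<in> W" "u \<in> W" "v \<in> W" for z u v
    unfolding S_def
    by (intro linear_on_minus lin linear_on_sum linear_on_plus linear_on_multc \<beta>_lin that)
  have S_lin2: "linear_on W (\<lambda>z. S y z u v)" if "y \<in> W" "u \<in> W" "v \<in> W" for y u v
    unfolding S_def
    by (intro linear_on_minus lin2 linear_on_sum linear_on_plus linear_on_multc linear_on_cmult
        \<beta>_lin2 Q_lin that)
  have S_sym: "S y z u v = S y u z v" "S y z u v = S y z v u"
    if "y \<in> W" "z \<in> W" "u \<in> W" "v \<in> W" for y z u v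
    unfolding S_def using that sym23 sym34 Q_sym
    by (auto intro!: arg_cong2[where f = "(-)"] sum.cong simp: add_ac)
  have S_lin3: "linear_on W (\<lambda>u. S y z u v)" if "y \<in> W" "z \<in> W" "v \<in> W" for y z v
    by (rule linear_on_cong[OF W(1) S_lin2[OF that]]) (rule S_sym(1)[OF that(1,2) _ that(3)])
  have slices: "index_le b' W {u \<in> W. \<forall>v\<in>W. S y z u v = 0}" if yz: "y \<in> W" "z \<in> W" for y z
  proof -
    obtain R where R: "R \<subseteq> W" "subspace R" "index_le b W R"
      "\<forall>u\<in>R. \<forall>v\<in>W. T y z u v = (\<Sum>q\<in>Q. \<beta> y z q * q (u, v))"
      using \<beta>[OF yz] unfolding low_form_def by auto
    \<comment> \<open>On the common kernel of these at most \<open>2 * card Q\<close> functionals of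
      \<open>u\<close> the last two products vanish, and on \<open>R\<close> the rest of
      \<open>S y z\<close> vanishes too; this is the origin of \<open>b'\<close>.\<close>
    define P where "P = (\<lambda>q u. \<beta> y u q) ` Q \<union> (\<lambda>q u. q (z, u)) ` Q"
    have "card P \<le> card ((\<lambda>q u. \<beta> y u q) ` Q) + card ((\<lambda>q u. q (z, u)) ` Q)"
      unfolding P_def by (rule card_Un_le)
    also have "\<dots> \<le> card Q + card Q" using Q by (intro add_mono card_image_le)
    finally have cardP: "card P \<le> 2 * card Q" by simp
    have finP: "finite P" using Q by (simp add: P_def)
    have P_lin: "linear_on R g" if g: "g \<in> P" for g
      using g \<beta>_lin2 Q_lin2 yz linear_on_subset[OF _ R(1)] by (auto simp: P_def)
    have finR: "finite R" using R W finite_subset by blast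
    have "index_le (CARD('a) * card P) R {u \<in> R. \<forall>g\<in>P. g u = 0}"
      using index_le_kernels[OF finP P_lin R(2) finR] by blast
    then have "index_le (CARD('a) * (2 * card Q)) R {u \<in> R. \<forall>g\<in>P. g u = 0}"
      by (rule index_le_mono) (use cardP in simp)
    from index_le_trans[OF R(3) this]
    have "index_le b' W {u \<in> R. \<forall>g\<in>P. g u = 0}" by (simp add: b' mult.commute mult.left_commute)
    then show ?thesis
    proof (rule index_le_mono_set)
      show "{u \<in> R. \<forall>g\<in>P. g u = 0} \<subseteq> {u \<in> W. \<forall>v\<in>W. S y z u v = 0}"
      proof clarify
        fix u assume u: "u \<in> R" "\<forall>g\<in>P. g u = 0"
        then have 0: "\<beta> y u q = 0" "q (z, u) = 0" if "q \<in> Q" for q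
          using that by (auto simp: P_def)
        have "S y z u v = 0" if "v \<in> W" for v
        proof -
          have "(\<Sum>q\<in>Q. \<beta> y z q * q (u, v) + \<beta> y u q * q (z, v) + \<beta> y v q * q (z, u))
              = (\<Sum>q\<in>Q. \<beta> y z q * q (u, v))"
            by (rule sum.cong) (simp_all add: 0)
          then show ?thesis using R(4) u(1) that by (simp add: S_def)
        qed
        then show "u \<in> W \<and> (\<forall>v\<in>W. S y z u v = 0)" using u R by blast
      qed
    qed (use W in simp)
  qed
  define a where "a y z = (\<lambda>(u, v). if u \<in> W \<and> v \<in> W then S y z u v else 0)" for y z
  have radical: "\<exists>G\<subseteq>W. subspace G \<and> index_le D W G \<and> (\<forall>e\<in>G. \<forall>w. a y e w = 0)" if y: "y \<in> W" for y
  proof -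
    have "\<exists>G\<subseteq>W. subspace G \<and> index_le (k + CARD('a) * k\<^sup>2) W G \<and>
        (\<forall>z\<in>G. \<forall>u\<in>W. \<forall>v\<in>W. S y z u v = 0)"
      by (rule symmetric_trilinear_radical[OF W S_lin2[OF y] S_sym(1)[OF y] S_sym(2)[OF y] slices[OF y] k])
    then obtain G where "G \<subseteq> W" "subspace G" "index_le D W G" "\<forall>z\<in>G. \<forall>u\<in>W. \<forall>v\<in>W. S y z u v = 0"
      unfolding D by blast
    then show ?thesis by (intro exI[of _ G]) (auto simp: a_def)
  qed
  have "\<exists>H Q'. H \<subseteq> W \<and> subspace H \<and> index_le (D\<^sup>2) W H \<and>
           finite Q' \<and> Q' \<subseteq> {a y e | y e. y \<in> W \<and> e \<in> W} \<and> card Q' \<le> D\<^sup>2 \<and>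
           (\<forall>y\<in>W. \<forall>e\<in>H. \<exists>d. \<forall>w. a y e w - (\<Sum>q\<in>Q'. d q * q w) = 0)"
  proof (rule exists_common_span_fun[where L = "\<lambda>i g. \<forall>w. g w = 0" and b = 0])
    fix y w assume "y \<in> W"
    then show "linear_on W (\<lambda>e. a y e w)"
      using S_lin2[of y "fst w" "snd w"]
      by (cases "fst w \<in> W \<and> snd w \<in> W") (auto simp: a_def case_prod_unfold linear_on_def)
  next
    show "\<exists>G\<subseteq>W. subspace G \<and> index_le D W G \<and> (\<forall>e\<in>G. \<forall>w. a y e w = 0)" if "y \<in> W" for y
      using radical[OF that] .
  qed (use W linear_on_add[OF S_lin] in \<open>auto simp: a_def subspace_add\<close>)
  then obtain H Q' where H: "H \<subseteq> W" "subspace H" "index_le (D\<^sup>2) W H"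
    and Q': "finite Q'" "Q' \<subseteq> {a y e | y e. y \<in> W \<and> e \<in> W}" "card Q' \<le> D\<^sup>2"
    and sp: "\<And>y e. y \<in> W \<Longrightarrow> e \<in> H \<Longrightarrow> \<exists>d. \<forall>w. a y e w = (\<Sum>q\<in>Q'. d q * q w)"
    by (auto simp: eq_iff_diff_eq_0[symmetric])
  define rad where "rad q = {u \<in> W. \<forall>v\<in>W. q (u, v) = 0}" for q :: "'b \<times> 'b \<Rightarrow> 'a"
  have rad: "subspace (rad q) \<and> rad q \<subseteq> W \<and> index_le b' W (rad q)" if q: "q \<in> Q'" for q
  proof -
    obtain y e where ye: "y \<in> W" "e \<in> W" "q = a y e" using q Q' by blast
    then have "rad q = {u \<in> W. \<forall>v\<in>W. S y e u v = 0}" by (auto simp: rad_def a_def)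
    then show ?thesis using subspace_radical[OF S_lin3 W(1)] slices ye by auto
  qed
  \<comment> \<open>\<open>H\<close> makes \<open>S x x\<close> a combination of the forms in
    \<open>Q'\<close>, and the radicals make each of these vanish at \<open>(x, x)\<close>.\<close>
  define U where "U = H \<inter> (W \<inter> (\<Inter>q\<in>Q'. rad q))"
  have rads: "subspace (W \<inter> (\<Inter>q\<in>Q'. rad q))" "index_le (card Q' * b') W (W \<inter> (\<Inter>q\<in>Q'. rad q))"
    using index_le_Inter[OF Q'(1) rad W] by auto
  have "index_le (D\<^sup>2 + card Q' * b') W U"
    unfolding U_def using index_le_Int[OF H(2) rads(1) W(1) H(1) _ W(2) H(3) rads(2)] by blast
  then have "index_le (D\<^sup>2 * (b' + 1)) W U"
    by (rule index_le_mono) (use Q'(3) in simp)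
  moreover have "subspace U" "U \<subseteq> W" unfolding U_def using H rads subspace_inter by auto
  moreover have "T x x x x = 3 * (\<Sum>q\<in>Q. \<beta> x x q * q (x, x))" if x: "x \<in> U" for x
  proof -
    have xW: "x \<in> W" "x \<in> H" using x \<open>U \<subseteq> W\<close> by (auto simp: U_def)
    obtain d where "a x x (x, x) = (\<Sum>q\<in>Q'. d q * q (x, x))" using sp[OF xW] by blast
    also have "\<dots> = 0" using x xW by (intro sum.neutral) (auto simp: U_def rad_def)
    finally have "S x x x x = 0" using xW by (simp add: a_def)
    then show ?thesis by (simp add: S_def sum_distrib_left algebra_simps)
  qed
  ultimately show ?thesis using \<beta>_lin \<beta>_lin2
    by (intro exI[of _ U] exI[of _ "\<lambda>q y z. \<beta> y z q"]) blast
qed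

end

section \<open>Additive characters and dense null sets\<close>

text \<open>The definition uses the least residue as exponent; since \<omega>^p = 1, any integer
  representative will do, which is what additivity requires.\<close>

lemma additive_char_of_int:
  "additive_char (of_int k :: 'p::prime_card mod_ring) = exp (2 * of_real pi * \<i> / of_nat CARD('p)) powi k"
proof -
  let ?w = "exp (2 * of_real pi * \<i> / of_nat CARD('p)) :: complex"
  let ?p = "int CARD('p)"
  have pw: "?w ^ CARD('p) = 1"
    by (simp flip: exp_of_nat_mult add: exp_two_pi_i')
  have "to_int_mod_ring (of_int k :: 'p mod_ring) = k mod ?p"
    by (simp add: of_int_of_int_mod_ring to_int_mod_ring.abs_eq of_int_mod_ring.rep_eq to_int_mod_ring_def)
  then have "additive_char (of_int k :: 'p mod_ring) = ?w powi (k mod ?p)"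
    by (simp add: additive_char_def)
  also have "\<dots> = ?w powi (?p * (k div ?p)) * ?w powi (k mod ?p)"
    by (simp add: power_int_mult pw)
  also have "\<dots> = ?w powi k"
    by (subst power_int_add[symmetric]) simp_all
  finally show ?thesis .
qed

lemma additive_char_add:
  fixes a b :: "'p::prime_card mod_ring"
  shows "additive_char (a + b) = additive_char a * additive_char b"
proof -
  have "additive_char (of_int (to_int_mod_ring a + to_int_mod_ring b) :: 'p mod_ring) =
    additive_char (of_int (to_int_mod_ring a) :: 'p mod_ring) * additive_char (of_int (to_int_mod_ring b) :: 'p mod_ring)"
    unfolding additive_char_of_int by (simp add: power_int_add)
  moreover have "of_int (to_int_mod_ring c) = c" for c :: "'p mod_ring"
    by (simp add: of_int_of_int_mod_ring)
  ultimately show ?thesis by (simp only: of_int_add)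
qed

lemma additive_char_0 [simp]: "additive_char 0 = 1"
  by (simp add: additive_char_def)

lemma norm_additive_char [simp]: "norm (additive_char a) = 1"
  by (simp add: additive_char_def norm_power_int norm_exp)

lemma additive_char_1_neq: "additive_char (1 :: 'p::prime_card mod_ring) \<noteq> 1"
proof
  assume *: "additive_char (1 :: 'p mod_ring) = 1"
  have p: "2 \<le> CARD('p)" using prime_card[where 'a = 'p] prime_ge_2_nat by blast
  have "additive_char (1 :: 'p mod_ring) = cis (2 * pi / CARD('p))"
    using additive_char_of_int[of 1, where 'p = 'p] by (simp add: cis_conv_exp mult_ac)
  then have "cos (2 * pi / CARD('p)) = 1" using * by (metis cis.sel(1) one_complex.sel(1))
  moreover have "cos (2 * pi / CARD('p)) < cos 0"
    by (rule cos_monotone_0_pi) (use p in \<open>auto simp: field_simps\<close>)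
  ultimately show False by simp
qed

locale prime_field_space = finite_field_space scale
  for scale :: "'p::prime_card mod_ring \<Rightarrow> 'b::ab_group_add \<Rightarrow> 'b"  (infixr \<open>*s\<close> 75)
begin

text \<open>Orthogonality: a nonzero functional takes the value 1 at some \<open>w\<close>, and
  translation by \<open>w\<close> multiplies the sum by \<open>additive_char 1\<close>, which is not
  1.\<close>

lemma sum_additive_char:
  assumes "linear_on G g" "subspace G" "finite G"
  shows "(\<Sum>v\<in>G. additive_char (g v)) = (if \<forall>v\<in>G. g v = 0 then of_nat (card G) else 0)"
proof (cases "\<forall>v\<in>G. g v = 0")
  case False
  then obtain v where v: "v \<in> G" "g v \<noteq> 0" by blast
  define w where "w = (1 / g v) *s v"
  have w: "w \<in> G" "g w = 1"
    using v assms linear_on_scale[OF assms(1) v(1)] subspace_scale by (auto simp: w_def)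
  have "(\<Sum>v\<in>G. additive_char (g v)) = (\<Sum>v\<in>G. additive_char (g (v + w)))"
    by (rule sum.reindex_bij_witness[of _ "\<lambda>v. v + w" "\<lambda>v. v - w"])
      (use assms w in \<open>auto simp: subspace_add subspace_diff\<close>)
  also have "\<dots> = additive_char (1 :: 'p mod_ring) * (\<Sum>v\<in>G. additive_char (g v))"
    using w linear_on_add[OF assms(1)] by (simp add: additive_char_add sum_distrib_left mult.commute)
  finally have "(1 - additive_char (1 :: 'p mod_ring)) * (\<Sum>v\<in>G. additive_char (g v)) = 0"
    by (simp add: algebra_simps)
  then show ?thesis using False additive_char_1_neq[where 'p = 'p] by auto
qed simp

text \<open>The three adjacent transpositions generate all permutations of the arguments and carry
  linearity from the first argument to the others.\<close>

definition sym_quadrilinear :: "'b set \<Rightarrow> ('b \<Rightarrow> 'b \<Rightarrow> 'b \<Rightarrow> 'b \<Rightarrow> 'p mod_ring) \<Rightarrow> bool" where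
  "sym_quadrilinear G T \<longleftrightarrow>
    (\<forall>z\<in>G. \<forall>u\<in>G. \<forall>v\<in>G. linear_on G (\<lambda>y. T y z u v)) \<and>
    (\<forall>y\<in>G. \<forall>z\<in>G. \<forall>u\<in>G. \<forall>v\<in>G. T y z u v = T z y u v \<and> T y z u v = T y u z v \<and> T y z u v = T y z v u)"

lemma sym_quadrilinear_subset: "sym_quadrilinear G T \<Longrightarrow> W \<subseteq> G \<Longrightarrow> sym_quadrilinear W T"
  unfolding sym_quadrilinear_def by (meson linear_on_subset subsetD)

lemma sym_quadrilinearD:
  assumes "sym_quadrilinear G T" "subspace G"
  shows "z \<in> G \<Longrightarrow> u \<in> G \<Longrightarrow> v \<in> G \<Longrightarrow> linear_on G (\<lambda>y. T y z u v)"
    and "y \<in> G \<Longrightarrow> u \<in> G \<Longrightarrow> v \<in> G \<Longrightarrow> linear_on G (\<lambda>z. T y z u v)"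
    and "y \<in> G \<Longrightarrow> z \<in> G \<Longrightarrow> v \<in> G \<Longrightarrow> linear_on G (\<lambda>u. T y z u v)"
    and "y \<in> G \<Longrightarrow> z \<in> G \<Longrightarrow> u \<in> G \<Longrightarrow> linear_on G (\<lambda>v. T y z u v)"
    and "y \<in> G \<Longrightarrow> z \<in> G \<Longrightarrow> u \<in> G \<Longrightarrow> v \<in> G \<Longrightarrow> T y z u v = T z y u v"
    and "y \<in> G \<Longrightarrow> z \<in> G \<Longrightarrow> u \<in> G \<Longrightarrow> v \<in> G \<Longrightarrow> T y z u v = T y u z v"
    and "y \<in> G \<Longrightarrow> z \<in> G \<Longrightarrow> u \<in> G \<Longrightarrow> v \<in> G \<Longrightarrow> T y z u v = T y z v u"
proof -
  show lin: "linear_on G (\<lambda>y. T y z u v)" if "z \<in> G" "u \<in> G" "v \<in> G" for z u v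
    using assms that unfolding sym_quadrilinear_def by blast
  show s12: "T y z u v = T z y u v" if "y \<in> G" "z \<in> G" "u \<in> G" "v \<in> G" for y z u v
    using assms that unfolding sym_quadrilinear_def by blast
  show s23: "T y z u v = T y u z v" if "y \<in> G" "z \<in> G" "u \<in> G" "v \<in> G" for y z u v
    using assms that unfolding sym_quadrilinear_def by blast
  show s34: "T y z u v = T y z v u" if "y \<in> G" "z \<in> G" "u \<in> G" "v \<in> G" for y z u v
    using assms that unfolding sym_quadrilinear_def by blast
  show lin2: "linear_on G (\<lambda>z. T y z u v)" if "y \<in> G" "u \<in> G" "v \<in> G" for y u v
    by (rule linear_on_cong[OF assms(2) lin[OF that]]) (rule s12[OF that(1) _ that(2,3)])
  show lin3: "linear_on G (\<lambda>u. T y z u v)" if "y \<in> G" "z \<in> G" "v \<in> G" for y z v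
    by (rule linear_on_cong[OF assms(2) lin2[OF that]]) (rule s23[OF that(1,2) _ that(3)])
  show "linear_on G (\<lambda>v. T y z u v)" if "y \<in> G" "z \<in> G" "u \<in> G" for y z u
    by (rule linear_on_cong[OF assms(2) lin3[OF that]]) (rule s34[OF that])
qed

text \<open>Up to a factor \<open>card G\<close>, the size of this set is the character sum of the
  trilinear slice \<open>T y\<close>; it measures the bias of that slice.\<close>

definition null_pairs :: "'b set \<Rightarrow> ('b \<Rightarrow> 'b \<Rightarrow> 'b \<Rightarrow> 'b \<Rightarrow> 'p mod_ring) \<Rightarrow> 'b \<Rightarrow> ('b \<times> 'b) set" where
  "null_pairs G T y = {(z, u) \<in> G \<times> G. \<forall>v\<in>G. T y z u v = 0}"

definition null_triples :: "'b set \<Rightarrow> ('b \<Rightarrow> 'b \<Rightarrow> 'b \<Rightarrow> 'b \<Rightarrow> 'p mod_ring) \<Rightarrow> ('b \<times> 'b \<times> 'b) set" where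
  "null_triples G T = {(z, u, v) \<in> G \<times> G \<times> G. \<forall>y\<in>G. T y z u v = 0}"

lemma sum_char_null_pairs:
  assumes "sym_quadrilinear G T" "subspace G" "finite G" "y \<in> G"
  shows "(\<Sum>(z, u, v)\<in>G \<times> G \<times> G. additive_char (T y z u v)) = of_nat (card G * card (null_pairs G T y))"
proof -
  have "(\<Sum>(z, u, v)\<in>G \<times> G \<times> G. additive_char (T y z u v)) =
    (\<Sum>(z, u)\<in>G \<times> G. \<Sum>v\<in>G. additive_char (T y z u v))"
    by (simp flip: sum.cartesian_product)
  also have "\<dots> = (\<Sum>(z, u)\<in>G \<times> G. if \<forall>v\<in>G. T y z u v = 0 then of_nat (card G) else 0)"
    using sum_additive_char[OF sym_quadrilinearD(4)[OF assms(1,2)] assms(2,3)] assms(4)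
    by (intro sum.cong) auto
  also have "\<dots> = (\<Sum>s\<in>{s \<in> G \<times> G. case s of (z, u) \<Rightarrow> \<forall>v\<in>G. T y z u v = 0}. of_nat (card G))"
    by (subst sum.inter_filter) (use assms(3) in \<open>auto intro!: sum.cong\<close>)
  also have "{s \<in> G \<times> G. case s of (z, u) \<Rightarrow> \<forall>v\<in>G. T y z u v = 0} = null_pairs G T y"
    by (auto simp: null_pairs_def)
  also have "(\<Sum>s\<in>null_pairs G T y. of_nat (card G) :: complex) = of_nat (card G * card (null_pairs G T y))"
    by (simp add: mult.commute)
  finally show ?thesis .
qed

text \<open>As a function of \<open>x\<close>, the bias of \<open>T x\<close> is a sum of characters
  of the functionals T(-,z,u,v), so its Fourier coefficients are multiplicities. Convolution squares
  them: a functional given by m triples gets weight m^2, written here as weight m for each of its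
  triples.\<close>

lemma convolution_null_pairs:
  assumes T: "sym_quadrilinear G T" and G: "subspace G" "finite G" and y: "y \<in> G"
  defines "t \<equiv> \<lambda>(z, u, v) y. T y z u v"
  shows "(\<Sum>x\<in>G. of_nat (card G * card (null_pairs G T x)) * of_nat (card G * card (null_pairs G T (y - x)))) =
    of_nat (card G) * (\<Sum>s\<in>G \<times> G \<times> G.
      of_nat (card {r \<in> G \<times> G \<times> G. \<forall>x\<in>G. t r x = t s x}) * additive_char (t s y))"
proof -
  let ?G3 = "G \<times> G \<times> G"
  have t_lin: "linear_on G (t s)" if "s \<in> ?G3" for s
    using that sym_quadrilinearD(1)[OF T G(1)] by (auto simp: t_def)
  have phi: "of_nat (card G * card (null_pairs G T x)) = (\<Sum>s\<in>?G3. additive_char (t s x))" if "x \<in> G" for x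
    using sum_char_null_pairs[OF T G that] by (simp add: t_def case_prod_unfold)
  have "(\<Sum>x\<in>G. of_nat (card G * card (null_pairs G T x)) * of_nat (card G * card (null_pairs G T (y - x))))
    = (\<Sum>x\<in>G. (\<Sum>r\<in>?G3. additive_char (t r x)) * (\<Sum>s\<in>?G3. additive_char (t s (y - x))))"
    using phi y G subspace_diff by (intro sum.cong) auto
  also have "\<dots> = (\<Sum>x\<in>G. \<Sum>r\<in>?G3. \<Sum>s\<in>?G3. additive_char (t s y) * additive_char (t r x - t s x))"
  proof (rule sum.cong[OF refl])
    fix x assume x: "x \<in> G"
    have "additive_char (t r x) * additive_char (t s (y - x)) =
      additive_char (t s y) * additive_char (t r x - t s x)" if "s \<in> ?G3" for r s
    proof -
      have "t r x + t s (y - x) = t s y + (t r x - t s x)"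
        using linear_on_diff[OF t_lin[OF that] G(1) y x] by simp
      then show ?thesis by (metis additive_char_add)
    qed
    then show "(\<Sum>r\<in>?G3. additive_char (t r x)) * (\<Sum>s\<in>?G3. additive_char (t s (y - x))) =
      (\<Sum>r\<in>?G3. \<Sum>s\<in>?G3. additive_char (t s y) * additive_char (t r x - t s x))"
      by (simp add: sum_product)
  qed
  also have "\<dots> = (\<Sum>x\<in>G. \<Sum>s\<in>?G3. \<Sum>r\<in>?G3. additive_char (t s y) * additive_char (t r x - t s x))"
    by (rule sum.cong[OF refl]) (rule sum.swap)
  also have "\<dots> = (\<Sum>s\<in>?G3. \<Sum>x\<in>G. \<Sum>r\<in>?G3. additive_char (t s y) * additive_char (t r x - t s x))"
    by (rule sum.swap)
  also have "\<dots> = (\<Sum>s\<in>?G3. \<Sum>r\<in>?G3. \<Sum>x\<in>G. additive_char (t s y) * additive_char (t r x - t s x))"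
    by (rule sum.cong[OF refl]) (rule sum.swap)
  also have "\<dots> = (\<Sum>s\<in>?G3. additive_char (t s y) *
      (\<Sum>r\<in>?G3. if \<forall>x\<in>G. t r x = t s x then of_nat (card G) else 0))"
  proof (rule sum.cong[OF refl])
    fix s assume s: "s \<in> ?G3"
    have "(\<Sum>x\<in>G. additive_char (t r x - t s x)) = (if \<forall>x\<in>G. t r x = t s x then of_nat (card G) else 0)"
      if "r \<in> ?G3" for r
      using sum_additive_char[OF linear_on_minus[OF t_lin[OF that] t_lin[OF s]] G] by simp
    then show "(\<Sum>r\<in>?G3. \<Sum>x\<in>G. additive_char (t s y) * additive_char (t r x - t s x)) =
      additive_char (t s y) * (\<Sum>r\<in>?G3. if \<forall>x\<in>G. t r x = t s x then of_nat (card G) else 0)"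
      by (simp flip: sum_distrib_left)
  qed
  also have "\<dots> = (\<Sum>s\<in>?G3. additive_char (t s y) *
      (of_nat (card {r \<in> ?G3. \<forall>x\<in>G. t r x = t s x}) * of_nat (card G)))"
    using G by (simp flip: sum.inter_filter)
  also have "\<dots> = of_nat (card G) * (\<Sum>s\<in>?G3.
      of_nat (card {r \<in> ?G3. \<forall>x\<in>G. t r x = t s x}) * additive_char (t s y))"
    by (simp add: sum_distrib_left mult_ac)
  finally show ?thesis .
qed

text \<open>
  \<open>V\<close> is the common kernel of the popular functionals \<open>T(-,z,u,v)\<close>; on \<open>V\<close> their contribution to the
  convolution is positive, and it includes the zero functional.
\<close>

lemma exists_subspace_null_pairs:
  assumes T: "sym_quadrilinear G T" and G: "subspace G" "finite G"
    and \<epsilon>: "0 < \<epsilon>" "\<epsilon> \<le> 1" "real (card (null_triples G T)) = \<epsilon> * real (card G) ^ 3"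
    and k: "2 / \<epsilon>\<^sup>2 \<le> real k"
  shows "\<exists>V\<subseteq>G. subspace V \<and> index_le (CARD('p) * k) G V \<and>
    (\<forall>y\<in>V. \<exists>x\<in>G. (\<epsilon>\<^sup>2 / 2) * real (card G) ^ 2 \<le> card (null_pairs G T x) \<and>
                   (\<epsilon>\<^sup>2 / 2) * real (card G) ^ 2 \<le> card (null_pairs G T (y - x)))"
proof -
  let ?G3 = "G \<times> G \<times> G"
  define N where "N = real (card G)"
  \<comment> \<open>Half of \<epsilon>^2: the zero functional contributes \<epsilon>^2 N^6 to the
    sum \<open>X\<close> below, and the unpopular functionals together at most \<eta> N^6 in
    absolute value.\<close>
  define \<eta> where "\<eta> = \<epsilon>\<^sup>2 / 2"
  have N: "0 < N" using card_subspace_pos G by (simp add: N_def)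
  have \<eta>: "0 < \<eta>" "\<eta> \<le> \<epsilon>"
    using \<epsilon> mult_left_le[of \<epsilon> \<epsilon>] by (auto simp: \<eta>_def power2_eq_square)
  define t where "t = (\<lambda>(z, u, v) y. T y z u v)"
  define m where "m s = card {r \<in> ?G3. \<forall>x\<in>G. t r x = t s x}" for s
  define Pop where "Pop = {s \<in> ?G3. \<eta> * N ^ 3 \<le> real (m s)}"
  \<comment> \<open>Extension by 0 identifies triples with the same functional on \<open>G\<close>,
    so that \<open>P\<close> counts functionals and not triples.\<close>
  define P where "P = (\<lambda>s y. if y \<in> G then t s y else 0) ` Pop"
  define V where "V = {y \<in> G. \<forall>g\<in>P. g y = 0}"
  have fin: "finite ?G3" "finite Pop" "finite P" using G by (auto simp: Pop_def P_def)
  have t_lin: "linear_on G (t s)" if "s \<in> ?G3" for s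
    using that sym_quadrilinearD(1)[OF T G(1)] by (auto simp: t_def)
  have card_G3: "real (card ?G3) = N ^ 3" by (simp add: N_def card_cartesian_product power3_eq_cube)
  have "card P \<le> k"
  proof -
    \<comment> \<open>The fibres over popular functionals are disjoint and have at least \<eta> N^3
      triples each, so there are at most 1/\<eta> of them.\<close>
    define F where "F g = {r \<in> ?G3. (\<lambda>y. if y \<in> G then t r y else 0) = g}" for g
    have "\<eta> * N ^ 3 \<le> real (card (F g))" if g: "g \<in> P" for g
    proof -
      obtain s where s: "s \<in> Pop" "g = (\<lambda>y. if y \<in> G then t s y else 0)" using g by (auto simp: P_def)
      have "{r \<in> ?G3. \<forall>x\<in>G. t r x = t s x} = F g"
        by (auto simp: F_def s(2) fun_eq_iff split: if_splits)
      then show ?thesis using s(1) by (simp add: Pop_def m_def)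
    qed
    then have "real (card P) * (\<eta> * N ^ 3) \<le> (\<Sum>g\<in>P. real (card (F g)))"
      using sum_bounded_below[of P "\<eta> * N ^ 3" "\<lambda>g. real (card (F g))"] by simp
    also have "\<dots> = real (card (\<Union>g\<in>P. F g))"
      using fin G by (subst card_UN_disjoint) (auto simp: F_def)
    also have "card (\<Union>g\<in>P. F g) \<le> card ?G3"
      using fin by (intro card_mono) (auto simp: F_def)
    finally have "real (card P) * (\<eta> * N ^ 3) \<le> N ^ 3" using card_G3 by simp
    then have "real (card P) * \<eta> \<le> 1" using N by (simp flip: mult.assoc)
    then have "real (card P) \<le> 2 / \<epsilon>\<^sup>2" using \<epsilon> by (simp add: \<eta>_def field_simps)
    then show ?thesis using k by linarith
  qed
  moreover have "linear_on G g" if "g \<in> P" for g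
    using that t_lin G linear_on_restrict by (auto simp: P_def Pop_def)
  then have "subspace V \<and> index_le (CARD('p mod_ring) * card P) G V"
    unfolding V_def using index_le_kernels[OF fin(3) _ G] by blast
  ultimately have V: "V \<subseteq> G" "subspace V" "index_le (CARD('p) * k) G V"
    using index_le_mono[of "CARD('p) * card P" G V "CARD('p) * k"] by (auto simp: V_def)
  have "\<exists>x\<in>G. \<eta> * N\<^sup>2 \<le> card (null_pairs G T x) \<and> \<eta> * N\<^sup>2 \<le> card (null_pairs G T (y - x))"
    if y: "y \<in> V" for y
  proof (rule ccontr)
    assume contra: "\<not> ?thesis"
    have yG: "y \<in> G" using y V by auto
    let ?\<Phi> = "\<lambda>x. real (card (null_pairs G T x))"
    have \<Phi>_le: "?\<Phi> x \<le> N\<^sup>2" for x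
    proof -
      have "card (null_pairs G T x) \<le> card (G \<times> G)"
        unfolding null_pairs_def using G by (intro card_mono) auto
      then have "?\<Phi> x \<le> real (card (G \<times> G))" by simp
      then show ?thesis by (simp add: N_def card_cartesian_product power2_eq_square)
    qed
    have "?\<Phi> x * ?\<Phi> (y - x) < \<eta> * N\<^sup>2 * N\<^sup>2" if "x \<in> G" for x
    proof (cases "?\<Phi> x < \<eta> * N\<^sup>2")
      case True
      have "?\<Phi> x * ?\<Phi> (y - x) \<le> ?\<Phi> x * N\<^sup>2" by (rule mult_left_mono[OF \<Phi>_le]) simp
      also have "\<dots> < \<eta> * N\<^sup>2 * N\<^sup>2" by (rule mult_strict_right_mono[OF True]) (use N in simp)
      finally show ?thesis .
    next
      case False
      then have *: "?\<Phi> (y - x) < \<eta> * N\<^sup>2" using contra that by force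
      have "?\<Phi> x * ?\<Phi> (y - x) \<le> N\<^sup>2 * ?\<Phi> (y - x)" by (rule mult_right_mono[OF \<Phi>_le]) simp
      also have "\<dots> < N\<^sup>2 * (\<eta> * N\<^sup>2)" by (rule mult_strict_left_mono[OF *]) (use N in simp)
      finally show ?thesis by (simp add: mult_ac)
    qed
    then have "(\<Sum>x\<in>G. ?\<Phi> x * ?\<Phi> (y - x)) < (\<Sum>x\<in>G. \<eta> * N\<^sup>2 * N\<^sup>2)"
      using G subspace_0 by (intro sum_strict_mono) auto
    also have "\<dots> = \<eta> * N ^ 5" by (simp add: N_def eval_nat_numeral)
    finally have upper: "(\<Sum>x\<in>G. ?\<Phi> x * ?\<Phi> (y - x)) < \<eta> * N ^ 5" .
    define X where "X = (\<Sum>s\<in>?G3. of_nat (m s) * additive_char (t s y))"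
    have "of_real (N\<^sup>2 * (\<Sum>x\<in>G. ?\<Phi> x * ?\<Phi> (y - x))) = of_real N * X"
      using convolution_null_pairs[OF T G yG] unfolding X_def m_def t_def N_def
      by (simp add: sum_distrib_left power2_eq_square mult_ac)
    from arg_cong[OF this, of Re]
    have eq: "N\<^sup>2 * (\<Sum>x\<in>G. ?\<Phi> x * ?\<Phi> (y - x)) = N * Re X" by simp
    define Z where "Z = null_triples G T"
    have Z_m: "real (m s) = \<epsilon> * N ^ 3" if "s \<in> Z" for s
    proof -
      have "{r \<in> ?G3. \<forall>x\<in>G. t r x = t s x} = Z"
        using that by (auto simp: Z_def null_triples_def t_def)
      then show ?thesis using \<epsilon> by (simp add: m_def Z_def N_def)
    qed
    have "\<eta> * N ^ 3 \<le> \<epsilon> * N ^ 3" using \<eta> N by simp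
    then have Z_Pop: "Z \<subseteq> Pop" using Z_m by (auto simp: Pop_def Z_def null_triples_def)
    have "\<epsilon> * N ^ 3 * (\<epsilon> * N ^ 3) = (\<Sum>s\<in>Z. real (m s))"
      using Z_m \<epsilon> by (simp add: Z_def N_def)
    also have "\<dots> \<le> (\<Sum>s\<in>Pop. real (m s))"
      using Z_Pop fin by (intro sum_mono2) auto
    finally have 1: "\<epsilon> * N ^ 3 * (\<epsilon> * N ^ 3) \<le> (\<Sum>s\<in>Pop. real (m s))" .
    have "(\<Sum>s\<in>?G3 - Pop. real (m s)) \<le> real (card (?G3 - Pop)) * (\<eta> * N ^ 3)"
      by (rule sum_bounded_above) (auto simp: Pop_def)
    also have "\<dots> \<le> N ^ 3 * (\<eta> * N ^ 3)"
    proof (rule mult_right_mono)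
      have "card (?G3 - Pop) \<le> card ?G3" using fin by (intro card_mono) auto
      then show "real (card (?G3 - Pop)) \<le> N ^ 3" using card_G3 by linarith
    qed (use \<eta> N in simp)
    finally have 2: "(\<Sum>s\<in>?G3 - Pop. real (m s)) \<le> N ^ 3 * (\<eta> * N ^ 3)" .
    have "Re X = (\<Sum>s\<in>?G3. real (m s) * Re (additive_char (t s y)))"
      by (simp add: X_def)
    also have "\<dots> = (\<Sum>s\<in>?G3 - Pop. real (m s) * Re (additive_char (t s y))) +
        (\<Sum>s\<in>Pop. real (m s) * Re (additive_char (t s y)))"
      by (rule sum.subset_diff) (use fin in \<open>auto simp: Pop_def\<close>)
    also have "(\<Sum>s\<in>Pop. real (m s) * Re (additive_char (t s y))) = (\<Sum>s\<in>Pop. real (m s))"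
    proof (rule sum.cong[OF refl])
      fix s assume "s \<in> Pop"
      then have "(\<lambda>y. if y \<in> G then t s y else 0) \<in> P" unfolding P_def by blast
      then have "t s y = 0" using y yG unfolding V_def by force
      then show "real (m s) * Re (additive_char (t s y)) = real (m s)" by simp
    qed
    finally have split: "Re X = (\<Sum>s\<in>?G3 - Pop. real (m s) * Re (additive_char (t s y))) +
        (\<Sum>s\<in>Pop. real (m s))" .
    have "(\<Sum>s\<in>?G3 - Pop. real (m s) * Re (additive_char (t s y))) \<ge> (\<Sum>s\<in>?G3 - Pop. - real (m s))"
    proof (rule sum_mono)
      fix s
      have "- 1 \<le> Re (additive_char (t s y))"
        using abs_Re_le_cmod[of "additive_char (t s y)"] by simp
      from mult_left_mono[OF this, of "real (m s)"]
      show "- real (m s) \<le> real (m s) * Re (additive_char (t s y))" by simp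
    qed
    then have "(\<Sum>s\<in>Pop. real (m s)) - (\<Sum>s\<in>?G3 - Pop. real (m s)) \<le> Re X"
      unfolding split by (simp add: sum_negf)
    then have "\<epsilon> * N ^ 3 * (\<epsilon> * N ^ 3) - N ^ 3 * (\<eta> * N ^ 3) \<le> Re X" using 1 2 by linarith
    moreover have "\<epsilon> * N ^ 3 * (\<epsilon> * N ^ 3) - N ^ 3 * (\<eta> * N ^ 3) = \<eta> * N ^ 6"
      by (simp add: \<eta>_def power2_eq_square eval_nat_numeral field_simps)
    ultimately have "N * (\<eta> * N ^ 6) \<le> N * Re X" using N by simp
    moreover have "N * Re X < N\<^sup>2 * (\<eta> * N ^ 5)"
      using upper N unfolding eq[symmetric] by simp
    moreover have "N * (\<eta> * N ^ 6) = N\<^sup>2 * (\<eta> * N ^ 5)" by (simp add: eval_nat_numeral)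
    ultimately show False by linarith
  qed
  then show ?thesis using V unfolding \<eta>_def N_def by (intro exI[of _ V]) blast
qed

text \<open>Averaging over \<open>z\<close>: slices whose radical has index above 2^K account for at
  most half of the assumed number of null pairs, so the other \<open>z\<close> have density at least
  2^-K. These need not form a subspace; the level-set lemma supplies one at a larger rank.\<close>

lemma low_slices_of_null_pairs:
  assumes T: "sym_quadrilinear G T" and G: "subspace G" "finite G" and x: "x \<in> G"
    and dense: "\<eta> * real (card G) ^ 2 \<le> card (null_pairs G T x)" and K: "2 \<le> \<eta> * 2 ^ K"
  shows "\<exists>H\<subseteq>G. subspace H \<and> index_le K G H \<and>
    (\<forall>z\<in>H. low_form G (2 * (5 ^ K * K)) (\<lambda>(u, v). T x z u v))"
proof -
  define N where "N = real (card G)"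
  have N: "0 < N" using card_subspace_pos G by (simp add: N_def)
  define L where "L c z = low_form G c (\<lambda>(u, v). T x z u v)" for c z
  define rad where "rad z = {u \<in> G. \<forall>v\<in>G. T x z u v = 0}" for z
  define A where "A = {z \<in> G. index_le K G (rad z)}"
  have A: "A \<subseteq> {z \<in> G. L K z}"
  proof
    fix z assume z: "z \<in> A"
    have "subspace (rad z)" unfolding rad_def
      using sym_quadrilinearD(3)[OF T G(1) x] z by (intro subspace_radical) (auto simp: A_def G)
    then have "L K z"
      unfolding L_def low_form_def using z
      by (intro exI[of _ "rad z"]) (auto simp: A_def rad_def)
    then show "z \<in> {z \<in> G. L K z}" using z by (simp add: A_def)
  qed
  have "null_pairs G T x = Sigma G rad" by (auto simp: null_pairs_def rad_def)
  then have "real (card (null_pairs G T x)) = (\<Sum>z\<in>G. real (card (rad z)))"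
    using G by (simp add: card_SigmaI rad_def)
  also have "\<dots> = (\<Sum>z\<in>G - A. real (card (rad z))) + (\<Sum>z\<in>A. real (card (rad z)))"
    by (rule sum.subset_diff) (use G in \<open>auto simp: A_def\<close>)
  also have "(\<Sum>z\<in>A. real (card (rad z))) \<le> real (card A) * N"
    by (rule sum_bounded_above) (use G in \<open>auto simp: rad_def N_def intro!: card_mono\<close>)
  also have "(\<Sum>z\<in>G - A. real (card (rad z))) \<le> real (card (G - A)) * (N / 2 ^ K)"
  proof (rule sum_bounded_above)
    fix z assume "z \<in> G - A"
    then have "2 ^ K * card (rad z) < card G" by (auto simp: A_def index_le_def)
    then have "real (2 ^ K * card (rad z)) < N" unfolding N_def by (simp only: of_nat_less_iff)
    then show "real (card (rad z)) \<le> N / 2 ^ K" by (simp add: field_simps)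
  qed
  also have "real (card (G - A)) * (N / 2 ^ K) \<le> N * (N / 2 ^ K)"
  proof (rule mult_right_mono)
    show "real (card (G - A)) \<le> N" unfolding N_def using G by (auto intro!: card_mono)
  qed (use N in simp)
  finally have "\<eta> * N\<^sup>2 \<le> N * (N / 2 ^ K) + real (card A) * N" using dense by (simp add: N_def)
  then have "N * (\<eta> * N) \<le> N * (N / 2 ^ K + real (card A))" by (simp add: power2_eq_square algebra_simps)
  then have "\<eta> * N \<le> N / 2 ^ K + real (card A)" using N by simp
  then have "(\<eta> * 2 ^ K) * N \<le> N + 2 ^ K * real (card A)" by (simp add: field_simps)
  moreover have "2 * N \<le> (\<eta> * 2 ^ K) * N" using K N by (intro mult_right_mono) auto
  ultimately have "N \<le> 2 ^ K * real (card A)" by linarith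
  then have "real (card G) \<le> real (2 ^ K * card A)" by (simp add: N_def)
  then have "index_le K G A" unfolding index_le_def by (simp only: of_nat_le_iff)
  then have idx: "index_le K G {z \<in> G. L K z}" using A G by (rule_tac index_le_mono_set) auto
  have "\<exists>c\<le>2 * (5 ^ K * K). subspace {z \<in> G. L c z} \<and> index_le K G {z \<in> G. L c z}"
  proof (rule exists_subspace_level[OF G])
    show "L (a + b) (z + w)" if "z \<in> G" "w \<in> G" "L a z" "L b w" for a b z w
      unfolding L_def
      by (rule low_form_cong[OF low_form_add[OF G that(3)[unfolded L_def] that(4)[unfolded L_def]]])
        (use linear_on_add[OF sym_quadrilinearD(2)[OF T G(1) x]] that in simp)
    show "L a (c *s z)" if "z \<in> G" "L a z" for a c z
      unfolding L_def
      by (rule low_form_cong[OF low_form_cmult[OF that(2)[unfolded L_def], of c]])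
        (use linear_on_scale[OF sym_quadrilinearD(2)[OF T G(1) x]] that in simp)
    show "L b z" if "L a z" "a \<le> b" for a b z
      using that low_form_mono by (auto simp: L_def)
    show "L 0 0"
      unfolding L_def low_form_def
      using linear_on_0[OF sym_quadrilinearD(2)[OF T G(1) x] G(1)] G
      by (intro exI[of _ G]) (auto simp: index_le_refl)
  qed (rule idx)
  then obtain c where c: "c \<le> 2 * (5 ^ K * K)" "subspace {z \<in> G. L c z}" "index_le K G {z \<in> G. L c z}"
    by blast
  then show ?thesis
    using low_form_mono[OF _ c(1)] by (intro exI[of _ "{z \<in> G. L c z}"]) (auto simp: L_def)
qed

end

text \<open>The factor 4 * 5^K * K is the sum of the ranks of two slices; the common span with
  codimension 2 * K contributes 3^(2 * K), and regularising at most (2 * K)^2 forms contributes 4^(4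
  * K^2). The last summand is the cost of the two extra products in \<open>S\<close>.\<close>

definition rank_bound :: "nat \<Rightarrow> nat \<Rightarrow> nat" where
  "rank_bound p K = 4 ^ (4 * K\<^sup>2) * (3 ^ (2 * K) * (4 * (5 ^ K * K))) + 2 * p * (4 * K\<^sup>2)"

text \<open>The codimension given by \<open>symmetric_trilinear_radical\<close> for slices of rank
  \<open>b\<close>.\<close>

definition radical_bound :: "nat \<Rightarrow> nat \<Rightarrow> nat" where
  "radical_bound p b = (p + 1) * b\<^sup>2 + p * ((p + 1) * b\<^sup>2)\<^sup>2"

text \<open>The three summands are the codimensions of \<open>V\<close>, which is cut out by at most
  2^K functionals at cost \<open>p\<close> each, of \<open>H\<close>, and of \<open>U\<close> inside
  \<open>V \<inter> H\<close>.\<close>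

definition index_bound :: "nat \<Rightarrow> nat \<Rightarrow> nat" where
  "index_bound p K = p * 2 ^ K + 4 * K\<^sup>2 + (radical_bound p (rank_bound p K))\<^sup>2 * (rank_bound p K + 1)"

section \<open>Structure of biased symmetric quadrilinear forms\<close>

context prime_field_space
begin

definition bilinear_on :: "'b set \<Rightarrow> ('b \<Rightarrow> 'b \<Rightarrow> 'p mod_ring) \<Rightarrow> bool" where
  "bilinear_on U \<beta> \<longleftrightarrow> (\<forall>z\<in>U. linear_on U (\<lambda>y. \<beta> y z) \<and> linear_on U (\<lambda>y. \<beta> z y))"

lemma bilinear_on_subset: "bilinear_on W \<beta> \<Longrightarrow> U \<subseteq> W \<Longrightarrow> bilinear_on U \<beta>"
  unfolding bilinear_on_def using linear_on_subset by blast

theorem sym_quadrilinear_structure: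
  assumes T: "sym_quadrilinear G T" and G: "subspace G" "finite G"
    and \<epsilon>: "0 < \<epsilon>" "\<epsilon> \<le> 1" "real (card (null_triples G T)) = \<epsilon> * real (card G) ^ 3"
    and K: "4 / \<epsilon>\<^sup>2 \<le> 2 ^ K"
  shows "\<exists>U \<alpha> Q. U \<subseteq> G \<and> subspace U \<and> index_le (index_bound CARD('p) K) G U \<and>
    finite Q \<and> card Q \<le> 4 * K\<^sup>2 \<and>
    (\<forall>q\<in>Q. bilinear_on U (\<alpha> q) \<and> bilinear_on U (\<lambda>u v. q (u, v))) \<and>
    (\<forall>x\<in>U. T x x x x = 3 * (\<Sum>q\<in>Q. \<alpha> q x x * q (x, x)))"
proof -
  note lin = sym_quadrilinearD[OF T G(1)]
  have "2 / \<epsilon>\<^sup>2 \<le> 4 / \<epsilon>\<^sup>2" using \<epsilon> by (intro divide_right_mono) auto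
  then have k: "2 / \<epsilon>\<^sup>2 \<le> real (2 ^ K)" using K by simp
  obtain V where V: "V \<subseteq> G" "subspace V" "index_le (CARD('p) * 2 ^ K) G V"
    and V_near: "\<And>y. y \<in> V \<Longrightarrow> \<exists>x\<in>G. (\<epsilon>\<^sup>2 / 2) * real (card G) ^ 2 \<le> card (null_pairs G T x) \<and>
                   (\<epsilon>\<^sup>2 / 2) * real (card G) ^ 2 \<le> card (null_pairs G T (y - x))"
    using exists_subspace_null_pairs[OF T G \<epsilon> k] by blast
  \<comment> \<open>One \<open>K\<close> serves twice: 2^K bounds the number of popular functionals,
    and 2^-K the density of the slices of low rank.\<close>
  have K': "2 \<le> (\<epsilon>\<^sup>2 / 2) * 2 ^ K" using K \<epsilon> by (simp add: field_simps)
  define a where "a y z = (\<lambda>(u, v). if u \<in> G \<and> v \<in> G then T y z u v else 0)" for y z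
  define B where "B = 4 * (5 ^ K * K)"
  have near: "\<exists>H\<subseteq>G. subspace H \<and> index_le (2 * K) G H \<and> (\<forall>z\<in>H. low_form G B (a y z))"
    if y: "y \<in> V" for y
  proof -
    obtain x where x: "x \<in> G" "(\<epsilon>\<^sup>2 / 2) * real (card G) ^ 2 \<le> card (null_pairs G T x)"
       "(\<epsilon>\<^sup>2 / 2) * real (card G) ^ 2 \<le> card (null_pairs G T (y - x))"
      using V_near[OF y] by blast
    have yx: "y - x \<in> G" "y \<in> G" using x y V G subspace_diff by auto
    obtain H where H: "H \<subseteq> G" "subspace H" "index_le K G H"
      "\<forall>z\<in>H. low_form G (2 * (5 ^ K * K)) (\<lambda>(u, v). T x z u v)"
      using low_slices_of_null_pairs[OF T G x(1,2) K'] by blast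
    obtain H' where H': "H' \<subseteq> G" "subspace H'" "index_le K G H'"
      "\<forall>z\<in>H'. low_form G (2 * (5 ^ K * K)) (\<lambda>(u, v). T (y - x) z u v)"
      using low_slices_of_null_pairs[OF T G yx(1) x(3) K'] by blast
    \<comment> \<open>\<open>T y z\<close> is the sum of \<open>T x z\<close> and
      \<open>T (y - x) z\<close>, and both have low rank by the choice of \<open>x\<close>.\<close>
    have "low_form G B (a y z)" if z: "z \<in> H \<inter> H'" for z
    proof -
      have zH: "z \<in> H" "z \<in> H'" "z \<in> G" using z H by auto
      have "low_form G (2 * (5 ^ K * K) + 2 * (5 ^ K * K))
        (\<lambda>w. (case w of (u, v) \<Rightarrow> T x z u v) + (case w of (u, v) \<Rightarrow> T (y - x) z u v))"
        using H(4) H'(4) zH by (intro low_form_add[OF G]) blast+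
      then have "low_form G (2 * (5 ^ K * K) + 2 * (5 ^ K * K)) (a y z)"
        by (rule low_form_cong)
          (use linear_on_diff[OF lin(1) G(1) yx(2) x(1)] zH in \<open>simp add: a_def\<close>)
      then show ?thesis by (rule low_form_mono) (simp add: B_def)
    qed
    moreover have "index_le (2 * K) G (H \<inter> H')"
      using index_le_Int[OF H(2) H'(2) G(1) H(1) H'(1) G(2) H(3) H'(3)] by (simp add: mult_2)
    ultimately show ?thesis using H(1,2) H'(2) subspace_inter by (intro exI[of _ "H \<inter> H'"]) auto
  qed
  have "\<exists>H Q. H \<subseteq> G \<and> subspace H \<and> index_le ((2 * K)\<^sup>2) G H \<and>
           finite Q \<and> Q \<subseteq> {a y e | y e. y \<in> V \<and> e \<in> G} \<and> card Q \<le> (2 * K)\<^sup>2 \<and>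
           (\<forall>y\<in>V. \<forall>e\<in>H. \<exists>d. low_form G (3 ^ (2 * K) * B) (\<lambda>w. a y e w - (\<Sum>q\<in>Q. d q * q w)))"
  proof (rule exists_common_span_fun)
    show "low_form G (i + j) (\<lambda>w. f w + g w)" if "low_form G i f" "low_form G j g" for i j f g
      using low_form_add[OF G that] .
    show "low_form G i (\<lambda>w. - f w)" if "low_form G i f" for i f
      using low_form_cmult[OF that, of "-1"] by simp
    show "low_form G j f" if "low_form G i f" "i \<le> j" for i j f
      using low_form_mono that by blast
    show "y + y' \<in> V" if "y \<in> V" "y' \<in> V" for y y'
      using that V subspace_add by blast
    show "a (y + y') e w = a y e w + a y' e w" if "y \<in> V" "y' \<in> V" "e \<in> G" for y y' e w
      using linear_on_add[OF lin(1)] that V(1) by (auto simp: a_def case_prod_unfold subset_iff)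
    show "linear_on G (\<lambda>e. a y e w)" if "y \<in> V" for y w
      using lin(2)[of y "fst w" "snd w"] that V(1)
      by (cases "fst w \<in> G \<and> snd w \<in> G") (auto simp: a_def case_prod_unfold linear_on_def)
    show "\<exists>H\<subseteq>G. subspace H \<and> index_le (2 * K) G H \<and> (\<forall>z\<in>H. low_form G B (a y z))" if "y \<in> V" for y
      using near[OF that] .
  qed (use G in simp_all)
  then obtain H Q where H: "H \<subseteq> G" "subspace H" "index_le ((2 * K)\<^sup>2) G H"
    and Q: "finite Q" "Q \<subseteq> {a y e | y e. y \<in> V \<and> e \<in> G}" "card Q \<le> (2 * K)\<^sup>2"
    and sp: "\<And>y e. y \<in> V \<Longrightarrow> e \<in> H \<Longrightarrow>
      \<exists>d. low_form G (3 ^ (2 * K) * B) (\<lambda>w. a y e w - (\<Sum>q\<in>Q. d q * q w))"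
    by auto
  \<comment> \<open>The first argument is controlled on \<open>V\<close>, the second on
    \<open>H\<close>; to use the symmetry of \<open>T\<close> both must range over the same
    subspace.\<close>
  define W where "W = V \<inter> H"
  have W: "subspace W" "W \<subseteq> G" "finite W" "W \<subseteq> V" "W \<subseteq> H"
    using V H G subspace_inter finite_subset unfolding W_def by (auto simp: finite_subset)
  have W_index: "index_le (CARD('p) * 2 ^ K + (2 * K)\<^sup>2) G W"
    unfolding W_def by (rule index_le_Int[OF V(2) H(2) G(1) V(1) H(1) G(2) V(3) H(3)])
  have "approx_by W (3 ^ (2 * K) * B) (W \<times> W) (\<lambda>(y, z) (u, v). T y z u v) Q"
    unfolding approx_by_def
  proof clarify
    fix y z assume yz: "y \<in> W" "z \<in> W"
    then obtain d where "low_form G (3 ^ (2 * K) * B) (\<lambda>w. a y z w - (\<Sum>q\<in>Q. d q * q w))"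
      using sp[of y z] W by auto
    from low_form_restrict[OF this W(2) G(1) W(1) G(2)]
    have "low_form W (3 ^ (2 * K) * B) (\<lambda>w. (case w of (u, v) \<Rightarrow> T y z u v) - (\<Sum>q\<in>Q. d q * q w))"
      by (rule low_form_cong) (use W(2) in \<open>auto simp: a_def\<close>)
    then show "\<exists>d. low_form W (3 ^ (2 * K) * B) (\<lambda>w. (case w of (u, v) \<Rightarrow> T y z u v) - (\<Sum>q\<in>Q. d q * q w))"
      by (rule exI[where x = d])
  qed
  from low_form_regularize[OF W(1,3) Q(1) this]
  obtain Q' b where Q': "Q' \<subseteq> Q" and b: "b \<le> 4 ^ card Q * (3 ^ (2 * K) * B)"
    and approx: "approx_by W b (W \<times> W) (\<lambda>(y, z) (u, v). T y z u v) Q'"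
    and indep: "indep_mod_low W (3 * b) Q'"
    by blast
  have finQ': "finite Q'" and card_Q': "card Q' \<le> 4 * K\<^sup>2"
    using Q' Q card_mono[OF Q(1) Q'] by (auto simp: finite_subset power_mult_distrib)
  have Q'_form: "\<exists>y e. y \<in> G \<and> e \<in> G \<and> q = a y e" if "q \<in> Q'" for q
    using that Q' Q(2) V(1) by blast
  have TW: "sym_quadrilinear W T" using sym_quadrilinear_subset[OF T W(2)] .
  note linW = sym_quadrilinearD[OF TW W(1)]
  have Q'_sym: "q (u, v) = q (v, u)" if q: "q \<in> Q'" "u \<in> W" "v \<in> W" for q u v
  proof -
    obtain y e where "y \<in> G" "e \<in> G" "q = a y e" using Q'_form q by blast
    then show ?thesis using lin(7)[of y e u v] q W(2) by (auto simp: a_def)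
  qed
  have Q'_lin: "linear_on W (\<lambda>u. q (u, v))" if q: "q \<in> Q'" "v \<in> W" for q v
  proof -
    obtain y e where ye: "y \<in> G" "e \<in> G" "q = a y e" using Q'_form q by blast
    have vG: "v \<in> G" using q W(2) by auto
    show ?thesis
      by (rule linear_on_cong[OF W(1) linear_on_subset[OF lin(3)[OF ye(1,2) vG] W(2)]])
        (use vG W(2) ye in \<open>auto simp: a_def\<close>)
  qed
  have Q'_lin2: "linear_on W (\<lambda>v. q (u, v))" if q: "q \<in> Q'" "u \<in> W" for q u
    by (rule linear_on_cong[OF W(1) Q'_lin[OF q]]) (rule Q'_sym[OF q])
  define b' where "b' = b + 2 * CARD('p mod_ring) * card Q'"
  define D where "D = radical_bound CARD('p) b'"
  have "\<exists>U \<alpha>. U \<subseteq> W \<and> subspace U \<and> index_le (D\<^sup>2 * (b' + 1)) W U \<and>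
           (\<forall>q\<in>Q'. \<forall>z\<in>W. linear_on W (\<lambda>y. \<alpha> q y z) \<and> linear_on W (\<lambda>y. \<alpha> q z y)) \<and>
           (\<forall>x\<in>U. T x x x x = 3 * (\<Sum>q\<in>Q'. \<alpha> q x x * q (x, x)))"
    by (rule quartic_on_subspace[OF W(1,3) linW(1) linW(5) linW(6) linW(7) finQ' Q'_lin Q'_sym
          approx indep b'_def refl])
      (simp_all add: D_def radical_bound_def)
  then obtain U \<alpha> where U: "U \<subseteq> W" "subspace U" "index_le (D\<^sup>2 * (b' + 1)) W U"
    and \<alpha>: "\<forall>q\<in>Q'. bilinear_on W (\<alpha> q)"
    and eq: "\<forall>x\<in>U. T x x x x = 3 * (\<Sum>q\<in>Q'. \<alpha> q x x * q (x, x))"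
    unfolding bilinear_on_def by blast
  have "4 ^ card Q \<le> (4 :: nat) ^ (4 * K\<^sup>2)"
    using Q(3) by (intro power_increasing) (auto simp: power_mult_distrib)
  then have "b \<le> 4 ^ (4 * K\<^sup>2) * (3 ^ (2 * K) * B)" using b by (meson le_trans mult_le_mono1)
  moreover have "2 * CARD('p) * card Q' \<le> 2 * CARD('p) * (4 * K\<^sup>2)"
    using card_Q' by (rule mult_le_mono2)
  ultimately have b'_le: "b' \<le> rank_bound CARD('p) K"
    unfolding rank_bound_def b'_def B_def CARD_mod_ring by (rule add_mono)
  have D_le: "D \<le> radical_bound CARD('p) (rank_bound CARD('p) K)"
    unfolding D_def radical_bound_def
    by (intro add_mono mult_le_mono power_mono order_refl b'_le) simp_all
  have "D\<^sup>2 * (b' + 1) \<le> (radical_bound CARD('p) (rank_bound CARD('p) K))\<^sup>2 * (rank_bound CARD('p) K + 1)"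
    by (intro mult_le_mono power_mono D_le add_mono b'_le) simp_all
  then have "index_le (index_bound CARD('p) K) G U"
    by (intro index_le_mono[OF index_le_trans[OF W_index U(3)]]) (simp add: index_bound_def power_mult_distrib)
  moreover have "\<forall>q\<in>Q'. bilinear_on U (\<alpha> q) \<and> bilinear_on U (\<lambda>u v. q (u, v))"
  proof
    fix q assume q: "q \<in> Q'"
    have "bilinear_on W (\<lambda>u v. q (u, v))" using Q'_lin[OF q] Q'_lin2[OF q] by (simp add: bilinear_on_def)
    then show "bilinear_on U (\<alpha> q) \<and> bilinear_on U (\<lambda>u v. q (u, v))"
      using \<alpha> q bilinear_on_subset[OF _ U(1)] by blast
  qed
  ultimately show ?thesis using U(1,2) W(2) finQ' card_Q' eq
    by (intro exI[of _ U] exI[of _ \<alpha>] exI[of _ Q'] conjI) auto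
qed

end

section \<open>Polynomial functions\<close>

text \<open>Vectors are encoded as functions that vanish from \<open>n\<close> on: all functions
  together form an abelian group, as the locales demand of the whole type, while the dimension stays
  a term.\<close>

definition coords :: "nat \<Rightarrow> (nat \<Rightarrow> 'p::prime_card mod_ring) set" where
  "coords n = {x. \<forall>i\<ge>n. x i = 0}"

definition vec_fun :: "nat \<Rightarrow> 'p::prime_card mod_ring vec \<Rightarrow> nat \<Rightarrow> 'p mod_ring" where
  "vec_fun n x = (\<lambda>i. if i < n then x $ i else 0)"

lemma finite_coords: "finite (coords n :: (nat \<Rightarrow> 'p::prime_card mod_ring) set)"
proof -
  have "finite {x :: nat \<Rightarrow> 'p mod_ring. \<forall>i. (i \<in> {..<n} \<longrightarrow> x i \<in> UNIV) \<and> (i \<notin> {..<n} \<longrightarrow> x i = 0)}"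
    by (rule finite_set_of_finite_funs) auto
  then show ?thesis by (rule rev_finite_subset) (auto simp: coords_def)
qed

lemma vec_fun_in_coords: "vec_fun n x \<in> coords n"
  by (simp add: vec_fun_def coords_def)

lemma vec_fun_add: "x \<in> carrier_vec n \<Longrightarrow> y \<in> carrier_vec n \<Longrightarrow> vec_fun n (x + y) = vec_fun n x + vec_fun n y"
  by (auto simp: vec_fun_def fun_eq_iff)

lemma bij_betw_vec_fun: "bij_betw (vec_fun n) (carrier_vec n) (coords n)"
proof (rule bij_betw_byWitness[where f' = "vec n"])
  show "\<forall>x\<in>carrier_vec n. vec n (vec_fun n x) = x" by (auto simp: vec_fun_def)
  show "\<forall>x\<in>coords n. vec_fun n (vec n x) = x" by (auto simp: vec_fun_def coords_def fun_eq_iff)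
qed (auto simp: vec_fun_in_coords)

text \<open>Functions of degree at most \<open>d\<close>, generated by one coordinate factor at a
  time; this induction suits both products and the translation into monomials.\<close>

inductive poly_fun :: "nat \<Rightarrow> nat \<Rightarrow> ((nat \<Rightarrow> 'p::prime_card mod_ring) \<Rightarrow> 'p mod_ring) \<Rightarrow> bool" for n where
  const: "poly_fun n d (\<lambda>x. c)"
| coord: "i < n \<Longrightarrow> poly_fun n d f \<Longrightarrow> poly_fun n (Suc d) (\<lambda>x. x i * f x)"
| add: "poly_fun n d f \<Longrightarrow> poly_fun n d g \<Longrightarrow> poly_fun n d (\<lambda>x. f x + g x)"

lemma poly_fun_mono: "poly_fun n d f \<Longrightarrow> d \<le> e \<Longrightarrow> poly_fun n e f"
proof (induction arbitrary: e rule: poly_fun.induct)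
  case (coord i d f)
  then obtain e' where "e = Suc e'" "d \<le> e'" by (cases e) auto
  then show ?case using coord poly_fun.coord by blast
qed (auto intro: poly_fun.intros)

lemma poly_fun_cmult: "poly_fun n d f \<Longrightarrow> poly_fun n d (\<lambda>x. c * f x)"
proof (induction rule: poly_fun.induct)
  case (coord i d f)
  from poly_fun.coord[OF coord(1,3)] show ?case by (simp add: mult.left_commute)
next
  case (add d f g)
  from poly_fun.add[OF add(3,4)] show ?case by (simp add: distrib_left)
qed (rule poly_fun.const)

lemma poly_fun_mult: "poly_fun n d f \<Longrightarrow> poly_fun n e g \<Longrightarrow> poly_fun n (d + e) (\<lambda>x. f x * g x)"
proof (induction rule: poly_fun.induct)
  case (const d c)
  then show ?case using poly_fun_mono[OF poly_fun_cmult[OF const, of c], of "d + e"] by simp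
next
  case (coord i d f)
  from poly_fun.coord[OF coord(1) coord.IH[OF coord.prems]] show ?case by (simp add: mult.assoc)
next
  case (add d f g')
  from poly_fun.add[OF add.IH(1)[OF add.prems] add.IH(2)[OF add.prems]]
  show ?case by (simp add: distrib_right)
qed

lemma poly_fun_coord: "i < n \<Longrightarrow> 1 \<le> d \<Longrightarrow> poly_fun n d (\<lambda>x. x i)"
  using poly_fun_mono[OF poly_fun.coord[OF _ poly_fun.const[of n 0 1]]] by simp

lemma poly_fun_prod_ex:
  "(\<And>i. i \<in> I \<Longrightarrow> \<exists>d. poly_fun n d (f i)) \<Longrightarrow> \<exists>d. poly_fun n d (\<lambda>x. \<Prod>i\<in>I. f i x)"
proof (induction I rule: infinite_finite_induct)
  case (insert i I)
  then obtain d e where "poly_fun n d (f i)" "poly_fun n e (\<lambda>x. \<Prod>i\<in>I. f i x)" by blast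
  from poly_fun_mult[OF this] show ?case using insert by auto
qed (auto intro: poly_fun.const)

lemma poly_fun_sum_ex:
  "(\<And>i. i \<in> I \<Longrightarrow> \<exists>d. poly_fun n d (f i)) \<Longrightarrow> \<exists>d. poly_fun n d (\<lambda>x. \<Sum>i\<in>I. f i x)"
proof (induction I rule: infinite_finite_induct)
  case (insert i I)
  then obtain d e where "poly_fun n d (f i)" "poly_fun n e (\<lambda>x. \<Sum>i\<in>I. f i x)" by blast
  then have "poly_fun n (max d e) (\<lambda>x. f i x + (\<Sum>i\<in>I. f i x))"
    by (intro poly_fun.add) (auto intro: poly_fun_mono)
  then show ?case using insert by auto
qed (auto intro: poly_fun.const)

text \<open>Lagrange interpolation; this makes the \<open>LEAST\<close> in \<open>fun_degree\<close> meaningful.\<close>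

lemma exists_poly_fun:
  fixes h :: "(nat \<Rightarrow> 'p::prime_card mod_ring) \<Rightarrow> 'p mod_ring"
  shows "\<exists>d g. poly_fun n d g \<and> (\<forall>x\<in>coords n. h x = g x)"
proof -
  define ind where "ind a x = (\<Prod>i<n. \<Prod>b\<in>UNIV - {a i}. (x i + - b) * (1 / (a i - b)))"
    for a x :: "nat \<Rightarrow> 'p mod_ring"
  have ind_poly: "\<exists>d. poly_fun n d (ind a)" for a
    unfolding ind_def
  proof (intro poly_fun_prod_ex)
    fix i b assume "i \<in> {..<n}"
    then have "poly_fun n (1 + 0) (\<lambda>x. (x i + - b) * (1 / (a i - b)))"
      by (intro poly_fun_mult poly_fun.add poly_fun_coord poly_fun.const) auto
    then show "\<exists>d. poly_fun n d (\<lambda>x. (x i + - b) * (1 / (a i - b)))" by blast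
  qed
  have ind_eq: "ind a x = (if x = a then 1 else 0)" if "a \<in> coords n" "x \<in> coords n" for a x
  proof (cases "x = a")
    case True
    then show ?thesis by (simp add: ind_def)
  next
    case False
    then obtain i where i: "x i \<noteq> a i" by blast
    then have "i < n" using that by (cases "i < n") (auto simp: coords_def)
    moreover have "(\<Prod>b\<in>UNIV - {a i}. (x i + - b) * (1 / (a i - b))) = 0"
      using i by (intro prod_zero) (auto intro!: bexI[of _ "x i"])
    ultimately have "ind a x = 0" unfolding ind_def by (intro prod_zero) auto
    then show ?thesis using False by simp
  qed
  have "\<exists>d. poly_fun n d (\<lambda>x. \<Sum>a\<in>coords n. h a * ind a x)"
    using ind_poly poly_fun_cmult by (intro poly_fun_sum_ex) blast
  moreover have "h x = (\<Sum>a\<in>coords n. h a * ind a x)" if "x \<in> coords n" for x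
  proof -
    have "(\<Sum>a\<in>coords n. h a * ind a x) = (\<Sum>a\<in>coords n. if a = x then h a else 0)"
      by (rule sum.cong) (auto simp: ind_eq that)
    then show ?thesis using that sum.delta[OF finite_coords, of x h n] by simp
  qed
  ultimately show ?thesis by blast
qed

section \<open>Translation between polynomial functions and polynomials\<close>

abbreviation monomial_degree :: "(nat \<Rightarrow>\<^sub>0 nat) \<Rightarrow> nat" where
  "monomial_degree m \<equiv> \<Sum>i\<in>Poly_Mapping.keys m. Poly_Mapping.lookup m i"

lemma total_deg_le_iff:
  "total_deg P \<le> d \<longleftrightarrow> (\<forall>m\<in>Poly_Mapping.keys P. monomial_degree m \<le> d)"
  by (simp add: total_deg_def)

definition monomial_eval :: "(nat \<Rightarrow>\<^sub>0 nat) \<Rightarrow> 'p::prime_card mod_ring vec \<Rightarrow> 'p mod_ring" where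
  "monomial_eval m x = (\<Prod>i\<in>Poly_Mapping.keys m. (x $ i) ^ Poly_Mapping.lookup m i)"

lemma mv_eval_superset:
  "finite A \<Longrightarrow> Poly_Mapping.keys P \<subseteq> A \<Longrightarrow>
    mv_eval P x = (\<Sum>m\<in>A. Poly_Mapping.lookup P m * monomial_eval m x)"
  unfolding mv_eval_def monomial_eval_def
  by (rule sum.mono_neutral_left) (auto simp: in_keys_iff)

lemma mv_eval_plus: "mv_eval (P + Q) x = mv_eval P x + mv_eval Q x"
proof -
  let ?A = "Poly_Mapping.keys P \<union> Poly_Mapping.keys Q"
  have "mv_eval (P + Q) x = (\<Sum>m\<in>?A. Poly_Mapping.lookup (P + Q) m * monomial_eval m x)"
    by (rule mv_eval_superset) (simp_all add: Poly_Mapping.keys_add)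
  also have "\<dots> = (\<Sum>m\<in>?A. Poly_Mapping.lookup P m * monomial_eval m x) +
      (\<Sum>m\<in>?A. Poly_Mapping.lookup Q m * monomial_eval m x)"
    by (simp add: lookup_add distrib_right sum.distrib)
  also have "\<dots> = mv_eval P x + mv_eval Q x"
    by (simp add: mv_eval_superset[of ?A])
  finally show ?thesis .
qed

lemma mv_eval_single: "mv_eval (Poly_Mapping.single m c) x = c * monomial_eval m x"
  by (cases "c = 0") (simp_all add: mv_eval_def monomial_eval_def)

lemma mv_eval_sum: "mv_eval (\<Sum>i\<in>I. P i) x = (\<Sum>i\<in>I. mv_eval (P i) x)"
  by (induction I rule: infinite_finite_induct) (simp_all add: mv_eval_plus mv_eval_def[of 0])

lemma monomial_degree_superset:
  "finite A \<Longrightarrow> Poly_Mapping.keys m \<subseteq> A \<Longrightarrow> monomial_degree m = (\<Sum>i\<in>A. Poly_Mapping.lookup m i)"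
  by (rule sum.mono_neutral_left) (auto simp: in_keys_iff)

lemma monomial_eval_superset:
  "finite A \<Longrightarrow> Poly_Mapping.keys m \<subseteq> A \<Longrightarrow> monomial_eval m x = (\<Prod>i\<in>A. (x $ i) ^ Poly_Mapping.lookup m i)"
  unfolding monomial_eval_def by (rule prod.mono_neutral_left) (auto simp: in_keys_iff)

lemma monomial_times_coord:
  fixes m :: "nat \<Rightarrow>\<^sub>0 nat" and i :: nat
  defines "m' \<equiv> Poly_Mapping.single i 1 + m"
  shows "monomial_eval m' x = x $ i * monomial_eval m x"
    and "monomial_degree m' = Suc (monomial_degree m)"
    and "Poly_Mapping.keys m' \<subseteq> insert i (Poly_Mapping.keys m)"
proof -
  let ?A = "insert i (Poly_Mapping.keys m)"
  show keys: "Poly_Mapping.keys m' \<subseteq> ?A"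
    unfolding m'_def by (rule order.trans[OF Poly_Mapping.keys_add]) auto
  have lk: "Poly_Mapping.lookup m' j = (if j = i then 1 else 0) + Poly_Mapping.lookup m j" for j
    by (auto simp: m'_def lookup_add lookup_single)
  have "monomial_eval m' x = (\<Prod>j\<in>?A. (x $ j) ^ Poly_Mapping.lookup m' j)"
    using keys by (intro monomial_eval_superset) auto
  also have "\<dots> = (\<Prod>j\<in>?A. if j = i then x $ j else 1) * (\<Prod>j\<in>?A. (x $ j) ^ Poly_Mapping.lookup m j)"
    unfolding prod.distrib[symmetric] by (rule prod.cong) (auto simp: lk power_add)
  also have "(\<Prod>j\<in>?A. if j = i then x $ j else 1) = x $ i" by (subst prod.delta) auto
  also have "(\<Prod>j\<in>?A. (x $ j) ^ Poly_Mapping.lookup m j) = monomial_eval m x"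
    by (rule monomial_eval_superset[symmetric]) auto
  finally show "monomial_eval m' x = x $ i * monomial_eval m x" .
  have "monomial_degree m' = (\<Sum>j\<in>?A. Poly_Mapping.lookup m' j)"
    using keys by (intro monomial_degree_superset) auto
  also have "\<dots> = (\<Sum>j\<in>?A. if j = i then 1 else 0) + (\<Sum>j\<in>?A. Poly_Mapping.lookup m j)"
    unfolding sum.distrib[symmetric] by (rule sum.cong) (auto simp: lk)
  also have "(\<Sum>j\<in>?A. if j = i then 1 else 0) = (1 :: nat)" by (subst sum.delta) auto
  also have "(\<Sum>j\<in>?A. Poly_Mapping.lookup m j) = monomial_degree m"
    by (rule monomial_degree_superset[symmetric]) auto
  finally show "monomial_degree m' = Suc (monomial_degree m)" by simp
qed

lemma poly_fun_imp_mv_poly: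
  fixes f :: "(nat \<Rightarrow> 'p::prime_card mod_ring) \<Rightarrow> 'p mod_ring"
  assumes "poly_fun n d f"
  shows "\<exists>P\<in>mv_polys n. total_deg P \<le> d \<and> (\<forall>x\<in>carrier_vec n. f (vec_fun n x) = mv_eval P x)"
  using assms
proof (induction rule: poly_fun.induct)
  case (const d c)
  show ?case
    by (rule bexI[of _ "Poly_Mapping.single 0 c"])
      (auto simp: total_deg_le_iff mv_eval_single monomial_eval_def mv_polys_def split: if_splits)
next
  case (add d f g)
  then obtain P Q where P: "P \<in> mv_polys n" "total_deg P \<le> d" "\<forall>x\<in>carrier_vec n. f (vec_fun n x) = mv_eval P x"
    and Q: "Q \<in> mv_polys n" "total_deg Q \<le> d" "\<forall>x\<in>carrier_vec n. g (vec_fun n x) = mv_eval Q x"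
    by blast
  have "Poly_Mapping.keys (P + Q) \<subseteq> Poly_Mapping.keys P \<union> Poly_Mapping.keys Q"
    by (rule Poly_Mapping.keys_add)
  then show ?case using P Q
    by (intro bexI[of _ "P + Q"]) (auto simp: total_deg_le_iff mv_eval_plus mv_polys_def subset_iff)
next
  case (coord i d f)
  then obtain P where P: "P \<in> mv_polys n" "total_deg P \<le> d" "\<forall>x\<in>carrier_vec n. f (vec_fun n x) = mv_eval P x"
    by blast
  define Q where "Q = (\<Sum>m\<in>Poly_Mapping.keys P.
    Poly_Mapping.single (Poly_Mapping.single i 1 + m) (Poly_Mapping.lookup P m))"
  have keys: "Poly_Mapping.keys Q \<subseteq> (\<lambda>m. Poly_Mapping.single i 1 + m) ` Poly_Mapping.keys P"
    unfolding Q_def by (rule order.trans[OF keys_sum]) (auto split: if_splits)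
  have "mv_eval Q x = x $ i * mv_eval P x" for x
    unfolding Q_def mv_eval_sum mv_eval_single monomial_times_coord(1)
    by (simp add: mv_eval_def monomial_eval_def sum_distrib_left mult_ac)
  moreover have "vec_fun n x i = x $ i" for x :: "'p mod_ring vec"
    using coord by (simp add: vec_fun_def)
  moreover have "total_deg Q \<le> Suc d"
    unfolding total_deg_le_iff
  proof
    fix m assume "m \<in> Poly_Mapping.keys Q"
    then obtain m0 where m0: "m0 \<in> Poly_Mapping.keys P" "m = Poly_Mapping.single i 1 + m0"
      using keys by blast
    then show "monomial_degree m \<le> Suc d"
      using P(2) monomial_times_coord(2)[of i m0] by (simp add: total_deg_le_iff)
  qed
  moreover have "Q \<in> mv_polys n"
    unfolding mv_polys_def
  proof (intro CollectI ballI)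
    fix m assume "m \<in> Poly_Mapping.keys Q"
    then obtain m0 where m0: "m0 \<in> Poly_Mapping.keys P" "m = Poly_Mapping.single i 1 + m0"
      using keys by blast
    then have "Poly_Mapping.keys m0 \<subseteq> {..<n}" using P(1) by (simp add: mv_polys_def)
    then show "Poly_Mapping.keys m \<subseteq> {..<n}"
      using monomial_times_coord(3)[of i m0] m0 coord(1) by auto
  qed
  ultimately show ?case using P(3) by (intro bexI[of _ Q]) auto
qed

lemma fun_degree_le:
  assumes "poly_fun n d h" "\<And>x. x \<in> carrier_vec n \<Longrightarrow> f x = h (vec_fun n x)"
  shows "fun_degree n f \<le> d"
proof -
  obtain P where P: "P \<in> mv_polys n" "total_deg P \<le> d" "\<forall>x\<in>carrier_vec n. h (vec_fun n x) = mv_eval P x"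
    using poly_fun_imp_mv_poly[OF assms(1)] by blast
  then have "fun_degree n f \<le> total_deg P"
    unfolding fun_degree_def using assms(2) by (intro Least_le) auto
  then show ?thesis using P by linarith
qed

lemma fun_degree_witness:
  fixes f :: "'p::prime_card vfun"
  shows "\<exists>P\<in>mv_polys n. total_deg P = fun_degree n f \<and> (\<forall>x\<in>carrier_vec n. f x = mv_eval P x)"
proof -
  obtain d g where g: "poly_fun n d g" "\<forall>x\<in>coords n. f (vec n x) = g x"
    using exists_poly_fun[of n "\<lambda>x. f (vec n x)"] by blast
  have "f x = g (vec_fun n x)" if "x \<in> carrier_vec n" for x
  proof -
    have "vec n (vec_fun n x) = x" using that by (auto simp: vec_fun_def)
    then show ?thesis using g(2) vec_fun_in_coords[of n x] by metis
  qed
  then have "\<exists>e. \<exists>P\<in>mv_polys n. total_deg P = e \<and> (\<forall>x\<in>carrier_vec n. f x = mv_eval P x)"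
    using poly_fun_imp_mv_poly[OF g(1)] by auto
  from LeastI_ex[OF this] show ?thesis unfolding fun_degree_def .
qed

text \<open>
  Homogenisation: a monomial of degree at most four is a product of exactly four factors
  \<open>hom_coord n x j\<close> with \<open>j \<le> n\<close>, where the index \<open>n\<close> stands for the constant one
  (recall that \<open>x n = 0\<close> for \<open>x \<in> coords n\<close>).
\<close>

definition hom_coord :: "nat \<Rightarrow> (nat \<Rightarrow> 'p::prime_card mod_ring) \<Rightarrow> nat \<Rightarrow> 'p mod_ring" where
  "hom_coord n x j = x j + (if j = n then 1 else 0)"

lemma prod_powers_hom_coord:
  fixes m :: "nat \<Rightarrow> nat"
  assumes "finite A" "A \<subseteq> {..<n}" "sum m A \<le> d"
  shows "\<exists>js. length js = d \<and> set js \<subseteq> {..n} \<and>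
    (\<forall>x :: nat \<Rightarrow> 'p::prime_card mod_ring. x \<in> coords n \<longrightarrow> (\<Prod>i\<in>A. x i ^ m i) = prod_list (map (hom_coord n x) js))"
  using assms
proof (induction A arbitrary: d rule: finite_induct)
  case empty
  have "prod_list (replicate d (1 :: 'p mod_ring)) = 1" by (induction d) auto
  then show ?case
    by (intro exI[of _ "replicate d n"]) (auto simp: hom_coord_def coords_def)
next
  case (insert i A)
  then have "m i + sum m A \<le> d" by simp
  then have "A \<subseteq> {..<n}" "sum m A \<le> d - m i" using insert.prems by auto
  from insert.IH[OF this] obtain js where js: "length js = d - m i" "set js \<subseteq> {..n}"
    "\<And>x :: nat \<Rightarrow> 'p mod_ring. x \<in> coords n \<Longrightarrow> (\<Prod>i\<in>A. x i ^ m i) = prod_list (map (hom_coord n x) js)"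
    by blast
  have "prod_list (replicate k (hom_coord n x i)) = x i ^ k" for x :: "nat \<Rightarrow> 'p mod_ring" and k
    using insert.prems by (induction k) (auto simp: hom_coord_def)
  then show ?case
    using js insert \<open>m i + sum m A \<le> d\<close>
    by (intro exI[of _ "replicate (m i) i @ js"]) (auto simp: less_imp_le)
qed

lemma mv_eval_quartic:
  fixes P :: "'p::prime_card mv_poly"
  assumes "P \<in> mv_polys n" "total_deg P \<le> 4"
  obtains M :: "(nat \<Rightarrow>\<^sub>0 nat) set" and i j k l :: "(nat \<Rightarrow>\<^sub>0 nat) \<Rightarrow> nat" and c :: "(nat \<Rightarrow>\<^sub>0 nat) \<Rightarrow> 'p mod_ring"
  where "\<And>m. m \<in> M \<Longrightarrow> i m \<le> n \<and> j m \<le> n \<and> k m \<le> n \<and> l m \<le> n"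
    "\<And>x. mv_eval P x = (\<Sum>m\<in>M. c m * (hom_coord n (vec_fun n x) (i m) * hom_coord n (vec_fun n x) (j m) *
        hom_coord n (vec_fun n x) (k m) * hom_coord n (vec_fun n x) (l m)))"
proof -
  have "\<exists>js. length js = 4 \<and> set js \<subseteq> {..n} \<and>
    (\<forall>x :: nat \<Rightarrow> 'p mod_ring. x \<in> coords n \<longrightarrow> (\<Prod>i\<in>Poly_Mapping.keys m. x i ^ Poly_Mapping.lookup m i) = prod_list (map (hom_coord n x) js))"
    if "m \<in> Poly_Mapping.keys P" for m
    using assms that by (intro prod_powers_hom_coord) (auto simp: mv_polys_def total_deg_le_iff)
  then obtain js where js: "\<And>m. m \<in> Poly_Mapping.keys P \<Longrightarrow> length (js m) = 4 \<and> set (js m) \<subseteq> {..n} \<and>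
    (\<forall>x :: nat \<Rightarrow> 'p mod_ring. x \<in> coords n \<longrightarrow> (\<Prod>i\<in>Poly_Mapping.keys m. x i ^ Poly_Mapping.lookup m i) = prod_list (map (hom_coord n x) (js m)))"
    by metis
  show ?thesis
  proof (rule that[of "Poly_Mapping.keys P" "\<lambda>m. js m ! 0" "\<lambda>m. js m ! 1" "\<lambda>m. js m ! 2" "\<lambda>m. js m ! 3"
        "Poly_Mapping.lookup P"])
    fix m assume m: "m \<in> Poly_Mapping.keys P"
    have "js m ! t \<le> n" if "t < 4" for t
      using js[OF m] that by (metis atMost_iff nth_mem subsetD)
    then show "js m ! 0 \<le> n \<and> js m ! 1 \<le> n \<and> js m ! 2 \<le> n \<and> js m ! 3 \<le> n" by simp
  next
    fix x :: "'p mod_ring vec"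
    have list4: "prod_list (map h xs) = h (xs ! 0) * h (xs ! 1) * h (xs ! 2) * h (xs ! 3)"
      if "length xs = 4" for h :: "nat \<Rightarrow> 'p mod_ring" and xs
      using that by (auto simp: numeral_eq_Suc length_Suc_conv mult.assoc)
    show "mv_eval P x = (\<Sum>m\<in>Poly_Mapping.keys P. Poly_Mapping.lookup P m *
        (hom_coord n (vec_fun n x) (js m ! 0) * hom_coord n (vec_fun n x) (js m ! 1) *
        hom_coord n (vec_fun n x) (js m ! 2) * hom_coord n (vec_fun n x) (js m ! 3)))"
      unfolding mv_eval_def
    proof (rule sum.cong[OF refl])
      fix m assume m: "m \<in> Poly_Mapping.keys P"
      have "(\<Prod>i\<in>Poly_Mapping.keys m. (x $ i) ^ Poly_Mapping.lookup m i) =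
        (\<Prod>i\<in>Poly_Mapping.keys m. vec_fun n x i ^ Poly_Mapping.lookup m i)"
        using m assms(1) by (intro prod.cong) (auto simp: mv_polys_def vec_fun_def)
      also have "\<dots> = prod_list (map (hom_coord n (vec_fun n x)) (js m))" using js[OF m] vec_fun_in_coords by blast
      finally show "Poly_Mapping.lookup P m * (\<Prod>i\<in>Poly_Mapping.keys m. (x $ i) ^ Poly_Mapping.lookup m i) =
        Poly_Mapping.lookup P m * (hom_coord n (vec_fun n x) (js m ! 0) * hom_coord n (vec_fun n x) (js m ! 1) *
        hom_coord n (vec_fun n x) (js m ! 2) * hom_coord n (vec_fun n x) (js m ! 3))"
        using js[OF m] by (simp add: list4)
    qed
  qed
qed

text \<open>The permanent of the 4 x 4 matrix with rows \<open>y\<close>, \<open>z\<close>,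
  \<open>u\<close>, \<open>v\<close> and columns \<open>i\<close>, \<open>j\<close>,
  \<open>k\<close>, \<open>l\<close>, expanded along its rows: the full polarisation of a monomial
  with four factors, a sum of 24 products.\<close>

definition perm4 :: "nat \<Rightarrow> nat \<Rightarrow> nat \<Rightarrow> nat \<Rightarrow> (nat \<Rightarrow> 'a) \<Rightarrow> (nat \<Rightarrow> 'a) \<Rightarrow> (nat \<Rightarrow> 'a) \<Rightarrow> (nat \<Rightarrow> 'a) \<Rightarrow> 'a::comm_ring_1"
  where "perm4 i j k l y z u v =
    y i * (z j * (u k * v l + u l * v k) + z k * (u j * v l + u l * v j) + z l * (u j * v k + u k * v j)) +
    y j * (z i * (u k * v l + u l * v k) + z k * (u i * v l + u l * v i) + z l * (u i * v k + u k * v i)) +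
    y k * (z i * (u j * v l + u l * v j) + z j * (u i * v l + u l * v i) + z l * (u i * v j + u j * v i)) +
    y l * (z i * (u j * v k + u k * v j) + z j * (u i * v k + u k * v i) + z k * (u i * v j + u j * v i))"

lemma perm4_sym:
  "perm4 i j k l y z u v = perm4 i j k l z y u v"
  "perm4 i j k l y z u v = perm4 i j k l y u z v"
  "perm4 i j k l y z u v = perm4 i j k l y z v u"
  unfolding perm4_def by (simp_all add: algebra_simps)

lemma perm4_add: "perm4 i j k l (x + y) z u v = perm4 i j k l x z u v + perm4 i j k l y z u v"
  unfolding perm4_def plus_fun_apply by (simp add: algebra_simps)

lemma perm4_scale: "perm4 i j k l (\<lambda>i. c * y i) z u v = c * perm4 i j k l y z u v"
  unfolding perm4_def by (simp add: algebra_simps)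

lemma perm4_diag: "perm4 i j k l x x x x = 24 * (x i * x j * x k * x l)"
  unfolding perm4_def by (simp add: algebra_simps)

definition diff_dir :: "'v::plus \<Rightarrow> ('v \<Rightarrow> 'a::ab_group_add) \<Rightarrow> 'v \<Rightarrow> 'a" where
  "diff_dir y f = (\<lambda>x. f (x + y) - f x)"

lemma diff_dir_sum:
  fixes f :: "'i \<Rightarrow> 'v::plus \<Rightarrow> 'a::ring"
  shows "diff_dir y (\<lambda>x. \<Sum>i\<in>I. c i * f i x) = (\<lambda>x. \<Sum>i\<in>I. c i * diff_dir y (f i) x)"
  by (simp add: diff_dir_def sum_subtractf right_diff_distrib)

text \<open>The Leibniz rule for an affine factor with linear part \<open>f'\<close>. The other
  factor appears shifted by \<open>y\<close>; the shift is lost once the remaining derivatives make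
  that factor constant.\<close>

lemma diff_dir_affine_mult:
  fixes f g :: "'v::ab_group_add \<Rightarrow> 'a::comm_ring_1"
  assumes "\<And>x y. f (x + y) = f x + f' y"
  shows "diff_dir y (\<lambda>x. f x * g x) = (\<lambda>x. f x * diff_dir y g x + f' y * g (x + y))"
  by (simp add: diff_dir_def assms algebra_simps)

lemma diff_dir_simps:
  fixes f g :: "'v::ab_group_add \<Rightarrow> 'a::comm_ring_1"
  shows "diff_dir y (\<lambda>x. f x + g x) = (\<lambda>x. diff_dir y f x + diff_dir y g x)"
    and "diff_dir y (\<lambda>x. c * f x) = (\<lambda>x. c * diff_dir y f x)"
    and "diff_dir y (\<lambda>x. f (x + z)) = (\<lambda>x. diff_dir y f (x + z))"
    and "diff_dir y (\<lambda>x. c) = (\<lambda>x. 0)"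
  by (simp_all add: diff_dir_def algebra_simps)

text \<open>The affine factors are peeled off one by one; \<open>p2\<close> and \<open>p3\<close>
  are the permanents of the linear parts that arise as top derivatives of the inner
  products.\<close>

lemma diff_dir_4_product:
  fixes a b c d :: "'v::ab_group_add \<Rightarrow> 'a::comm_ring_1"
  assumes a: "\<And>x y. a (x + y) = a x + a' y" and b: "\<And>x y. b (x + y) = b x + b' y"
    and c: "\<And>x y. c (x + y) = c x + c' y" and d: "\<And>x y. d (x + y) = d x + d' y"
  defines "p2 \<equiv> \<lambda>u v. c' u * d' v + c' v * d' u"
  defines "p3 \<equiv> \<lambda>z u v. b' z * p2 u v + b' u * p2 z v + b' v * p2 z u"
  shows "diff_dir v (diff_dir u (diff_dir z (diff_dir y (\<lambda>x. a x * (b x * (c x * d x)))))) =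
    (\<lambda>x. a' y * p3 z u v + a' z * p3 y u v + a' u * p3 y z v + a' v * p3 y z u)"
proof -
  have d1: "diff_dir y d = (\<lambda>x. d' y)" for y by (simp add: diff_dir_def d)
  have d2: "diff_dir v (diff_dir u (\<lambda>x. c x * d x)) = (\<lambda>x. p2 u v)" for u v
    by (simp add: diff_dir_affine_mult[of c c', OF c] diff_dir_simps d1 p2_def d algebra_simps)
  have d3: "diff_dir v (diff_dir u (diff_dir z (\<lambda>x. b x * (c x * d x)))) = (\<lambda>x. p3 z u v)" for z u v
    by (simp add: diff_dir_affine_mult[of b b', OF b] diff_dir_simps(1-3)
        diff_dir_simps(3)[where f = "\<lambda>x. c x * d x"] diff_dir_simps(4) d2 p3_def add_ac)
  show ?thesis
    by (simp add: diff_dir_affine_mult[of a a', OF a] diff_dir_simps(1-3)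
        diff_dir_simps(3)[where f = "\<lambda>x. b x * (c x * d x)"] diff_dir_simps(4) d3 add_ac)
qed

lemma fold_deriv_dir:
  assumes "\<And>x. x \<in> carrier_vec n \<Longrightarrow> f x = h (vec_fun n x)" "set ys \<subseteq> carrier_vec n" "x \<in> carrier_vec n"
  shows "fold deriv_dir ys f x = fold diff_dir (map (vec_fun n) ys) h (vec_fun n x)"
  using assms
proof (induction ys arbitrary: f h)
  case (Cons y ys)
  have "deriv_dir y f x = diff_dir (vec_fun n y) h (vec_fun n x)" if "x \<in> carrier_vec n" for x
    using Cons.prems that by (simp add: deriv_dir_def diff_dir_def vec_fun_add plus_fun_def)
  from Cons.IH[of "deriv_dir y f" "diff_dir (vec_fun n y) h", OF this] show ?case
    using Cons.prems by simp
qed simp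

lemma diff_dir_4_hom_coord:
  "diff_dir v (diff_dir u (diff_dir z (diff_dir y (\<lambda>x. hom_coord n x i * (hom_coord n x j * (hom_coord n x k * hom_coord n x l))))))
    = (\<lambda>x. perm4 i j k l y z u v)"
proof -
  have aff: "hom_coord n (x + y) i = hom_coord n x i + y i" for x y :: "nat \<Rightarrow> 'p::prime_card mod_ring" and i
    by (simp add: hom_coord_def)
  show ?thesis
    by (subst diff_dir_4_product[where a' = "\<lambda>y. y i" and b' = "\<lambda>y. y j" and c' = "\<lambda>y. y k" and d' = "\<lambda>y. y l"])
      (simp_all add: aff perm4_def algebra_simps)
qed

text \<open>Only values on \<open>coords n\<close> count, because the projection and the forms
  composed with it are controlled only there.\<close>

definition poly_on :: "nat \<Rightarrow> nat \<Rightarrow> ((nat \<Rightarrow> 'p::prime_card mod_ring) \<Rightarrow> 'p mod_ring) \<Rightarrow> bool" where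
  "poly_on n d f \<longleftrightarrow> (\<exists>h. poly_fun n d h \<and> (\<forall>x\<in>coords n. f x = h x))"

lemma poly_on_poly_fun: "poly_fun n d f \<Longrightarrow> poly_on n d f"
  unfolding poly_on_def by blast

lemma poly_on_coord: "i < n \<Longrightarrow> poly_on n 1 (\<lambda>x. x i)"
  by (simp add: poly_on_poly_fun poly_fun_coord)

lemma poly_on_cong: "poly_on n d f \<Longrightarrow> (\<And>x. x \<in> coords n \<Longrightarrow> g x = f x) \<Longrightarrow> poly_on n d g"
  unfolding poly_on_def by metis

lemma poly_on_mono: "poly_on n d f \<Longrightarrow> d \<le> e \<Longrightarrow> poly_on n e f"
  unfolding poly_on_def using poly_fun_mono by blast

lemma poly_on_add:
  assumes "poly_on n d f" "poly_on n d g" shows "poly_on n d (\<lambda>x. f x + g x)"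
proof -
  obtain h h' where "poly_fun n d h" "\<forall>x\<in>coords n. f x = h x" "poly_fun n d h'" "\<forall>x\<in>coords n. g x = h' x"
    using assms unfolding poly_on_def by blast
  then show ?thesis unfolding poly_on_def using poly_fun.add by (intro exI[of _ "\<lambda>x. h x + h' x"]) auto
qed

lemma poly_on_mult:
  assumes "poly_on n d f" "poly_on n e g" shows "poly_on n (d + e) (\<lambda>x. f x * g x)"
proof -
  obtain h h' where "poly_fun n d h" "\<forall>x\<in>coords n. f x = h x" "poly_fun n e h'" "\<forall>x\<in>coords n. g x = h' x"
    using assms unfolding poly_on_def by blast
  then show ?thesis unfolding poly_on_def using poly_fun_mult by (intro exI[of _ "\<lambda>x. h x * h' x"]) auto
qed

lemma poly_on_cmult: "poly_on n d f \<Longrightarrow> poly_on n d (\<lambda>x. c * f x)"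
  using poly_on_mult[OF poly_on_poly_fun[OF poly_fun.const[of n 0 c]]] by simp

lemma poly_on_sum: "(\<And>i. i \<in> I \<Longrightarrow> poly_on n d (f i)) \<Longrightarrow> poly_on n d (\<lambda>x. \<Sum>i\<in>I. f i x)"
  by (induction I rule: infinite_finite_induct)
    (auto intro: poly_on_add poly_on_poly_fun[OF poly_fun.const])

lemma fun_degree_le_poly_on:
  assumes "poly_on n d h" "\<And>x. x \<in> carrier_vec n \<Longrightarrow> f x = h (vec_fun n x)"
  shows "fun_degree n f \<le> d"
proof -
  obtain h' where "poly_fun n d h'" "\<forall>x\<in>coords n. h x = h' x" using assms unfolding poly_on_def by blast
  then show ?thesis using assms(2) vec_fun_in_coords by (intro fun_degree_le[of n d h']) auto
qed

interpretation vf: prime_field_space "\<lambda>c (f :: nat \<Rightarrow> 'p::prime_card mod_ring) i. c * f i"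
  by unfold_locales (auto simp: fun_eq_iff algebra_simps)

lemma subspace_coords: "vf.subspace (coords n)"
  by (auto simp: vf.subspace_def coords_def)

lemma coords_expansion:
  fixes x :: "nat \<Rightarrow> 'p::prime_card mod_ring"
  assumes "vf.linear_on (coords n) g" "x \<in> coords n"
  shows "g x = (\<Sum>i<n. x i * g (\<lambda>j. if j = i then 1 else 0))"
proof -
  let ?e = "\<lambda>i j. if j = i then 1 else 0 :: 'p mod_ring"
  have step: "g (\<lambda>j. if j < m then x j else 0) = (\<Sum>i<m. x i * g (?e i))" if "m \<le> n" for m
    using that
  proof (induction m)
    case 0
    have "g 0 = 0" using vf.linear_on_0[OF assms(1) subspace_coords] .
    then show ?case by (simp add: zero_fun_def)
  next
    case (Suc m)
    have "(\<lambda>j. if j < Suc m then x j else 0) = (\<lambda>j. if j < m then x j else 0) + (\<lambda>j. x m * ?e m j)"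
      by (auto simp: fun_eq_iff less_Suc_eq)
    moreover have "(\<lambda>j. if j < m then x j else 0) \<in> coords n" "?e m \<in> coords n"
      "(\<lambda>j. x m * ?e m j) \<in> coords n"
      using Suc.prems by (auto simp: coords_def)
    ultimately have "g (\<lambda>j. if j < Suc m then x j else 0) = g (\<lambda>j. if j < m then x j else 0) + x m * g (?e m)"
      using vf.linear_on_add[OF assms(1)] vf.linear_on_scale[OF assms(1), of "?e m" "x m"] by simp
    then show ?case using Suc by simp
  qed
  have "(\<lambda>j. if j < n then x j else 0) = x"
    using assms(2) by (auto simp: coords_def fun_eq_iff)
  then show ?thesis using step[of n] by simp
qed

lemma poly_on_linear: "vf.linear_on (coords n) g \<Longrightarrow> poly_on n 1 g"
proof (rule poly_on_cong)
  show "poly_on n 1 (\<lambda>x. \<Sum>i<n. x i * g (\<lambda>j. if j = i then 1 else 0))"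
    using poly_on_mult[OF poly_on_poly_fun[OF poly_fun_coord[OF _ order_refl]] poly_on_poly_fun[OF poly_fun.const[of n 0]]]
    by (intro poly_on_sum) simp
qed (rule coords_expansion)

text \<open>Expanding the first argument alone in coordinates leaves linear functions as cofactors.
  The trilinear case repeats this with diagonals of bilinear forms as cofactors.\<close>

lemma poly_on_bilinear:
  assumes "\<And>y. y \<in> coords n \<Longrightarrow> vf.linear_on (coords n) (\<lambda>x. \<beta> x y)"
    and "\<And>x. x \<in> coords n \<Longrightarrow> vf.linear_on (coords n) (\<beta> x)"
  shows "poly_on n 2 (\<lambda>x. \<beta> x x)"
proof (rule poly_on_cong)
  let ?e = "\<lambda>i j. if j = i then 1 else 0"
  have "poly_on n 1 (\<beta> (?e i))" if "i < n" for i
    using that assms(2)[of "?e i"] by (intro poly_on_linear) (simp add: coords_def)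
  then have "poly_on n (1 + 1) (\<lambda>x. x i * \<beta> (?e i) x)" if "i < n" for i
    using that by (intro poly_on_mult[OF poly_on_coord]) auto
  then show "poly_on n 2 (\<lambda>x. \<Sum>i<n. x i * \<beta> (?e i) x)"
    by (intro poly_on_sum) (simp add: numeral_2_eq_2)
  show "\<beta> x x = (\<Sum>i<n. x i * \<beta> (?e i) x)" if "x \<in> coords n" for x
    using coords_expansion[OF assms(1)[OF that] that] .
qed

lemma poly_on_trilinear:
  assumes "\<And>y z. y \<in> coords n \<Longrightarrow> z \<in> coords n \<Longrightarrow> vf.linear_on (coords n) (\<lambda>x. \<tau> x y z)"
    and "\<And>x z. x \<in> coords n \<Longrightarrow> z \<in> coords n \<Longrightarrow> vf.linear_on (coords n) (\<lambda>y. \<tau> x y z)"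
    and "\<And>x y. x \<in> coords n \<Longrightarrow> y \<in> coords n \<Longrightarrow> vf.linear_on (coords n) (\<lambda>z. \<tau> x y z)"
  shows "poly_on n 3 (\<lambda>x. \<tau> x x x)"
proof (rule poly_on_cong)
  let ?e = "\<lambda>i j. if j = i then 1 else 0"
  have "poly_on n 2 (\<lambda>x. \<tau> (?e i) x x)" if "i < n" for i
    using that assms(2,3)[of "?e i"] by (intro poly_on_bilinear) (auto simp: coords_def)
  then have "poly_on n (1 + 2) (\<lambda>x. x i * \<tau> (?e i) x x)" if "i < n" for i
    using that by (intro poly_on_mult[OF poly_on_coord]) auto
  then show "poly_on n 3 (\<lambda>x. \<Sum>i<n. x i * \<tau> (?e i) x x)"
    by (intro poly_on_sum) (simp add: numeral_3_eq_3)
  show "\<tau> x x x = (\<Sum>i<n. x i * \<tau> (?e i) x x)" if "x \<in> coords n" for x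
    using coords_expansion[OF assms(1)[OF that that] that] .
qed

text \<open>If some index is \<open>n\<close>, then \<open>x n = 0\<close> kills the subtracted
  product and the corresponding factor is the constant 1, so at most three genuine factors remain;
  otherwise the two products coincide.\<close>

lemma poly_on_hom_coord_minus:
  assumes "i \<le> n" "j \<le> n" "k \<le> n" "l \<le> n"
  shows "poly_on n 3 (\<lambda>x :: nat \<Rightarrow> 'p::prime_card mod_ring.
    hom_coord n x i * (hom_coord n x j * (hom_coord n x k * hom_coord n x l)) - x i * x j * x k * x l)"
proof (cases "i = n \<or> j = n \<or> k = n \<or> l = n")
  case False
  then show ?thesis
    by (intro poly_on_cong[OF poly_on_poly_fun[OF poly_fun.const[of n 3 0]]]) (simp add: hom_coord_def mult_ac)
next
  case True
  define e where "e a = (if a = n then 0 else 1 :: nat)" for a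
  have X: "poly_on n (e a) (\<lambda>x :: nat \<Rightarrow> 'p mod_ring. hom_coord n x a)" if "a \<le> n" for a
  proof (cases "a = n")
    case True
    then show ?thesis
      by (intro poly_on_cong[OF poly_on_poly_fun[OF poly_fun.const[of n "e a" 1]]])
        (simp add: hom_coord_def coords_def)
  next
    case False
    then have "poly_on n (e a) (\<lambda>x :: nat \<Rightarrow> 'p mod_ring. x a)"
      using that by (intro poly_on_poly_fun poly_fun_coord) (auto simp: e_def)
    then show ?thesis by (rule poly_on_cong) (use False in \<open>simp add: hom_coord_def\<close>)
  qed
  have "poly_on n (e i + (e j + (e k + e l)))
      (\<lambda>x :: nat \<Rightarrow> 'p mod_ring. hom_coord n x i * (hom_coord n x j * (hom_coord n x k * hom_coord n x l)))"
    by (intro poly_on_mult X assms)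
  then have "poly_on n 3
      (\<lambda>x :: nat \<Rightarrow> 'p mod_ring. hom_coord n x i * (hom_coord n x j * (hom_coord n x k * hom_coord n x l)))"
    by (rule poly_on_mono) (use True in \<open>auto simp: e_def\<close>)
  then show ?thesis
    by (rule poly_on_cong) (use True in \<open>auto simp: coords_def\<close>)
qed

text \<open>\<open>T\<close> is a sum of permanents over the monomials. It is given by a formula on
  all functions, so it is multilinear on every \<open>G\<close>, including \<open>UNIV\<close>.
  Monomials of lower degree carry the index \<open>n\<close> and drop out on
  \<open>coords n\<close>.\<close>

theorem quartic_polarization:
  fixes f :: "'p::prime_card vfun"
  assumes "fun_degree n f \<le> 4" "(24 :: 'p mod_ring) \<noteq> 0"
  obtains T low where "\<And>G. vf.sym_quadrilinear G T"
    and "\<And>x y z u v. x \<in> carrier_vec n \<Longrightarrow> set [y, z, u, v] \<subseteq> carrier_vec n \<Longrightarrow>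
      fold deriv_dir [y, z, u, v] f x = T (vec_fun n y) (vec_fun n z) (vec_fun n u) (vec_fun n v)"
    and "poly_on n 3 low"
    and "\<And>x. x \<in> carrier_vec n \<Longrightarrow>
      f x = 1 / 24 * T (vec_fun n x) (vec_fun n x) (vec_fun n x) (vec_fun n x) + low (vec_fun n x)"
proof -
  obtain P where P: "P \<in> mv_polys n" "total_deg P \<le> 4" "\<And>x. x \<in> carrier_vec n \<Longrightarrow> f x = mv_eval P x"
    using fun_degree_witness[of n f] assms(1) by auto
  show thesis
  proof (rule mv_eval_quartic[OF P(1,2)])
    fix M :: "(nat \<Rightarrow>\<^sub>0 nat) set" and i j k l :: "(nat \<Rightarrow>\<^sub>0 nat) \<Rightarrow> nat" and c
    assume idx: "\<And>m. m \<in> M \<Longrightarrow> i m \<le> n \<and> j m \<le> n \<and> k m \<le> n \<and> l m \<le> n"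
      and eval: "\<And>x. mv_eval P x = (\<Sum>m\<in>M. c m * (hom_coord n (vec_fun n x) (i m) * hom_coord n (vec_fun n x) (j m) *
          hom_coord n (vec_fun n x) (k m) * hom_coord n (vec_fun n x) (l m)))"
    define mon where "mon m x = hom_coord n x (i m) * (hom_coord n x (j m) * (hom_coord n x (k m) * hom_coord n x (l m)))"
      for m and x :: "nat \<Rightarrow> 'p mod_ring"
    have f: "f x = (\<Sum>m\<in>M. c m * mon m (vec_fun n x))" if "x \<in> carrier_vec n" for x
      using P(3)[OF that] eval[of x] by (simp add: mon_def mult.assoc)
    define T where "T y z u v = (\<Sum>m\<in>M. c m * perm4 (i m) (j m) (k m) (l m) y z u v)"
      for y z u v :: "nat \<Rightarrow> 'p mod_ring"
    define low where "low x = (\<Sum>m\<in>M. c m * (mon m x - x (i m) * x (j m) * x (k m) * x (l m)))" for x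
    show thesis
    proof (rule that[of T low])
      show "vf.sym_quadrilinear G T" for G
      proof -
        have "vf.linear_on G (\<lambda>y. T y z u v)" for z u v
          unfolding vf.linear_on_def T_def perm4_scale perm4_add
          by (simp add: sum.distrib sum_distrib_left distrib_left mult_ac)
        moreover have "T y z u v = T z y u v" "T y z u v = T y u z v" "T y z u v = T y z v u" for y z u v
          unfolding T_def using perm4_sym by metis+
        ultimately show ?thesis unfolding vf.sym_quadrilinear_def by blast
      qed
      show "fold deriv_dir [y, z, u, v] f x = T (vec_fun n y) (vec_fun n z) (vec_fun n u) (vec_fun n v)"
        if "x \<in> carrier_vec n" "set [y, z, u, v] \<subseteq> carrier_vec n" for x y z u v
      proof -
        have "fold deriv_dir [y, z, u, v] f x =
          fold diff_dir (map (vec_fun n) [y, z, u, v]) (\<lambda>x. \<Sum>m\<in>M. c m * mon m x) (vec_fun n x)"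
          using f that by (intro fold_deriv_dir) auto
        also have "\<dots> = T (vec_fun n y) (vec_fun n z) (vec_fun n u) (vec_fun n v)"
          by (simp add: diff_dir_sum mon_def[abs_def] diff_dir_4_hom_coord T_def)
        finally show ?thesis .
      qed
      show "poly_on n 3 low"
        unfolding low_def mon_def using idx by (intro poly_on_sum poly_on_cmult poly_on_hom_coord_minus) auto
      show "f x = 1 / 24 * T (vec_fun n x) (vec_fun n x) (vec_fun n x) (vec_fun n x) + low (vec_fun n x)"
        if "x \<in> carrier_vec n" for x
        unfolding f[OF that] T_def low_def perm4_diag sum_distrib_left sum.distrib[symmetric]
        using assms(2) by (intro sum.cong) (simp_all add: right_diff_distrib)
    qed
  qed
qed

section \<open>The Gowers norm as a density of null triples\<close>

context prime_field_space
begin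

lemma card_proper_subspace: "subspace A \<Longrightarrow> subspace G \<Longrightarrow> finite G \<Longrightarrow> A \<subseteq> G \<Longrightarrow> A \<noteq> G \<Longrightarrow>
    2 * card A \<le> card G"
  using card_subspace_double by blast

text \<open>For \<open>z\<close> outside a proper subspace, then \<open>u\<close> outside one
  depending on \<open>z\<close>, then \<open>v\<close> outside one depending on both, the functional
  T(-,z,u,v) is nonzero. Each choice keeps at least half, so 1/8 of the triples are not null. This
  keeps log (1/\<delta>) away from 0.\<close>

lemma card_null_triples_le:
  assumes T: "sym_quadrilinear G T" and G: "subspace G" "finite G"
    and nz: "y0 \<in> G" "z0 \<in> G" "u0 \<in> G" "v0 \<in> G" "T y0 z0 u0 v0 \<noteq> 0"
  shows "8 * card (null_triples G T) \<le> 7 * card G ^ 3"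
proof -
  note lin = sym_quadrilinearD[OF T G(1)]
  define N where "N = card G"
  define R where "R z u = {v \<in> G. \<forall>y\<in>G. T y z u v = 0}" for z u
  define B where "B z = {u \<in> G. \<forall>v\<in>G. \<forall>y\<in>G. T y z u v = 0}" for z
  define A where "A = {z \<in> G. \<forall>u\<in>G. \<forall>v\<in>G. \<forall>y\<in>G. T y z u v = 0}"
  have sR: "subspace (R z u)" if "z \<in> G" "u \<in> G" for z u
    unfolding R_def using lin(4)[OF _ that] G(1) by (intro subspace_radical) auto
  have sB: "subspace (B z)" if "z \<in> G" for z
  proof -
    have "B z = G \<inter> (\<Inter>v\<in>G. \<Inter>y\<in>G. {u \<in> G. T y z u v = 0})" by (auto simp: B_def)
    moreover have "subspace {u \<in> G. T y z u v = 0}" if "v \<in> G" "y \<in> G" for v y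
      using subspace_kernel[OF lin(3) G(1)] that \<open>z \<in> G\<close> by blast
    ultimately show ?thesis using G(1)
      by (auto intro!: subspace_inter subspace_Int)
  qed
  have sA: "subspace A"
  proof -
    have "A = G \<inter> (\<Inter>u\<in>G. \<Inter>v\<in>G. \<Inter>y\<in>G. {z \<in> G. T y z u v = 0})" by (auto simp: A_def)
    moreover have "subspace {z \<in> G. T y z u v = 0}" if "u \<in> G" "v \<in> G" "y \<in> G" for u v y
      using subspace_kernel[OF lin(2) G(1)] that by blast
    ultimately show ?thesis using G(1)
      by (auto intro!: subspace_inter subspace_Int)
  qed
  have sub: "R z u \<subseteq> G" "B z \<subseteq> G" "A \<subseteq> G" for z u by (auto simp: R_def B_def A_def)
  have fin: "finite (R z u)" "finite (B z)" "finite A" for z u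
    by (rule finite_subset[OF _ G(2)], rule sub)+
  have le: "card (R z u) \<le> N" for z u unfolding N_def by (rule card_mono[OF G(2) sub(1)])
  have R_half: "2 * card (R z u) \<le> N" if "z \<in> G" "u \<in> G - B z" for z u
  proof -
    have "R z u \<noteq> G" using that by (auto simp: R_def B_def)
    then show ?thesis unfolding N_def using that by (intro card_proper_subspace sR sub G) auto
  qed
  have B_half: "2 * card (B z) \<le> N" if "z \<in> G - A" for z
  proof -
    have "B z \<noteq> G" using that by (auto simp: A_def B_def)
    then show ?thesis unfolding N_def using that by (intro card_proper_subspace sB sub G) auto
  qed
  have "A \<noteq> G" using nz by (auto simp: A_def)
  then have A_half: "2 * card A \<le> N" unfolding N_def by (intro card_proper_subspace sA sub G)
  have split: "card G = card (G - X) + card X" if "X \<subseteq> G" for X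
    using card_Diff_subset[OF finite_subset[OF that G(2)] that] card_mono[OF G(2) that] by simp
  define r where "r z = (\<Sum>u\<in>G. card (R z u))" for z
  have r_le: "r z \<le> N * N" for z
    unfolding r_def using sum_bounded_above[of G "card \<circ> R z" N] le by (simp add: N_def)
  have r_half: "4 * r z \<le> 3 * (N * N)" if z: "z \<in> G - A" for z
  proof -
    have "r z = (\<Sum>u\<in>G - B z. card (R z u)) + (\<Sum>u\<in>B z. card (R z u))"
      unfolding r_def by (rule sum.subset_diff) (use sub G in auto)
    moreover have "(\<Sum>u\<in>B z. card (R z u)) \<le> card (B z) * N"
      using sum_bounded_above[of "B z" "\<lambda>u. card (R z u)" N] le by simp
    moreover have "(\<Sum>u\<in>G - B z. 2 * card (R z u)) \<le> card (G - B z) * N"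
      using sum_bounded_above[of "G - B z" "\<lambda>u. 2 * card (R z u)" N] R_half z by simp
    ultimately have "4 * r z \<le> 2 * (card (G - B z) * N) + 4 * (card (B z) * N)"
      by (simp flip: sum_distrib_left)
    also have "\<dots> = 2 * ((card (G - B z) + card (B z)) * N) + (2 * card (B z)) * N"
      by (simp add: algebra_simps)
    also have "card (G - B z) + card (B z) = N" using split[OF sub(2)] by (simp add: N_def)
    also have "2 * (N * N) + (2 * card (B z)) * N \<le> 2 * (N * N) + N * N"
      using B_half[OF z] by (intro add_left_mono mult_le_mono1)
    finally show ?thesis by simp
  qed
  have "null_triples G T = Sigma G (\<lambda>z. Sigma G (R z))" by (auto simp: null_triples_def R_def)
  then have "card (null_triples G T) = (\<Sum>z\<in>G. r z)"
    using G fin by (simp add: card_SigmaI r_def)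
  also have "\<dots> = (\<Sum>z\<in>G - A. r z) + (\<Sum>z\<in>A. r z)"
    by (rule sum.subset_diff) (use sub G in auto)
  finally have eq: "card (null_triples G T) = (\<Sum>z\<in>G - A. r z) + (\<Sum>z\<in>A. r z)" .
  have "(\<Sum>z\<in>A. r z) \<le> card A * (N * N)"
    using sum_bounded_above[of A r "N * N"] r_le by simp
  moreover have "(\<Sum>z\<in>G - A. 4 * r z) \<le> card (G - A) * (3 * (N * N))"
    using sum_bounded_above[of "G - A" "\<lambda>z. 4 * r z" "3 * (N * N)"] r_half by simp
  ultimately have "8 * card (null_triples G T) \<le> 2 * (card (G - A) * (3 * (N * N))) + 8 * (card A * (N * N))"
    unfolding eq by (simp flip: sum_distrib_left)
  also have "\<dots> = 6 * ((card (G - A) + card A) * (N * N)) + (2 * card A) * (N * N)"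
    by (simp add: algebra_simps)
  also have "card (G - A) + card A = N" using split[OF sub(3)] by (simp add: N_def)
  also have "6 * (N * (N * N)) + (2 * card A) * (N * N) \<le> 6 * (N * (N * N)) + N * (N * N)"
    using A_half by (intro add_left_mono mult_le_mono1)
  finally show ?thesis by (simp add: N_def power3_eq_cube)
qed

end

text \<open>The fourth derivative is independent of the base point, and summation over one direction
  turns the character into \<open>N\<close> times the indicator of a null triple. In particular the
  average is real and nonnegative, so the absolute value changes nothing.\<close>

lemma gowers_norm_eq:
  fixes f :: "'p::prime_card vfun"
  assumes T: "vf.sym_quadrilinear (coords n) T"
    and f: "\<And>x y z u v. x \<in> carrier_vec n \<Longrightarrow> set [y, z, u, v] \<subseteq> carrier_vec n \<Longrightarrow>
      fold deriv_dir [y, z, u, v] f x = T (vec_fun n y) (vec_fun n z) (vec_fun n u) (vec_fun n v)"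
  shows "gowers_norm n 4 f =
    root 16 (real (card (vf.null_triples (coords n) T)) / real (card (coords n :: (nat \<Rightarrow> 'p mod_ring) set)) ^ 3)"
proof -
  let ?V = "carrier_vec n :: 'p mod_ring vec set"
  let ?G = "coords n :: (nat \<Rightarrow> 'p mod_ring) set"
  let ?L = "{ys :: 'p mod_ring vec list. length ys = 4 \<and> set ys \<subseteq> ?V}"
  let ?Z = "vf.null_triples (coords n) T"
  define N where "N = card ?G"
  have cardV: "card ?V = N" unfolding N_def using bij_betw_same_card[OF bij_betw_vec_fun] .
  have finV: "finite ?V" using bij_betw_finite[OF bij_betw_vec_fun] finite_coords by blast
  have Npos: "0 < N" unfolding N_def using vf.card_subspace_pos[OF subspace_coords finite_coords] .
  have cardL: "card ?L = N ^ 4"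
    using card_lists_length_eq[OF finV, of 4] cardV by (simp add: conj_commute)
  have list4: "ys = [ys ! 0, ys ! 1, ys ! 2, ys ! 3]" if "length ys = 4" for ys :: "'p mod_ring vec list"
    using that by (auto simp: numeral_eq_Suc length_Suc_conv)
  have vv: "vec n (vec_fun n x) = x" if "x \<in> ?V" for x using that by (auto simp: vec_fun_def)
  have vv': "vec_fun n (vec n x) = x" if "x \<in> ?G" for x
    using that by (auto simp: vec_fun_def coords_def fun_eq_iff)
  define t where "t ys = T (vec_fun n (ys ! 0)) (vec_fun n (ys ! 1)) (vec_fun n (ys ! 2)) (vec_fun n (ys ! 3))"
    for ys :: "'p mod_ring vec list"
  have "(\<Sum>(x, ys)\<in>?V \<times> ?L. additive_char (fold deriv_dir ys f x)) =
    (\<Sum>(x, ys)\<in>?V \<times> ?L. additive_char (t ys))"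
  proof (rule sum.cong[OF refl], clarify)
    fix x ys assume *: "x \<in> ?V" "length ys = 4" "set ys \<subseteq> ?V"
    show "additive_char (fold deriv_dir ys f x) = additive_char (t ys)"
      using f[of x "ys ! 0" "ys ! 1" "ys ! 2" "ys ! 3"] * list4[OF *(2)] unfolding t_def by metis
  qed
  also have "\<dots> = of_nat N * (\<Sum>ys\<in>?L. additive_char (t ys))"
    by (simp add: cardV flip: sum.cartesian_product)
  \<comment> \<open>The first direction \<open>y\<close> is moved to the last place, so that it
    becomes the inner sum.\<close>
  also have "(\<Sum>ys\<in>?L. additive_char (t ys)) =
    (\<Sum>(z, u, v, y)\<in>?G \<times> ?G \<times> ?G \<times> ?G. additive_char (T y z u v))"
  proof (rule sum.reindex_bij_witness[where
        i = "\<lambda>(z, u, v, y). [vec n y, vec n z, vec n u, vec n v]" and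
        j = "\<lambda>ys. (vec_fun n (ys ! 1), vec_fun n (ys ! 2), vec_fun n (ys ! 3), vec_fun n (ys ! 0))"])
    fix ys assume "ys \<in> ?L"
    then have ys: "length ys = 4" "set ys \<subseteq> ?V" by auto
    then have "ys ! i \<in> ?V" if "i < 4" for i using that nth_mem[of i ys] by auto
    then show "(case (vec_fun n (ys ! 1), vec_fun n (ys ! 2), vec_fun n (ys ! 3), vec_fun n (ys ! 0)) of
        (z, u, v, y) \<Rightarrow> [vec n y, vec n z, vec n u, vec n v]) = ys"
      using list4[OF ys(1)] by (simp add: vv)
  qed (auto simp: vv' vec_fun_in_coords t_def)
  also have "\<dots> = (\<Sum>(z, u, v)\<in>?G \<times> ?G \<times> ?G. \<Sum>y\<in>?G. additive_char (T y z u v))"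
    by (simp flip: sum.cartesian_product)
  also have "\<dots> = (\<Sum>s\<in>?G \<times> ?G \<times> ?G. if (case s of (z, u, v) \<Rightarrow> \<forall>y\<in>?G. T y z u v = 0) then of_nat N else 0)"
  proof (rule sum.cong[OF refl])
    fix s assume s: "s \<in> ?G \<times> ?G \<times> ?G"
    obtain z u v where zuv: "s = (z, u, v)" by (cases s)
    then have "z \<in> ?G" "u \<in> ?G" "v \<in> ?G" using s by simp_all
    from vf.sum_additive_char[OF vf.sym_quadrilinearD(1)[OF T subspace_coords this] subspace_coords finite_coords]
    show "(case s of (z, u, v) \<Rightarrow> \<Sum>y\<in>?G. additive_char (T y z u v)) =
      (if (case s of (z, u, v) \<Rightarrow> \<forall>y\<in>?G. T y z u v = 0) then of_nat N else 0)"
      by (simp only: N_def zuv prod.case)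
  qed
  also have "\<dots> = (\<Sum>s\<in>{s \<in> ?G \<times> ?G \<times> ?G. case s of (z, u, v) \<Rightarrow> \<forall>y\<in>?G. T y z u v = 0}. of_nat N)"
    using finite_coords by (subst sum.inter_filter) auto
  also have "{s \<in> ?G \<times> ?G \<times> ?G. case s of (z, u, v) \<Rightarrow> \<forall>y\<in>?G. T y z u v = 0} = ?Z"
    by (auto simp: vf.null_triples_def)
  finally have sum: "(\<Sum>(x, ys)\<in>?V \<times> ?L. additive_char (fold deriv_dir ys f x)) =
      of_nat (N * (N * card ?Z))" by (simp add: mult_ac)
  have "average (?V \<times> ?L) (\<lambda>(x, ys). additive_char (fold deriv_dir ys f x)) =
      of_nat (N * (N * card ?Z)) / of_nat (N * N ^ 4)"
    unfolding average_def sum card_cartesian_product cardV cardL ..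
  also have "\<dots> = of_real (real (card ?Z) / real N ^ 3)"
    using Npos by (simp add: field_simps eval_nat_numeral)
  finally show ?thesis unfolding gowers_norm_def N_def
    by (simp add: norm_divide norm_power)
qed

section \<open>The decomposition\<close>

context finite_field_space
begin

lemma linear_on_combination:
  assumes "linear_on UNIV g"
  shows "g (a + (\<Sum>c\<in>C. k c *s c)) = g a + (\<Sum>c\<in>C. k c * g c)"
proof -
  have "g (\<Sum>c\<in>C. k c *s c) = (\<Sum>c\<in>C. k c * g c)"
    using linear_on_0[OF assms subspace_UNIV]
    by (induction C rule: infinite_finite_induct)
      (simp_all add: linear_on_add[OF assms] linear_on_scale[OF assms])
  then show ?thesis by (simp add: linear_on_add[OF assms])
qed

lemma linear_on_compose:
  assumes "linear_on U g" "\<And>x. x \<in> G \<Longrightarrow> u x \<in> U"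
    and "\<And>x y. x \<in> G \<Longrightarrow> y \<in> G \<Longrightarrow> u (x + y) = u x + u y" "\<And>a x. x \<in> G \<Longrightarrow> u (a *s x) = a *s u x"
  shows "linear_on G (\<lambda>x. g (u x))"
  unfolding linear_on_def
  using linear_on_add[OF assms(1)] linear_on_scale[OF assms(1)] assms(2-4) by simp

end

context prime_field_space
begin

text \<open>Replace \<open>x\<close> by \<open>w\<close> in one argument after the other. All four
  corrections carry the same factor \<open>k c\<close>, so one linear function per element of
  \<open>C\<close> suffices.\<close>

lemma quadrilinear_telescope:
  assumes T: "sym_quadrilinear UNIV T" and x: "x = w + (\<Sum>c\<in>C. k c *s c)"
  shows "T x x x x = T w w w w + (\<Sum>c\<in>C. k c * (T c x x x + T w c x x + T w w c x + T w w w c))"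
proof -
  note lin = sym_quadrilinearD(1-4)[OF T subspace_UNIV UNIV_I UNIV_I UNIV_I]
  note comb = linear_on_combination[OF lin(1)] linear_on_combination[OF lin(2)]
    linear_on_combination[OF lin(3)] linear_on_combination[OF lin(4)]
  have "T x x x x = T w x x x + (\<Sum>c\<in>C. k c * T c x x x)" by (subst x) (rule comb)
  also have "T w x x x = T w w x x + (\<Sum>c\<in>C. k c * T w c x x)" by (subst x) (rule comb)
  also have "T w w x x = T w w w x + (\<Sum>c\<in>C. k c * T w w c x)" by (subst x) (rule comb)
  also have "T w w w x = T w w w w + (\<Sum>c\<in>C. k c * T w w w c)" by (subst x) (rule comb)
  finally show ?thesis by (simp add: sum.distrib distrib_left)
qed

end

lemma quartic_decomposition:
  fixes f :: "'p::prime_card vfun"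
  assumes deg: "fun_degree n f = 4" and nz24: "(24 :: 'p mod_ring) \<noteq> 0"
  defines "\<epsilon> \<equiv> gowers_norm n 4 f ^ 16"
  shows "0 < gowers_norm n 4 f \<and> \<epsilon> \<le> 7 / 8 \<and> (\<forall>K. 4 / \<epsilon>\<^sup>2 \<le> 2 ^ K \<longrightarrow>
    (\<exists>r R l g q q'. r \<le> 4 * K\<^sup>2 \<and> R \<le> index_bound CARD('p) K + 1 \<and>
      (\<forall>i<R. fun_degree n (l i) \<le> 1 \<and> fun_degree n (g i) \<le> 3) \<and>
      (\<forall>i<r. fun_degree n (q i) \<le> 2 \<and> fun_degree n (q' i) \<le> 2) \<and>
      (\<forall>x\<in>carrier_vec n. f x = (\<Sum>i<R. l i x * g i x) + (\<Sum>i<r. q i x * q' i x))))"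
proof -
  let ?G = "coords n :: (nat \<Rightarrow> 'p mod_ring) set"
  have "fun_degree n f \<le> 4" using deg by simp
  then show ?thesis
  proof (rule quartic_polarization[OF _ nz24])
    fix T low
    assume T: "\<And>G. vf.sym_quadrilinear G T"
      and T_eq: "\<And>x y z u v. x \<in> carrier_vec n \<Longrightarrow> set [y, z, u, v] \<subseteq> carrier_vec n \<Longrightarrow>
        fold deriv_dir [y, z, u, v] f x = T (vec_fun n y) (vec_fun n z) (vec_fun n u) (vec_fun n v)"
      and low: "poly_on n 3 low"
      and f_eq: "\<And>x. x \<in> carrier_vec n \<Longrightarrow>
        f x = 1 / 24 * T (vec_fun n x) (vec_fun n x) (vec_fun n x) (vec_fun n x) + low (vec_fun n x)"
    define N where "N = real (card ?G)"
    define Z where "Z = real (card (vf.null_triples ?G T))"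
    have Npos: "0 < N" using vf.card_subspace_pos[OF subspace_coords finite_coords, where 'p = 'p] by (simp add: N_def)
    note lin = vf.sym_quadrilinearD(1-4)[OF T[of UNIV] vf.subspace_UNIV UNIV_I UNIV_I UNIV_I]
    have "(0, 0, 0) \<in> vf.null_triples ?G T"
      using vf.subspace_0[OF subspace_coords] vf.linear_on_0[OF lin(2) vf.subspace_UNIV]
      by (simp add: vf.null_triples_def)
    moreover have "finite (vf.null_triples ?G T)"
      by (rule finite_subset[of _ "?G \<times> ?G \<times> ?G"]) (auto simp: vf.null_triples_def finite_coords)
    ultimately have Zpos: "0 < Z" by (auto simp: Z_def card_gt_0_iff)
    have norm: "gowers_norm n 4 f = root 16 (Z / N ^ 3)"
      unfolding Z_def N_def by (rule gowers_norm_eq[OF T T_eq])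
    have \<epsilon>: "\<epsilon> = Z / N ^ 3"
      unfolding \<epsilon>_def norm using Zpos Npos by (intro real_root_pow_pos) simp_all
    \<comment> \<open>Degree exactly four, and not just at most four, enters here.\<close>
    have "\<exists>x\<in>carrier_vec n. T (vec_fun n x) (vec_fun n x) (vec_fun n x) (vec_fun n x) \<noteq> 0"
    proof (rule ccontr)
      assume "\<not> ?thesis"
      then have "fun_degree n f \<le> 3" using f_eq by (intro fun_degree_le_poly_on[OF low]) simp
      then show False using deg by simp
    qed
    then obtain x0 where "x0 \<in> ?G" "T x0 x0 x0 x0 \<noteq> 0" using vec_fun_in_coords by blast
    from vf.card_null_triples_le[OF T subspace_coords finite_coords this(1,1,1,1,2)]
    have "real (8 * card (vf.null_triples ?G T)) \<le> real (7 * card ?G ^ 3)" by (simp only: of_nat_le_iff)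
    then have \<epsilon>_le: "\<epsilon> \<le> 7 / 8" unfolding \<epsilon> using Npos by (simp add: Z_def N_def field_simps)
    have \<epsilon>_pos: "0 < \<epsilon>" unfolding \<epsilon> using Zpos Npos by simp
    have main: "\<exists>r R l g q q'. r \<le> 4 * K\<^sup>2 \<and> R \<le> index_bound CARD('p) K + 1 \<and>
      (\<forall>i<R. fun_degree n (l i) \<le> 1 \<and> fun_degree n (g i) \<le> 3) \<and>
      (\<forall>i<r. fun_degree n (q i) \<le> 2 \<and> fun_degree n (q' i) \<le> 2) \<and>
      (\<forall>x\<in>carrier_vec n. f x = (\<Sum>i<R. l i x * g i x) + (\<Sum>i<r. q i x * q' i x))"
      if K: "4 / \<epsilon>\<^sup>2 \<le> 2 ^ K" for K
    proof -
      have eq: "real (card (vf.null_triples ?G T)) = \<epsilon> * real (card ?G) ^ 3"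
        using Npos by (simp add: \<epsilon> Z_def N_def)
      have "\<epsilon> \<le> 1" using \<epsilon>_le by simp
      from vf.sym_quadrilinear_structure[OF T subspace_coords finite_coords \<epsilon>_pos this eq K]
      obtain U \<alpha> Q where U: "U \<subseteq> ?G" "vf.subspace U" "index_le (index_bound CARD('p) K) ?G U"
        and Q: "finite Q" "card Q \<le> 4 * K\<^sup>2"
        and bil: "\<And>q. q \<in> Q \<Longrightarrow> vf.bilinear_on U (\<alpha> q) \<and> vf.bilinear_on U (\<lambda>u v. q (u, v))"
        and TU: "\<And>x. x \<in> U \<Longrightarrow> T x x x x = 3 * (\<Sum>q\<in>Q. \<alpha> q x x * q (x, x))"
        by blast
      from vf.subspace_projection[OF U(2) subspace_coords U(1) finite_coords U(3)]
      show ?thesis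
      proof (elim exE conjE)
        fix C u l
        assume C: "C \<subseteq> ?G" "finite C" "card C \<le> index_bound CARD('p) K"
          and ball_dec: "\<forall>x\<in>?G. u x \<in> U \<and> x = u x + (\<Sum>c\<in>C. (\<lambda>i. l c x * c i))"
          and ball_l: "\<forall>c\<in>C. vf.linear_on ?G (l c)"
          and ball_u: "\<forall>x\<in>?G. \<forall>y\<in>?G. u (x + y) = u x + u y"
            "\<forall>a. \<forall>x\<in>?G. u (\<lambda>i. a * x i) = (\<lambda>i. a * u x i)"
        have u_in: "u x \<in> U" and dec: "x = u x + (\<Sum>c\<in>C. (\<lambda>i. l c x * c i))" if "x \<in> ?G" for x
          using ball_dec that by simp_all
        have l: "vf.linear_on ?G (l c)" if "c \<in> C" for c
          using ball_l that by simp
        have u: "u (x + y) = u x + u y" if "x \<in> ?G" "y \<in> ?G" for x y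
          using ball_u(1) that by simp
        have u_scale: "u (\<lambda>i. a * x i) = (\<lambda>i. a * u x i)" if "x \<in> ?G" for a x
          using ball_u(2) that by simp
        \<comment> \<open>The cofactor of \<open>l c\<close> in the telescoping sum. Its arguments
          are \<open>x\<close> and \<open>u x\<close>, both linear in \<open>x\<close>, so it is a
          sum of diagonals of trilinear forms.\<close>
        define g where "g c x = 1 / 24 * (T c x x x + T (u x) c x x + T (u x) (u x) c x + T (u x) (u x) (u x) c)"
          for c x
        have comp: "vf.linear_on ?G (\<lambda>x. h (u x))" if "vf.linear_on U h" for h
          by (rule vf.linear_on_compose[OF that u_in u u_scale])
        have linG: "vf.linear_on ?G h" "vf.linear_on ?G (\<lambda>x. h (u x))" if "vf.linear_on UNIV h" for h
          using vf.linear_on_subset[OF that subset_UNIV] comp by simp_all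
        have g_poly: "poly_on n 3 (g c)" for c
          unfolding g_def
          by (intro poly_on_cmult poly_on_add poly_on_trilinear[of n "\<lambda>x y z. T c x y z"]
              poly_on_trilinear[of n "\<lambda>x y z. T (u x) c y z"] poly_on_trilinear[of n "\<lambda>x y z. T (u x) (u y) c z"]
              poly_on_trilinear[of n "\<lambda>x y z. T (u x) (u y) (u z) c"] linG lin)
        have q_poly: "poly_on n 2 (\<lambda>x. \<beta> (u x) (u x))" if \<beta>: "vf.bilinear_on U \<beta>" for \<beta>
        proof (rule poly_on_bilinear[of n "\<lambda>x y. \<beta> (u x) (u y)"])
          fix y assume "y \<in> ?G"
          then have b: "vf.linear_on U (\<lambda>x. \<beta> x (u y))" "vf.linear_on U (\<beta> (u y))"
            using \<beta> u_in unfolding vf.bilinear_on_def by simp_all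
          show "vf.linear_on ?G (\<lambda>x. \<beta> (u x) (u y))" "vf.linear_on ?G (\<lambda>x. \<beta> (u y) (u x))"
            by (rule comp[OF b(1)], rule comp[OF b(2)])
        qed
        have expand: "f x = (\<Sum>c\<in>C. l c (vec_fun n x) * g c (vec_fun n x)) + low (vec_fun n x) +
            (\<Sum>q\<in>Q. \<alpha> q (u (vec_fun n x)) (u (vec_fun n x)) * (3 / 24 * q (u (vec_fun n x), u (vec_fun n x))))"
          if x: "x \<in> carrier_vec n" for x
        proof -
          define X where "X = vec_fun n x"
          have X: "u X \<in> U" "X = u X + (\<Sum>c\<in>C. (\<lambda>i. l c X * c i))"
            unfolding X_def by (rule u_in[OF vec_fun_in_coords], rule dec[OF vec_fun_in_coords])
          have "T X X X X = 3 * (\<Sum>q\<in>Q. \<alpha> q (u X) (u X) * q (u X, u X)) +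
            (\<Sum>c\<in>C. l c X * (T c X X X + T (u X) c X X + T (u X) (u X) c X + T (u X) (u X) (u X) c))"
            using vf.quadrilinear_telescope[OF T X(2)] TU[OF X(1)] by simp
          then show ?thesis
            unfolding f_eq[OF x] X_def[symmetric] g_def
            by (simp add: sum_distrib_left distrib_left mult_ac)
        qed
        obtain e where e: "bij_betw e {..<card C} C"
          using ex_bij_betw_nat_finite[OF C(2)] by (auto simp: atLeast0LessThan)
        obtain e' where e': "bij_betw e' {..<card Q} Q"
          using ex_bij_betw_nat_finite[OF Q(1)] by (auto simp: atLeast0LessThan)
        have eC: "e i \<in> C" if "i < card C" for i using e that bij_betwE by blast
        have eQ: "e' i \<in> Q" if "i < card Q" for i using e' that bij_betwE by blast
        \<comment> \<open>The index \<open>card C\<close> carries \<open>low\<close> with the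
          constant factor 1; this is the \<open>+ 1\<close> in the bound for
          \<open>R\<close>.\<close>
        define L where "L i x = (if i < card C then l (e i) (vec_fun n x) else 1)" for i x
        define g' where "g' i x = (if i < card C then g (e i) (vec_fun n x) else low (vec_fun n x))" for i x
        define q where "q i x = \<alpha> (e' i) (u (vec_fun n x)) (u (vec_fun n x))" for i x
        \<comment> \<open>3/24 combines the three equal products on the diagonal with the division
          by 24.\<close>
        define q' where "q' i x = 3 / 24 * e' i (u (vec_fun n x), u (vec_fun n x))" for i x
        have L_deg: "fun_degree n (L i) \<le> 1" if "i < card C + 1" for i
        proof (cases "i < card C")
          case True
          show ?thesis
            by (rule fun_degree_le_poly_on[OF poly_on_linear[OF l[OF eC[OF True]]]]) (simp add: L_def True)
        next
          case False
          show ?thesis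
            by (rule fun_degree_le_poly_on[OF poly_on_poly_fun[OF poly_fun.const[of n 1 1]]]) (simp add: L_def False)
        qed
        have g'_deg: "fun_degree n (g' i) \<le> 3" if "i < card C + 1" for i
        proof (cases "i < card C")
          case True
          show ?thesis by (rule fun_degree_le_poly_on[OF g_poly[of "e i"]]) (simp add: g'_def True)
        next
          case False
          show ?thesis by (rule fun_degree_le_poly_on[OF low]) (simp add: g'_def False)
        qed
        have q_deg: "fun_degree n (q i) \<le> 2" if "i < card Q" for i
          by (rule fun_degree_le_poly_on[OF q_poly[OF conjunct1[OF bil[OF eQ[OF that]]]]]) (simp add: q_def)
        have q'_deg: "fun_degree n (q' i) \<le> 2" if "i < card Q" for i
          by (rule fun_degree_le_poly_on[OF poly_on_cmult[OF q_poly[OF conjunct2[OF bil[OF eQ[OF that]]]], of "3 / 24"]])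
            (simp add: q'_def)
        have f_sum: "f x = (\<Sum>i<card C + 1. L i x * g' i x) + (\<Sum>i<card Q. q i x * q' i x)"
          if "x \<in> carrier_vec n" for x
        proof -
          have "(\<Sum>i<card C + 1. L i x * g' i x) =
              (\<Sum>i<card C. l (e i) (vec_fun n x) * g (e i) (vec_fun n x)) + low (vec_fun n x)"
            by (simp add: L_def g'_def)
          also have "(\<Sum>i<card C. l (e i) (vec_fun n x) * g (e i) (vec_fun n x)) =
              (\<Sum>c\<in>C. l c (vec_fun n x) * g c (vec_fun n x))"
            by (rule sum.reindex_bij_betw[OF e])
          finally have 1: "(\<Sum>i<card C + 1. L i x * g' i x) =
              (\<Sum>c\<in>C. l c (vec_fun n x) * g c (vec_fun n x)) + low (vec_fun n x)" .
          have "(\<Sum>i<card Q. q i x * q' i x) = (\<Sum>q\<in>Q. \<alpha> q (u (vec_fun n x)) (u (vec_fun n x)) *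
              (3 / 24 * q (u (vec_fun n x), u (vec_fun n x))))"
            unfolding q_def q'_def by (rule sum.reindex_bij_betw[OF e'])
          then show ?thesis using expand[OF that] 1 by simp
        qed
        show ?thesis
        proof (intro exI conjI)
          show "card Q \<le> 4 * K\<^sup>2" by (rule Q(2))
          show "card C + 1 \<le> index_bound CARD('p) K + 1" using C(3) by simp
          show "\<forall>i<card C + 1. fun_degree n (L i) \<le> 1 \<and> fun_degree n (g' i) \<le> 3"
            by (intro allI impI conjI L_deg g'_deg)
          show "\<forall>i<card Q. fun_degree n (q i) \<le> 2 \<and> fun_degree n (q' i) \<le> 2"
            by (intro allI impI conjI q_deg q'_deg)
          show "\<forall>x\<in>carrier_vec n. f x = (\<Sum>i<card C + 1. L i x * g' i x) + (\<Sum>i<card Q. q i x * q' i x)"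
            by (intro ballI f_sum)
        qed
      qed
    qed
    have "0 < gowers_norm n 4 f" unfolding norm using Zpos Npos by simp
    then show ?thesis using \<epsilon>_le main by blast
  qed
qed

section \<open>Numerical bounds and the choice of constants\<close>

lemma power_add_le: "1 \<le> s \<Longrightarrow> x ^ s + y ^ s \<le> (x + y :: nat) ^ s"
proof (cases s)
  case (Suc t)
  have "x * x ^ t + y * y ^ t \<le> x * (x + y) ^ t + y * (x + y) ^ t"
    by (intro add_mono mult_le_mono power_mono) auto
  then show ?thesis by (simp add: Suc algebra_simps)
qed simp

text \<open>With s = K^2 everything is compared with B = (92160 + 16 * p)^s. Here 92160 = 4^4 * 3^2
  * 4 * 5 * 2, where the final 2 comes from K \<le> 2^s, and 16 * p absorbs the second summand of
  \<open>rank_bound\<close>. The radical bound is of order B^4; its square times the rank gives the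
  exponent 9.\<close>

definition bound_base :: "nat \<Rightarrow> nat" where
  "bound_base p = (p + 5 + 2 * (p + 1) ^ 6) * (92160 + 16 * p) ^ 9"

lemma index_bound_le:
  assumes "1 \<le> K" "1 \<le> p"
  shows "index_bound p K + 1 \<le> bound_base p ^ K\<^sup>2"
proof -
  define s where "s = K\<^sup>2"
  define B where "B = (92160 + 16 * p) ^ s"
  have s: "1 \<le> s" "K \<le> s" using assms by (simp_all add: s_def power2_eq_square)
  have s2: "s \<le> 2 ^ s" by (simp add: less_imp_le)
  have "3 ^ (2 * K) * (4 * (5 ^ K * K)) \<le> 9 ^ s * (4 ^ s * (5 ^ s * 2 ^ s))"
    unfolding power_mult
    by (intro mult_le_mono) (use s s2 power_increasing[OF s(1), of "4 :: nat"] in \<open>auto intro: power_increasing le_trans\<close>)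
  then have "4 ^ (4 * s) * (3 ^ (2 * K) * (4 * (5 ^ K * K))) \<le> 256 ^ s * (9 ^ s * (4 ^ s * (5 ^ s * 2 ^ s)))"
    by (simp add: power_mult)
  also have "\<dots> = (92160 :: nat) ^ s" by (simp flip: power_mult_distrib)
  finally have 1: "4 ^ (4 * s) * (3 ^ (2 * K) * (4 * (5 ^ K * K))) \<le> 92160 ^ s" .
  have "8 * p \<le> (8 * p) ^ s" using power_increasing[OF s(1), of "8 * p"] assms by simp
  then have "8 * p * s \<le> (8 * p) ^ s * 2 ^ s" using s2 by (rule mult_le_mono)
  also have "\<dots> = (8 * p * 2) ^ s" by (rule power_mult_distrib[symmetric])
  finally have "2 * p * (4 * s) \<le> (16 * p) ^ s" by simp
  then have "rank_bound p K \<le> 92160 ^ s + (16 * p) ^ s"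
    unfolding rank_bound_def s_def[symmetric] using 1 by (rule_tac add_mono)
  also have "\<dots> \<le> B" unfolding B_def by (rule power_add_le[OF s(1)])
  finally have b: "rank_bound p K \<le> B" .
  have B1: "1 \<le> B" by (simp add: B_def)
  have "2 ^ s \<le> B" unfolding B_def by (rule power_mono) simp_all
  moreover have "(2 :: nat) ^ K \<le> 2 ^ s" using s by (simp add: power_increasing)
  ultimately have 2: "2 ^ K \<le> B" "s \<le> B" using s2 by linarith+
  have "radical_bound p (rank_bound p K) \<le> (p + 1) * B\<^sup>2 + p * ((p + 1) * B\<^sup>2)\<^sup>2"
    unfolding radical_bound_def by (intro add_mono mult_le_mono power_mono order_refl b) simp_all
  also have "\<dots> \<le> (p + 1) * B ^ 4 + p * ((p + 1) * B\<^sup>2)\<^sup>2"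
    by (intro add_mono mult_le_mono power_increasing B1 order_refl) simp
  also have "\<dots> = ((p + 1) + p * (p + 1)\<^sup>2) * B ^ 4" by (simp add: algebra_simps power2_eq_square eval_nat_numeral)
  also have "\<dots> \<le> (p + 1) ^ 3 * B ^ 4"
    by (intro mult_le_mono1) (simp add: power3_eq_cube power2_eq_square algebra_simps)
  finally have "(radical_bound p (rank_bound p K))\<^sup>2 * (rank_bound p K + 1) \<le> ((p + 1) ^ 3 * B ^ 4)\<^sup>2 * (B + B)"
    using b B1 by (intro mult_le_mono power_mono add_mono) auto
  also have "\<dots> = 2 * (p + 1) ^ 6 * B ^ 9" by (simp add: power_mult_distrib eval_nat_numeral algebra_simps)
  finally have 3: "(radical_bound p (rank_bound p K))\<^sup>2 * (rank_bound p K + 1) \<le> 2 * (p + 1) ^ 6 * B ^ 9" .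
  have B9: "B \<le> B ^ 9" "1 \<le> B ^ 9" using power_increasing[of 1 9 B] B1 by simp_all
  have "p * 2 ^ K \<le> p * B ^ 9" "4 * s \<le> 4 * B ^ 9" using 2 B9 by (auto intro: le_trans)
  then have "index_bound p K + 1 \<le> p * B ^ 9 + 4 * B ^ 9 + 2 * (p + 1) ^ 6 * B ^ 9 + B ^ 9"
    unfolding index_bound_def s_def[symmetric] using 3 B9(2) by linarith
  also have "\<dots> = (p + 5 + 2 * (p + 1) ^ 6) * ((92160 + 16 * p) ^ 9) ^ s"
    by (simp add: B_def algebra_simps flip: power_mult)
  \<comment> \<open>The leading constant is raised to the power \<open>s\<close> as well, because a
    bound exp (C' * L^2) leaves no room for a constant in front.\<close>
  also have "\<dots> \<le> (p + 5 + 2 * (p + 1) ^ 6) ^ s * ((92160 + 16 * p) ^ 9) ^ s"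
    using power_increasing[OF s(1), of "p + 5 + 2 * (p + 1) ^ 6"] by (intro mult_le_mono1) simp
  also have "\<dots> = bound_base p ^ s" by (simp add: bound_base_def power_mult_distrib)
  finally show ?thesis by (simp add: s_def)
qed

theorem theorem5:
  assumes "CHAR('p::prime_card mod_ring) > 4"
  shows "\<exists>C C' :: real. \<forall>(n::nat) (f :: 'p vfun) (\<delta>::real).
    fun_degree n f = 4 \<longrightarrow> gowers_norm n 4 f = \<delta> \<longrightarrow>
    (\<exists>(r::nat) (R::nat) (l :: nat \<Rightarrow> 'p vfun) (g :: nat \<Rightarrow> 'p vfun)
        (q :: nat \<Rightarrow> 'p vfun) (q' :: nat \<Rightarrow> 'p vfun).
      real r \<le> C * (ln (1 / \<delta>))\<^sup>2 \<and>
      real R \<le> exp (C' * (ln (1 / \<delta>))\<^sup>2) \<and>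
      (\<forall>i<R. fun_degree n (l i) \<le> 1 \<and> fun_degree n (g i) \<le> 3) \<and>
      (\<forall>i<r. fun_degree n (q i) \<le> 2 \<and> fun_degree n (q' i) \<le> 2) \<and>
      (\<forall>x\<in>carrier_vec n. f x = (\<Sum>i<R. l i x * g i x) + (\<Sum>i<r. q i x * q' i x)))"
proof -
  have p: "4 < CARD('p)" "prime CARD('p)" using assms prime_card by simp_all
  have nz24: "(24 :: 'p mod_ring) \<noteq> 0"
  proof
    assume "(24 :: 'p mod_ring) = 0"
    then have "of_nat 24 = (0 :: 'p mod_ring)" by simp
    then have "CARD('p) dvd 24" by (rule of_nat_0_mod_ring_dvd)
    then have "CARD('p) dvd 2 ^ 3 * 3" by simp
    then have "CARD('p) dvd 2 \<or> CARD('p) dvd 3"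
      using p(2) by (simp only: prime_dvd_mult_iff prime_dvd_power_iff)
    then show False using p(1) by (auto dest: dvd_imp_le)
  qed
  \<comment> \<open>With L = ln (1/\<delta>), the choice of \<open>K\<close> below gives K \<le> 3 +
    32 * L / ln 2, and L \<ge> ln (8/7) / 16 turns the 3 into 48 * L / ln (8/7). Hence K \<le> A *
    L.\<close>
  define A :: real where "A = 48 / ln (8 / 7) + 32 / ln 2"
  define E :: real where "E = real (bound_base CARD('p))"
  have "1 \<le> bound_base CARD('p)" by (simp add: bound_base_def Suc_le_eq)
  then have E: "1 \<le> E" unfolding E_def by linarith
  have "\<exists>r R l g q q'. real r \<le> (4 * A\<^sup>2) * (ln (1 / \<delta>))\<^sup>2 \<and>
      real R \<le> exp ((A\<^sup>2 * ln E) * (ln (1 / \<delta>))\<^sup>2) \<and>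
      (\<forall>i<R. fun_degree n (l i) \<le> 1 \<and> fun_degree n (g i) \<le> 3) \<and>
      (\<forall>i<r. fun_degree n (q i) \<le> 2 \<and> fun_degree n (q' i) \<le> 2) \<and>
      (\<forall>x\<in>carrier_vec n. f x = (\<Sum>i<R. l i x * g i x) + (\<Sum>i<r. q i x * q' i x))"
    if deg: "fun_degree n f = 4" and \<delta>: "gowers_norm n 4 f = \<delta>" for n \<delta> and f :: "'p vfun"
  proof -
    define \<epsilon> where "\<epsilon> = \<delta> ^ 16"
    define L where "L = ln (1 / \<delta>)"
    have \<delta>pos: "0 < \<delta>" and \<epsilon>_le: "\<epsilon> \<le> 7 / 8"
      and decomp: "\<And>K. 4 / \<epsilon>\<^sup>2 \<le> 2 ^ K \<Longrightarrow>
        \<exists>r R l g q q'. r \<le> 4 * K\<^sup>2 \<and> R \<le> index_bound CARD('p) K + 1 \<and>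
          (\<forall>i<R. fun_degree n (l i) \<le> 1 \<and> fun_degree n (g i) \<le> 3) \<and>
          (\<forall>i<r. fun_degree n (q i) \<le> 2 \<and> fun_degree n (q' i) \<le> 2) \<and>
          (\<forall>x\<in>carrier_vec n. f x = (\<Sum>i<R. l i x * g i x) + (\<Sum>i<r. q i x * q' i x))"
      using quartic_decomposition[OF deg nz24] unfolding \<delta> \<epsilon>_def by blast+
    have \<epsilon>pos: "0 < \<epsilon>" using \<delta>pos by (simp add: \<epsilon>_def)
    have ln\<epsilon>: "ln \<epsilon> = - 16 * L"
      using \<delta>pos by (simp add: \<epsilon>_def L_def ln_realpow ln_div)
    have ln78: "0 < ln (8 / 7 :: real)" "0 < ln (2 :: real)" by simp_all
    have "ln \<epsilon> \<le> ln (7 / 8)" using \<epsilon>_le \<epsilon>pos by simp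
    also have "ln (7 / 8 :: real) = - ln (8 / 7)" by (simp add: ln_div)
    finally have L: "ln (8 / 7) \<le> 16 * L" using ln\<epsilon> by simp
    define K where "K = nat \<lceil>log 2 (4 / \<epsilon>\<^sup>2)\<rceil>"
    have "4 / \<epsilon>\<^sup>2 = 2 powr log 2 (4 / \<epsilon>\<^sup>2)" using \<epsilon>pos by simp
    also have "\<dots> \<le> 2 powr real K" unfolding K_def by (intro powr_mono) linarith+
    also have "\<dots> = 2 ^ K" by (simp add: powr_realpow)
    finally have K: "4 / \<epsilon>\<^sup>2 \<le> 2 ^ K" .
    have "\<epsilon>\<^sup>2 \<le> 1" using \<epsilon>_le \<epsilon>pos by (simp add: power_le_one)
    then have "4 \<le> 4 / \<epsilon>\<^sup>2" using \<epsilon>pos by (simp add: field_simps)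
    then have "K \<noteq> 0" using K by (intro notI) simp
    then have K1: "1 \<le> K" by simp
    have log: "log 2 (4 / \<epsilon>\<^sup>2) = 2 + 32 * L / ln 2"
    proof -
      have "ln (4 / \<epsilon>\<^sup>2) = 2 * ln 2 + 32 * L"
        using \<epsilon>pos ln\<epsilon> ln_realpow[of 2 2] by (simp add: ln_div ln_realpow)
      then show ?thesis by (simp add: log_def add_divide_distrib)
    qed
    have "0 \<le> L" using L ln78 by linarith
    then have "0 \<le> log 2 (4 / \<epsilon>\<^sup>2)" unfolding log using ln78 by simp
    then have "real K \<le> log 2 (4 / \<epsilon>\<^sup>2) + 1" unfolding K_def by linarith
    moreover have "3 \<le> 48 / ln (8 / 7) * L" using L ln78 by (simp add: field_simps)
    ultimately have KA: "real K \<le> A * L" by (simp add: log A_def distrib_right)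
    have sq: "(real K)\<^sup>2 \<le> A\<^sup>2 * L\<^sup>2" using power_mono[OF KA, of 2] by (simp add: power_mult_distrib)
    obtain r R l g q q' where r: "r \<le> 4 * K\<^sup>2" and R: "R \<le> index_bound CARD('p) K + 1"
      and rest: "\<forall>i<R. fun_degree n (l i) \<le> 1 \<and> fun_degree n (g i) \<le> 3"
        "\<forall>i<r. fun_degree n (q i) \<le> 2 \<and> fun_degree n (q' i) \<le> 2"
        "\<forall>x\<in>carrier_vec n. f x = (\<Sum>i<R. l i x * g i x) + (\<Sum>i<r. q i x * q' i x)"
      using decomp[OF K] by blast
    have "real r \<le> real (4 * K\<^sup>2)" using r by (simp only: of_nat_le_iff)
    then have r': "real r \<le> (4 * A\<^sup>2) * L\<^sup>2" using sq by simp
    have "R \<le> bound_base CARD('p) ^ K\<^sup>2"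
      using R index_bound_le[OF K1, of "CARD('p)"] p(1) by simp
    then have "real R \<le> real (bound_base CARD('p) ^ K\<^sup>2)" by (simp only: of_nat_le_iff)
    also have "\<dots> = E ^ K\<^sup>2" by (simp add: E_def)
    also have "\<dots> = exp (real (K\<^sup>2) * ln E)" using E by (subst exp_of_nat_mult) simp
    also have "\<dots> \<le> exp ((A\<^sup>2 * ln E) * L\<^sup>2)"
      using mult_right_mono[OF sq, of "ln E"] E by (simp add: mult_ac)
    finally have R': "real R \<le> exp ((A\<^sup>2 * ln E) * L\<^sup>2)" .
    show ?thesis using r' R' rest unfolding L_def
      by (intro exI[of _ r] exI[of _ R] exI[of _ l] exI[of _ g] exI[of _ q] exI[of _ q'] conjI)
  qed
  then show ?thesis by (intro exI[of _ "4 * A\<^sup>2"] exI[of _ "A\<^sup>2 * ln E"] allI impI)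
qed

end
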